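(* Let $(\mathcal S,\mathcal M,\Delta_s^* )$ be a marked surface with a simple coordinate and let $\alpha$ be a zigzag $\circ$-arc whose endpoints $p$ and $q$ lie on the boundary. Let $\mathbb P=\{\ell_1^*,\dots,\ell_n^*\}$ and $\mathbb P'=\{\iota_1^*,\dots,\iota_m^*\}$ be the polygons of $\Delta_s^*$ containing $p$ and $q$ respectively (edges labelled clockwise). Let $\sigma=\sigma_1\sigma_2\cdots\sigma_r$ ($r\ge1$) be the string associated to $\alpha$, directed from $p$ to $q$, decomposed into maximal direct or inverse substrings $\sigma_i$, and let $\nu_i^*$ be the endpoint of $\sigma_i$, $1\le i\le r$. Put $a=n-w_p(\alpha)$ and $b=m-w_q(\alpha)$, where $w_p(\alpha)$, $w_q(\alpha)$ are the weights of $\alpha$ at $p$ and $q$. Then the minimal projective resolution $P^\bullet_\alpha$ of $M_\alpha$ is given as follows (projectives in the same degree are to be put together). (1) If $\sigma_1$ is direct and $\sigma_r$ is inverse: $$P_{t(\ell_n)}\to\cdots\to P_{t(\ell_{a})}\leftarrow P_{t(\nu_1)}\to P_{t(\nu_2)}\leftarrow P_{t(\nu_3)}\to\cdots\to P_{t(\nu_{r-2})}\leftarrow P_{t(\nu_{r-1})}\to P_{t(\iota_{b})}\leftarrow\cdots\leftarrow P_{t(\iota_m)}.$$ (2) If $\sigma_1$ and $\sigma_r$ are both direct: $$P_{t(\ell_n)}\to\cdots\to P_{t(\ell_{a})}\leftarrow P_{t(\nu_1)}\to P_{t(\nu_2)}\leftarrow P_{t(\nu_3)}\to\cdots\leftarrow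 P_{t(\nu_{r-2})}\to P_{t(\nu_{r-1})}\leftarrow P_{t(\iota_{b+1})}\leftarrow\cdots\leftarrow P_{t(\iota_m)}.$$ (3) If $\sigma_1$ and $\sigma_r$ are both inverse: $$P_{t(\ell_n)}\to\cdots\to P_{t(\ell_{a+1})}\to P_{t(\nu_1)}\leftarrow P_{t(\nu_2)}\to P_{t(\nu_3)}\leftarrow\cdots\to P_{t(\nu_{r-2})}\leftarrow P_{t(\nu_{r-1})}\to P_{t(\iota_{b})}\leftarrow\cdots\leftarrow P_{t(\iota_m)}.$$ (4) If $\sigma_1$ is inverse and $\sigma_r$ is direct: $$P_{t(\ell_n)}\to\cdots\to P_{t(\ell_{a+1})}\to P_{t(\nu_1)}\leftarrow P_{t(\nu_2)}\to P_{t(\nu_3)}\leftarrow\cdots\leftarrow P_{t(\nu_{r-2})}\to P_{t(\nu_{r-1})}\leftarrow P_{t(\iota_{b+1})}\leftarrow\cdots\leftarrow P_{t(\iota_m)}.$$ Here all maps are induced by the associated paths in the quiver; in cases (1)–(4) the middle part is $P_{t(\nu_1)},\dots,P_{t(\nu_{r-1})}$ with alternating arrows (empty if $r=1$), and the parts $P_{t(\ell_n)}\to\cdots\to P_{t(\ell_{a+1})}$ and $P_{t(\iota_{b+1})}\leftarrow\cdots\leftarrow P_{t(\iota_m)}$ are empty if $w_p(\alpha)=0$, resp. $w_q(\alpha)=0$.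
   Context: **Algebra conventions.** $k$ is an algebraically closed field, modules are finite-dimensional right modules, paths compose from left to right. String modules of a gentle algebra are the usual ones (Butler–Ringel). For a vertex $v$ of the quiver of $A$, $P_v=e_vA$; a path $u\to v$ induces a map $P_v\to P_u$. A direct (inverse) string consists of arrows (formal inverses). **Surfaces.** A marked surface $(\mathcal S,\mathcal M)$ is an oriented surface with non-empty boundary with finitely many components and a finite set $\mathcal M=\mathcal M_\circ\cup\mathcal M_\bullet\cup\mathcal P_\circ$: $\mathcal M_\circ,\mathcal M_\bullet\subset\partial\mathcal S$, each boundary component contains at least one point of each, alternating; $\mathcal P_\circ$ (punctures, of type $\circ$) lies in the interior. Curves are considered up to homotopy with respect to boundary components and punctures, and are in minimal position. Following a boundary component clockwise, the interior is on the right. A $\circ$-arc is a non-contractible curve with endpoints in $\mathcal M_\circ\cup\mathcal P_\circ$, a $\bullet$-arc has endpoints in $\mathcal M_\bullet$; simple means no interior self-intersection. **Simple coordinate.** A simple coordinate $\Delta_s^*$ is a collection of simple $\bullet$-arcs without interior intersections cutting the surface into polygons each containing exactly one point of $\mathcal M_\circ\cup\mathcal P_\circ$. The edges of a polygon in $\Delta_s^*$ are listed clockwise, starting after the boundary edge if it contains a point of $\mathcal M_\circ$, cyclically if it contains a puncture; this defines predecessors and successors. $A=A(\Delta_s^* )$ is the gentle algebra with vertices the arcs of $\Delta_s^*$, arrows the minimal anti-clockwise interior angles between arcs at a common endpoint (so from an edge of a polygon to its successor), relations the paths $ab$ where the common endpoints giving $a$ and $b$ are different. For $\ell^*\in\Delta_s^*$,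 $\ell$ denotes its dual $\circ$-arc in the dual simple dissection (crossing only $\ell^*$), and $t(\ell)$ its twist, obtained by moving boundary endpoints clockwise to the next marked point of the boundary component and keeping punctures. The vertex $\ell^*$ of $Q(\Delta_s^* )$ is identified with $t(\ell)$, so $P_{t(\ell)}$ is the indecomposable projective $A$-module at the vertex $\ell^*$. **Zigzag arcs, modules.** Let $\alpha$ be a directed $\circ$-arc crossing successively arcs $\kappa_0^*,\dots,\kappa_s^*$ of $\Delta_s^*$. It is a zigzag arc if in each polygon traversed from $\kappa_i^*$ to $\kappa_{i+1}^*$, $\kappa_{i+1}^*$ is the predecessor or successor of $\kappa_i^*$, and, if the polygon contains a puncture and has a number of edges $\ne2$, the puncture is not in the triangle formed by the segments of $\kappa_i^*,\kappa_{i+1}^*,\alpha$ (for a punctured bigon it may be in either of the two triangles). The corner of the triangle without puncture gives an arrow between $\kappa_i^*$ and $\kappa_{i+1}^*$; reading this arrow if it goes from $\kappa_i^*$ to $\kappa_{i+1}^*$ and its formal inverse otherwise gives the string associated to $\alpha$, from $\kappa_0^*$ to $\kappa_s^*$; $M_\alpha$ is its string module. **Weights.** If $q\in\mathcal M_\circ$ is an endpoint of $\alpha$ in a polygon $\{\ell_1^*,\dots,\ell_n^*\}$ of $\Delta_s^*$ with edges labelled clockwise and $\ell_t^*$ is the first arc of $\Delta_s^*$ that $\alpha$ crosses starting from $q$, the weight of $\alpha$ at $q$ is $w_q(\alpha)=n-t$. **Complex notation.** A diagram as in the claim stands for the complex whose terms are the direct sums of displayed projectives of equal degree, where each displayed map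 is a component of the differential (raising degree by one) and the maximal degree is $0$. $P^\bullet_\alpha$ denotes the canonical projective complex of $\alpha$: it is the complex obtained from the successive crossings of $\alpha$ with $\Delta_p^*=\{t(\ell):\ell^*\in\Delta_s^*\}$, with the corresponding projectives joined by the paths given by the polygons of $\Delta_p^*$ traversed; it is the minimal projective resolution of $M_\alpha$. *)

theory Defs
  imports
    "HOL-Complex_Analysis.Winding_Numbers"
    "HOL-Computational_Algebra.Polynomial"
    "HOL-Library.Function_Algebras"
    "Graph_Theory.Arc_Walk"
begin

section \<open>Oriented surfaces with marked points\<close>

definition half_plane :: "complex set" where
  "half_plane = {z. 0 \<le> Im z}"

definition surface_chart :: "'p topology \<Rightarrow> 'p set \<Rightarrow> ('p \<Rightarrow> complex) \<Rightarrow> bool" where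
  "surface_chart X U \<phi> \<longleftrightarrow> openin X U \<and> openin (top_of_set half_plane) (\<phi> ` U) \<and>
     homeomorphic_map (subtopology X U) (top_of_set (\<phi> ` U)) \<phi>"

text \<open>Local degree one, for maps that are continuous and injective near the point.\<close>

definition orientation_preserving_at :: "(complex \<Rightarrow> complex) \<Rightarrow> complex \<Rightarrow> bool" where
  "orientation_preserving_at f z \<longleftrightarrow>
     (\<exists>\<epsilon>>0. \<forall>r. 0 < r \<and> r < \<epsilon> \<longrightarrow> winding_number (f \<circ> circlepath z r) (f z) = 1)"

definition surface_boundary :: "('p set \<times> ('p \<Rightarrow> complex)) set \<Rightarrow> 'p set" where
  "surface_boundary \<A> = {x. \<exists>(U, \<phi>) \<in> \<A>. x \<in> U \<and> Im (\<phi> x) = 0}"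

locale oriented_surface =
  fixes X :: "'p topology" and \<A> :: "('p set \<times> ('p \<Rightarrow> complex)) set"
  assumes hausdorff: "Hausdorff_space X"
    and countable_base: "\<exists>\<B>. countable \<B> \<and> (\<forall>V\<in>\<B>. openin X V) \<and>
          (\<forall>U x. openin X U \<and> x \<in> U \<longrightarrow> (\<exists>V\<in>\<B>. x \<in> V \<and> V \<subseteq> U))"
    and charts: "\<And>U \<phi>. (U, \<phi>) \<in> \<A> \<Longrightarrow> surface_chart X U \<phi>"
    and cover: "topspace X = (\<Union>(U, \<phi>)\<in>\<A>. U)"
    and oriented: "\<And>U \<phi> V \<psi> x. (U, \<phi>) \<in> \<A> \<Longrightarrow> (V, \<psi>) \<in> \<A> \<Longrightarrow> x \<in> U \<inter> V \<Longrightarrow> 0 < Im (\<phi> x) \<Longrightarrow>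
          orientation_preserving_at (\<psi> \<circ> inv_into U \<phi>) (\<phi> x)"

record 'p marked_surface =
  space_of :: "'p topology"
  atlas_of :: "('p set \<times> ('p \<Rightarrow> complex)) set"
  white_points :: "'p set"  \<comment> \<open>marked points of type \<open>\<circ>\<close> on the boundary\<close>
  black_points :: "'p set"  \<comment> \<open>marked points of type \<open>\<bullet>\<close>\<close>
  punctures :: "'p set"

abbreviation boundary_of :: "'p marked_surface \<Rightarrow> 'p set" where
  "boundary_of S \<equiv> surface_boundary (atlas_of S)"

definition boundary_components :: "'p marked_surface \<Rightarrow> 'p set set" where
  "boundary_components S = connected_components_of (subtopology (space_of S) (boundary_of S))"

text \<open>Marked points alternate on a boundary component \<open>C\<close> iff each of the intervals into which \<open>C\<close>
  is divided by its points of one colour contains exactly one point of the other colour.\<close>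

locale is_marked_surface = oriented_surface "space_of S" "atlas_of S"
  for S :: "'p marked_surface" +
  assumes boundary_nonempty: "boundary_of S \<noteq> {}"
    and finite_boundary_components: "finite (boundary_components S)"
    and finite_marked: "finite (white_points S)" "finite (black_points S)" "finite (punctures S)"
    and white_boundary: "white_points S \<subseteq> boundary_of S"
    and black_boundary: "black_points S \<subseteq> boundary_of S"
    and white_black_disjoint: "white_points S \<inter> black_points S = {}"
    and punctures_interior: "punctures S \<subseteq> topspace (space_of S) - boundary_of S"
    and component_marked: "\<And>C. C \<in> boundary_components S \<Longrightarrow>
          C \<inter> white_points S \<noteq> {} \<and> C \<inter> black_points S \<noteq> {}"
    and alternating: "\<And>C D. C \<in> boundary_components S \<Longrightarrow>
            D \<in> connected_components_of (subtopology (space_of S) (C - white_points S)) \<Longrightarrow>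
            \<exists>!x. x \<in> D \<inter> black_points S"
          "\<And>C D. C \<in> boundary_components S \<Longrightarrow>
            D \<in> connected_components_of (subtopology (space_of S) (C - black_points S)) \<Longrightarrow>
            \<exists>!x. x \<in> D \<inter> white_points S"


section \<open>Arcs\<close>

type_synonym 'p curve = "real \<Rightarrow> 'p"

definition inner_points :: "'p marked_surface \<Rightarrow> 'p set" where
  "inner_points S = topspace (space_of S) - boundary_of S - punctures S"

definition is_curve :: "'p marked_surface \<Rightarrow> 'p curve \<Rightarrow> bool" where
  "is_curve S f \<longleftrightarrow> pathin (space_of S) f \<and> f ` {0<..<1} \<subseteq> inner_points S"

definition homotopic_curves :: "'p marked_surface \<Rightarrow> 'p curve \<Rightarrow> 'p curve \<Rightarrow> bool" where
  "homotopic_curves S f g \<longleftrightarrow>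
     homotopic_with (\<lambda>h. h 0 = f 0 \<and> h 1 = f 1 \<and> h ` {0<..<1} \<subseteq> inner_points S)
       (top_of_set {0..1}) (space_of S) f g"

text \<open>The base point is exempted from the punctures to be avoided, so that loops based at a
  puncture are covered as well.\<close>

definition contractible_curve :: "'p marked_surface \<Rightarrow> 'p curve \<Rightarrow> bool" where
  "contractible_curve S f \<longleftrightarrow> f 0 = f 1 \<and>
     homotopic_with (\<lambda>h. h 0 = f 0 \<and> h 1 = f 0 \<and> h ` {0..1} \<inter> (punctures S - {f 0}) = {})
       (top_of_set {0..1}) (space_of S) f (\<lambda>_. f 0)"

definition white_arc :: "'p marked_surface \<Rightarrow> 'p curve \<Rightarrow> bool" where
  "white_arc S \<alpha> \<longleftrightarrow> is_curve S \<alpha> \<and> \<not> contractible_curve S \<alpha> \<and>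
     \<alpha> 0 \<in> white_points S \<union> punctures S \<and> \<alpha> 1 \<in> white_points S \<union> punctures S"

definition black_arc :: "'p marked_surface \<Rightarrow> 'p curve \<Rightarrow> bool" where
  "black_arc S \<kappa> \<longleftrightarrow> is_curve S \<kappa> \<and> \<not> contractible_curve S \<kappa> \<and>
     \<kappa> 0 \<in> black_points S \<and> \<kappa> 1 \<in> black_points S"

definition simple_curve :: "'p curve \<Rightarrow> bool" where
  "simple_curve f \<longleftrightarrow> inj_on f {0<..<1}"

definition crossing_times :: "'p curve set \<Rightarrow> 'p curve \<Rightarrow> real set" where
  "crossing_times \<Delta> f = {t \<in> {0<..<1}. f t \<in> (\<Union>\<kappa>\<in>\<Delta>. \<kappa> ` {0..1})}"

definition minimal_position :: "'p marked_surface \<Rightarrow> 'p curve set \<Rightarrow> 'p curve \<Rightarrow> bool" where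
  "minimal_position S \<Delta> f \<longleftrightarrow> finite (crossing_times \<Delta> f) \<and>
     (\<forall>g. homotopic_curves S f g \<and> finite (crossing_times \<Delta> g) \<longrightarrow>
        card (crossing_times \<Delta> f) \<le> card (crossing_times \<Delta> g))"


section \<open>Simple coordinates\<close>

text \<open>A polygon is parametrised by a map from the closed unit disc. Its edges are listed clockwise
  as pairs \<open>(\<kappa>, d)\<close>, where \<open>d\<close> tells whether walking clockwise along the edge follows the
  direction of the curve \<open>\<kappa>\<close>. An arc both of whose sides lie in the polygon is listed twice.
  The circle is divided into as many equal parts as there are sides; if the polygon is not punctured,
  part number \<open>0\<close> is the boundary edge, and in all cases part number \<open>i\<close>, for
  \<open>1 \<le> i \<le> n\<close>, is the \<open>i\<close>-th edge.\<close>

record 'p polygon =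
  param :: "complex \<Rightarrow> 'p"
  edges :: "('p curve \<times> bool) list"
  punctured :: bool

definition num_edges :: "'p polygon \<Rightarrow> nat" where
  "num_edges P = length (edges P)"

definition edge :: "'p polygon \<Rightarrow> nat \<Rightarrow> 'p curve \<times> bool" where
  "edge P i = edges P ! (i - 1)"

definition edge_arc :: "'p polygon \<Rightarrow> nat \<Rightarrow> 'p curve" where
  "edge_arc P i = fst (edge P i)"

definition num_sides :: "'p polygon \<Rightarrow> nat" where
  "num_sides P = (if punctured P then num_edges P else num_edges P + 1)"

definition side :: "'p polygon \<Rightarrow> nat \<Rightarrow> real \<Rightarrow> complex" where
  "side P i t = cis (- 2 * pi * (real i + t) / real (num_sides P))"

definition traverse :: "'p curve \<times> bool \<Rightarrow> 'p curve" where
  "traverse e t = (if snd e then fst e t else fst e (1 - t))"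

locale polygon_in =
  fixes S :: "'p marked_surface" and P :: "'p polygon"
  assumes param_cont: "continuous_map (top_of_set (cball 0 1)) (space_of S) (param P)"
    and param_inj: "inj_on (param P) (ball 0 1)"
    and param_oriented: "\<And>z U \<phi>. z \<in> ball 0 1 \<Longrightarrow> (U, \<phi>) \<in> atlas_of S \<Longrightarrow> param P z \<in> U \<Longrightarrow>
          orientation_preserving_at (\<phi> \<circ> param P) z"
    and edges: "\<And>i t. 1 \<le> i \<Longrightarrow> i \<le> num_edges P \<Longrightarrow> t \<in> {0..1} \<Longrightarrow>
          param P (side P i t) = traverse (edge P i) t"
    and punctured_polygon: "punctured P \<Longrightarrow>
          1 \<le> num_edges P \<and> (\<exists>!z. z \<in> ball 0 1 \<and> param P z \<in> punctures S)"
    and unpunctured_polygon: "\<not> punctured P \<Longrightarrow>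
          param P ` ball 0 1 \<inter> punctures S = {} \<and>
          param P ` side P 0 ` {0..1} \<subseteq> boundary_of S \<and>
          inj_on (param P \<circ> side P 0) {0<..<1} \<and>
          param P (side P 0 0) \<in> black_points S \<and> param P (side P 0 1) \<in> black_points S \<and>
          param P ` side P 0 ` {0<..<1} \<inter> black_points S = {} \<and>
          (\<exists>!t. t \<in> {0<..<1} \<and> param P (side P 0 t) \<in> white_points S)"

text \<open>Cutting along an arc produces two copies of it, one in the polygon on its right (which is
  traversed in the direction of the arc when going clockwise around the polygon) and one in the
  polygon on its left. The open polygons are the components of what remains of the interior.\<close>

locale simple_coordinate = is_marked_surface S
  for S :: "'p marked_surface" and \<Delta> :: "'p curve set" and \<P> :: "'p polygon set" +
  assumes finite_arcs: "finite \<Delta>"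
    and finite_polygons: "finite \<P>"
    and arcs: "\<And>\<kappa>. \<kappa> \<in> \<Delta> \<Longrightarrow> black_arc S \<kappa> \<and> simple_curve \<kappa>"
    and arcs_disjoint: "\<And>\<kappa> \<kappa>'. \<kappa> \<in> \<Delta> \<Longrightarrow> \<kappa>' \<in> \<Delta> \<Longrightarrow> \<kappa> \<noteq> \<kappa>' \<Longrightarrow>
          \<kappa> ` {0<..<1} \<inter> \<kappa>' ` {0<..<1} = {}"
    and polygons: "\<And>P. P \<in> \<P> \<Longrightarrow> polygon_in S P"
    and polygon_edges: "\<And>P i. P \<in> \<P> \<Longrightarrow> 1 \<le> i \<Longrightarrow> i \<le> num_edges P \<Longrightarrow> edge_arc P i \<in> \<Delta>"
    and cut_components: "bij_betw (\<lambda>P. param P ` ball 0 1) \<P>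
          (connected_components_of (subtopology (space_of S)
             (topspace (space_of S) - boundary_of S - (\<Union>\<kappa>\<in>\<Delta>. \<kappa> ` {0..1}))))"
    and cut_sides: "\<And>\<kappa> d. \<kappa> \<in> \<Delta> \<Longrightarrow>
          \<exists>!(P, i). P \<in> \<P> \<and> 1 \<le> i \<and> i \<le> num_edges P \<and> edge P i = (\<kappa>, d)"

definition next_edge :: "'p polygon \<Rightarrow> nat \<Rightarrow> nat" where
  "next_edge P i = (if i < num_edges P then i + 1 else 1)"

definition has_next :: "'p polygon \<Rightarrow> nat \<Rightarrow> bool" where
  "has_next P i \<longleftrightarrow> 1 \<le> i \<and> i \<le> num_edges P \<and> (punctured P \<or> i < num_edges P)"


section \<open>Modules over bound quivers with quadratic monomial relations\<close>

text \<open>All vector spaces are subspaces of spaces \<open>'b \<Rightarrow> 'k\<close> with pointwise operations.\<close>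

definition fscale :: "'k::field \<Rightarrow> ('b \<Rightarrow> 'k) \<Rightarrow> 'b \<Rightarrow> 'k" where
  "fscale c f = (\<lambda>x. c * f x)"

global_interpretation fun_space: vector_space "fscale :: 'k::field \<Rightarrow> ('b \<Rightarrow> 'k) \<Rightarrow> 'b \<Rightarrow> 'k"
  defines fun_subspace = fun_space.subspace and fun_span = fun_space.span
  by unfold_locales (auto simp: fscale_def algebra_simps fun_eq_iff)

record ('x, 'k) alg =
  acarrier :: "('x \<Rightarrow> 'k) set"
  amult :: "('x \<Rightarrow> 'k) \<Rightarrow> ('x \<Rightarrow> 'k) \<Rightarrow> 'x \<Rightarrow> 'k"
  aone :: "'x \<Rightarrow> 'k"

record ('b, 'x, 'k) rmod =
  mcarrier :: "('b \<Rightarrow> 'k) set"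
  mact :: "('b \<Rightarrow> 'k) \<Rightarrow> ('x \<Rightarrow> 'k) \<Rightarrow> 'b \<Rightarrow> 'k"

locale right_module =
  fixes A :: "('x, 'k::field) alg" and M :: "('b, 'x, 'k) rmod"
  assumes subspace: "fun_subspace (mcarrier M)"
    and act_closed: "m \<in> mcarrier M \<Longrightarrow> x \<in> acarrier A \<Longrightarrow> mact M m x \<in> mcarrier M"
    and act_add_left: "m \<in> mcarrier M \<Longrightarrow> m' \<in> mcarrier M \<Longrightarrow> x \<in> acarrier A \<Longrightarrow>
          mact M (m + m') x = mact M m x + mact M m' x"
    and act_add_right: "m \<in> mcarrier M \<Longrightarrow> x \<in> acarrier A \<Longrightarrow> y \<in> acarrier A \<Longrightarrow>
          mact M m (x + y) = mact M m x + mact M m y"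
    and act_scale_left: "m \<in> mcarrier M \<Longrightarrow> x \<in> acarrier A \<Longrightarrow>
          mact M (fscale c m) x = fscale c (mact M m x)"
    and act_scale_right: "m \<in> mcarrier M \<Longrightarrow> x \<in> acarrier A \<Longrightarrow>
          mact M m (fscale c x) = fscale c (mact M m x)"
    and act_mult: "m \<in> mcarrier M \<Longrightarrow> x \<in> acarrier A \<Longrightarrow> y \<in> acarrier A \<Longrightarrow>
          mact M m (amult A x y) = mact M (mact M m x) y"
    and act_one: "m \<in> mcarrier M \<Longrightarrow> mact M m (aone A) = m"

definition fd_module :: "('x, 'k::field) alg \<Rightarrow> ('b, 'x, 'k) rmod \<Rightarrow> bool" where
  "fd_module A M \<longleftrightarrow> right_module A M \<and> (\<exists>B. finite B \<and> mcarrier M \<subseteq> fun_span B)"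

definition module_hom :: "('x, 'k::field) alg \<Rightarrow> ('b, 'x, 'k) rmod \<Rightarrow> ('c, 'x, 'k) rmod \<Rightarrow>
    (('b \<Rightarrow> 'k) \<Rightarrow> 'c \<Rightarrow> 'k) \<Rightarrow> bool" where
  "module_hom A M N f \<longleftrightarrow>
     (\<forall>m\<in>mcarrier M. f m \<in> mcarrier N) \<and>
     (\<forall>m\<in>mcarrier M. \<forall>m'\<in>mcarrier M. f (m + m') = f m + f m') \<and>
     (\<forall>c. \<forall>m\<in>mcarrier M. f (fscale c m) = fscale c (f m)) \<and>
     (\<forall>m\<in>mcarrier M. \<forall>x\<in>acarrier A. f (mact M m x) = mact N (f m) x)"

text \<open>Projectivity in the category of finite-dimensional right modules; each of those is isomorphic
  to one whose elements are functions on \<open>nat\<close>.\<close>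

definition projective_module :: "('x, 'k::field) alg \<Rightarrow> ('b, 'x, 'k) rmod \<Rightarrow> bool" where
  "projective_module A P \<longleftrightarrow> fd_module A P \<and>
     (\<forall>(N :: (nat, 'x, 'k) rmod) (N' :: (nat, 'x, 'k) rmod) g f.
        fd_module A N \<and> fd_module A N' \<and> module_hom A N N' g \<and> g ` mcarrier N = mcarrier N' \<and>
        module_hom A P N' f \<longrightarrow>
        (\<exists>h. module_hom A P N h \<and> (\<forall>x\<in>mcarrier P. g (h x) = f x)))"

definition submodule :: "('x, 'k::field) alg \<Rightarrow> ('b, 'x, 'k) rmod \<Rightarrow> ('b \<Rightarrow> 'k) set \<Rightarrow> bool" where
  "submodule A M U \<longleftrightarrow> U \<subseteq> mcarrier M \<and> fun_subspace U \<and>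
     (\<forall>u\<in>U. \<forall>x\<in>acarrier A. mact M u x \<in> U)"

definition superfluous :: "('x, 'k::field) alg \<Rightarrow> ('b, 'x, 'k) rmod \<Rightarrow> ('b \<Rightarrow> 'k) set \<Rightarrow> bool" where
  "superfluous A M K \<longleftrightarrow> submodule A M K \<and>
     (\<forall>U. submodule A M U \<and> {u + v | u v. u \<in> U \<and> v \<in> K} = mcarrier M \<longrightarrow> U = mcarrier M)"

definition hom_kernel :: "('b, 'x, 'k::field) rmod \<Rightarrow> (('b \<Rightarrow> 'k) \<Rightarrow> 'c \<Rightarrow> 'k) \<Rightarrow> ('b \<Rightarrow> 'k) set" where
  "hom_kernel M f = {m \<in> mcarrier M. f m = 0}"

definition projective_cover :: "('x, 'k::field) alg \<Rightarrow> ('b, 'x, 'k) rmod \<Rightarrow>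
    (('b \<Rightarrow> 'k) \<Rightarrow> 'c \<Rightarrow> 'k) \<Rightarrow> ('c \<Rightarrow> 'k) set \<Rightarrow> bool" where
  "projective_cover A P f U \<longleftrightarrow>
     projective_module A P \<and> f ` mcarrier P = U \<and> superfluous A P (hom_kernel P f)"

text \<open>\<open>C i\<close> is the term in degree \<open>-i\<close>, and \<open>d i\<close> maps it, for \<open>i > 0\<close>,
  to the term in degree \<open>-i + 1\<close>; \<open>\<epsilon>\<close> is the augmentation.\<close>

definition minimal_projective_resolution :: "('x, 'k::field) alg \<Rightarrow> (nat \<Rightarrow> ('b, 'x, 'k) rmod) \<Rightarrow>
    (nat \<Rightarrow> ('b \<Rightarrow> 'k) \<Rightarrow> 'b \<Rightarrow> 'k) \<Rightarrow> (('b \<Rightarrow> 'k) \<Rightarrow> 'c \<Rightarrow> 'k) \<Rightarrow> ('c, 'x, 'k) rmod \<Rightarrow> bool" where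
  "minimal_projective_resolution A C d \<epsilon> M \<longleftrightarrow> fd_module A M \<and>
     module_hom A (C 0) M \<epsilon> \<and>
     projective_cover A (C 0) \<epsilon> (mcarrier M) \<and>
     (\<forall>i. module_hom A (C (Suc i)) (C i) (d (Suc i))) \<and>
     projective_cover A (C 1) (d 1) (hom_kernel (C 0) \<epsilon>) \<and>
     (\<forall>i\<ge>1. projective_cover A (C (Suc i)) (d (Suc i)) (hom_kernel (C i) (d i)))"

subsection \<open>The algebra and its projective modules\<close>

text \<open>A path is given by its starting vertex and its list of arrows. Arrows are composed from left
  to right. Let \<open>R\<close> be a set of paths of length two. The residue classes of the paths that have no
  subpath in \<open>R\<close> form a basis of the quotient of the path algebra by the ideal generated
  by \<open>R\<close>, and the product of two of them is their concatenation if this is again such a path,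
  and zero otherwise.\<close>

type_synonym ('v, 'a) qpath = "'v \<times> 'a list"

definition path_end :: "('v, 'a) pre_digraph \<Rightarrow> ('v, 'a) qpath \<Rightarrow> 'v" where
  "path_end Q w = pre_digraph.awlast Q (fst w) (snd w)"

definition path_append :: "('v, 'a) qpath \<Rightarrow> ('v, 'a) qpath \<Rightarrow> ('v, 'a) qpath" where
  "path_append w w' = (fst w, snd w @ snd w')"

definition nonzero_paths :: "('v, 'a) pre_digraph \<Rightarrow> ('a \<times> 'a) set \<Rightarrow> ('v, 'a) qpath set" where
  "nonzero_paths Q R = {w. pre_digraph.awalk Q (fst w) (snd w) (path_end Q w) \<and>
     successively (\<lambda>a b. (a, b) \<notin> R) (snd w)}"

definition bound_quiver_algebra ::
    "('v, 'a) pre_digraph \<Rightarrow> ('a \<times> 'a) set \<Rightarrow> (('v, 'a) qpath, 'k::field) alg" where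
  "bound_quiver_algebra Q R =
     \<lparr>acarrier = {x. finite {w. x w \<noteq> 0} \<and> {w. x w \<noteq> 0} \<subseteq> nonzero_paths Q R},
      amult = (\<lambda>x y w. if w \<in> nonzero_paths Q R
         then \<Sum>i\<le>length (snd w). x (fst w, take i (snd w)) *
                y (path_end Q (fst w, take i (snd w)), drop i (snd w))
         else 0),
      aone = (\<lambda>w. if fst w \<in> verts Q \<and> snd w = [] then 1 else 0)\<rparr>"

definition path_elem :: "('v, 'a) qpath \<Rightarrow> ('v, 'a) qpath \<Rightarrow> 'k::field" where
  "path_elem w = (\<lambda>w'. if w' = w then 1 else 0)"

definition indec_projective ::
    "(('v, 'a) qpath, 'k::field) alg \<Rightarrow> 'v \<Rightarrow> (('v, 'a) qpath, ('v, 'a) qpath, 'k) rmod" where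
  "indec_projective A v =
     \<lparr>mcarrier = amult A (path_elem (v, [])) ` acarrier A, mact = amult A\<rparr>"

subsection \<open>Complexes given by diagrams of projectives\<close>

text \<open>A diagram is a list of vertices \<open>v\<^sub>0, v\<^sub>1, \<dots>\<close>, standing for the corresponding projectives, and
  a list of links, the \<open>s\<close>-th one joining \<open>v\<^sub>s\<close> and \<open>v\<^sub>s\<^sub>+\<^sub>1\<close>. It is labelled by the path inducing the
  displayed map; a path \<open>w\<close> from \<open>u\<close> to \<open>v\<close> induces the map from the projective at \<open>v\<close> to the
  projective at \<open>u\<close> that multiplies by \<open>w\<close> from the left.\<close>

datatype 'w link = Rightwards 'w | Leftwards 'w

definition relative_degree :: "'w link list \<Rightarrow> nat \<Rightarrow> int" where
  "relative_degree L s = (\<Sum>i<s. case L ! i of Rightwards _ \<Rightarrow> 1 | Leftwards _ \<Rightarrow> -1)"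

definition node_degree :: "'v list \<Rightarrow> 'w link list \<Rightarrow> nat \<Rightarrow> int" where
  "node_degree V L s = relative_degree L s - Max (relative_degree L ` {..<length V})"

text \<open>The term in degree \<open>-d\<close>.\<close>

definition diagram_term :: "(('v, 'a) qpath, 'k::field) alg \<Rightarrow> 'v list \<Rightarrow> ('v, 'a) qpath link list \<Rightarrow>
    nat \<Rightarrow> (nat \<times> ('v, 'a) qpath, ('v, 'a) qpath, 'k) rmod" where
  "diagram_term A V L d =
     \<lparr>mcarrier = {f. \<forall>s. if s < length V \<and> node_degree V L s = - int d
         then (\<lambda>w. f (s, w)) \<in> mcarrier (indec_projective A (V ! s))
         else (\<lambda>w. f (s, w)) = 0},
      mact = (\<lambda>f x (s, w). amult A (\<lambda>w'. f (s, w')) x w)\<rparr>"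

definition diagram_diff :: "(('v, 'a) qpath, 'k::field) alg \<Rightarrow> ('v, 'a) qpath link list \<Rightarrow>
    (nat \<times> ('v, 'a) qpath \<Rightarrow> 'k) \<Rightarrow> nat \<times> ('v, 'a) qpath \<Rightarrow> 'k" where
  "diagram_diff A L f = (\<lambda>(s, w).
     (if 0 < s \<and> s - 1 < length L
      then (case L ! (s - 1) of
              Rightwards u \<Rightarrow> amult A (path_elem u) (\<lambda>w'. f (s - 1, w')) w
            | Leftwards u \<Rightarrow> 0)
      else 0) +
     (if s < length L
      then (case L ! s of
              Rightwards u \<Rightarrow> 0
            | Leftwards u \<Rightarrow> amult A (path_elem u) (\<lambda>w'. f (s + 1, w')) w)
      else 0))"

definition resolved_by :: "(('v, 'a) qpath, 'k::field) alg \<Rightarrow> ('b, ('v, 'a) qpath, 'k) rmod \<Rightarrow>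
    'v list \<Rightarrow> ('v, 'a) qpath link list \<Rightarrow> bool" where
  "resolved_by A M V L \<longleftrightarrow> length V = length L + 1 \<and>
     (\<exists>\<epsilon>. minimal_projective_resolution A (diagram_term A V L) (\<lambda>_. diagram_diff A L) \<epsilon> M)"

subsection \<open>String modules\<close>

text \<open>A letter is an arrow together with a flag telling whether it is read directly or as a formal
  inverse. The module of a string with \<open>n\<close> letters has basis elements \<open>z\<^sub>0, \<dots>, z\<^sub>n\<close>; if its
  \<open>j\<close>-th letter is a direct arrow \<open>a\<close> then \<open>a\<close> maps \<open>z\<^sub>j\<close> to \<open>z\<^sub>j\<^sub>+\<^sub>1\<close>, and if it is the formal inverse
  of \<open>a\<close> then \<open>a\<close> maps \<open>z\<^sub>j\<^sub>+\<^sub>1\<close> to \<open>z\<^sub>j\<close>.\<close>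

type_synonym 'a letter = "'a \<times> bool"

definition letter_source :: "('v, 'a) pre_digraph \<Rightarrow> 'a letter \<Rightarrow> 'v" where
  "letter_source Q l = (if snd l then tail Q (fst l) else head Q (fst l))"

definition letter_target :: "('v, 'a) pre_digraph \<Rightarrow> 'a letter \<Rightarrow> 'v" where
  "letter_target Q l = (if snd l then head Q (fst l) else tail Q (fst l))"

definition word_vertex :: "('v, 'a) pre_digraph \<Rightarrow> 'v \<Rightarrow> 'a letter list \<Rightarrow> nat \<Rightarrow> 'v" where
  "word_vertex Q u w j = (if j = 0 then u else letter_target Q (w ! (j - 1)))"

definition string_arrow_act :: "'a letter list \<Rightarrow> 'a \<Rightarrow> (nat \<Rightarrow> 'k::field) \<Rightarrow> nat \<Rightarrow> 'k" where
  "string_arrow_act w a f = (\<lambda>j.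
     (if 0 < j \<and> j \<le> length w \<and> w ! (j - 1) = (a, True) then f (j - 1) else 0) +
     (if j < length w \<and> w ! j = (a, False) then f (j + 1) else 0))"

definition string_path_act :: "('v, 'a) pre_digraph \<Rightarrow> 'v \<Rightarrow> 'a letter list \<Rightarrow> ('v, 'a) qpath \<Rightarrow>
    (nat \<Rightarrow> 'k::field) \<Rightarrow> nat \<Rightarrow> 'k" where
  "string_path_act Q u w p f = fold (string_arrow_act w) (snd p)
     (\<lambda>j. if j \<le> length w \<and> word_vertex Q u w j = fst p then f j else 0)"

definition string_module :: "('v, 'a) pre_digraph \<Rightarrow> 'v \<Rightarrow> 'a letter list \<Rightarrow>
    (nat, ('v, 'a) qpath, 'k::field) rmod" where
  "string_module Q u w =
     \<lparr>mcarrier = {f. \<forall>j>length w. f j = 0},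
      mact = (\<lambda>f x j. \<Sum>p | x p \<noteq> 0. x p * string_path_act Q u w p f j)\<rparr>"

definition direct_word :: "'a letter list \<Rightarrow> bool" where
  "direct_word w \<longleftrightarrow> w \<noteq> [] \<and> (\<forall>l\<in>set w. snd l)"

definition inverse_word :: "'a letter list \<Rightarrow> bool" where
  "inverse_word w \<longleftrightarrow> w \<noteq> [] \<and> (\<forall>l\<in>set w. \<not> snd l)"

definition maximal_decomposition :: "'a letter list \<Rightarrow> 'a letter list list \<Rightarrow> bool" where
  "maximal_decomposition w \<sigma>s \<longleftrightarrow> concat \<sigma>s = w \<and>
     (\<forall>\<sigma>\<in>set \<sigma>s. direct_word \<sigma> \<or> inverse_word \<sigma>) \<and>
     successively (\<lambda>\<sigma> \<tau>. direct_word \<sigma> \<longleftrightarrow> inverse_word \<tau>) \<sigma>s"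

text \<open>The path underlying a direct word, or underlying the formal inverse of an inverse word, and
  the link it gives between the projectives at the two ends of the word.\<close>

definition word_path :: "('v, 'a) pre_digraph \<Rightarrow> 'a letter list \<Rightarrow> ('v, 'a) qpath" where
  "word_path Q \<sigma> = (if direct_word \<sigma> then (tail Q (fst (hd \<sigma>)), map fst \<sigma>)
                     else (tail Q (fst (last \<sigma>)), rev (map fst \<sigma>)))"

definition word_link :: "('v, 'a) pre_digraph \<Rightarrow> 'a letter list \<Rightarrow> ('v, 'a) qpath link" where
  "word_link Q \<sigma> = (if direct_word \<sigma> then Leftwards (word_path Q \<sigma>) else Rightwards (word_path Q \<sigma>))"


section \<open>The gentle algebra of a simple coordinate\<close>

text \<open>The arrow \<open>(P, i)\<close> is the angle of \<open>P\<close> between its \<open>i\<close>-th edge and the successor of that edge.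
  An end of an arc is written as a pair of the arc and one of the parameters \<open>0, 1\<close>; the two ends
  of a loop are thus distinguished. The vertex \<open>\<kappa>\<close> is the one that is also named after the twist
  of the dual \<open>\<circ>\<close>-arc of \<open>\<kappa>\<close>; the projective indexed by this twist is
  \<open>indec_projective (gentle_algebra \<Delta> \<P>) \<kappa>\<close>.\<close>

type_synonym 'p angle = "'p polygon \<times> nat"

definition gentle_quiver :: "'p curve set \<Rightarrow> 'p polygon set \<Rightarrow> ('p curve, 'p angle) pre_digraph" where
  "gentle_quiver \<Delta> \<P> =
     \<lparr>verts = \<Delta>,
      arcs = {(P, i). P \<in> \<P> \<and> has_next P i},
      tail = (\<lambda>(P, i). edge_arc P i),
      head = (\<lambda>(P, i). edge_arc P (next_edge P i))\<rparr>"

definition first_end :: "'p curve \<times> bool \<Rightarrow> 'p curve \<times> real" where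
  "first_end e = (fst e, if snd e then 0 else 1)"

definition last_end :: "'p curve \<times> bool \<Rightarrow> 'p curve \<times> real" where
  "last_end e = (fst e, if snd e then 1 else 0)"

definition angle_tail_end :: "'p angle \<Rightarrow> 'p curve \<times> real" where
  "angle_tail_end = (\<lambda>(P, i). last_end (edge P i))"

definition angle_head_end :: "'p angle \<Rightarrow> 'p curve \<times> real" where
  "angle_head_end = (\<lambda>(P, i). first_end (edge P (next_edge P i)))"

definition gentle_relations :: "'p curve set \<Rightarrow> 'p polygon set \<Rightarrow> ('p angle \<times> 'p angle) set" where
  "gentle_relations \<Delta> \<P> = {(a, b). a \<in> arcs (gentle_quiver \<Delta> \<P>) \<and> b \<in> arcs (gentle_quiver \<Delta> \<P>) \<and>
     head (gentle_quiver \<Delta> \<P>) a = tail (gentle_quiver \<Delta> \<P>) b \<and> angle_head_end a \<noteq> angle_tail_end b}"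

definition gentle_algebra :: "'p curve set \<Rightarrow> 'p polygon set \<Rightarrow>
    (('p curve, 'p angle) qpath, 'k::field) alg" where
  "gentle_algebra \<Delta> \<P> = bound_quiver_algebra (gentle_quiver \<Delta> \<P>) (gentle_relations \<Delta> \<P>)"

definition angle_path :: "'p polygon \<Rightarrow> nat \<Rightarrow> ('p curve, 'p angle) qpath" where
  "angle_path P i = (edge_arc P i, [(P, i)])"


section \<open>Zigzag arcs\<close>

text \<open>A curve crossing \<open>\<kappa>\<^sub>0, \<dots>, \<kappa>\<^sub>s\<close> at the times \<open>ctime 0 < \<dots> < ctime s\<close> is divided into \<open>s + 2\<close>
  segments. The \<open>i\<close>-th one runs through the polygon \<open>cpoly i\<close>, in which it is the image of
  \<open>clift i\<close>; it enters through the edge number \<open>cin i\<close> at the position \<open>cin_pos i\<close> of this edge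
  (for \<open>i > 0\<close>), and leaves through the edge number \<open>cout i\<close> at the position \<open>cout_pos i\<close>
  (for \<open>i \<le> s\<close>).\<close>

record 'p crossings =
  clast :: nat
  ctime :: "nat \<Rightarrow> real"
  cpoly :: "nat \<Rightarrow> 'p polygon"
  clift :: "nat \<Rightarrow> real \<Rightarrow> complex"
  cin :: "nat \<Rightarrow> nat"
  cin_pos :: "nat \<Rightarrow> real"
  cout :: "nat \<Rightarrow> nat"
  cout_pos :: "nat \<Rightarrow> real"

definition seg_start :: "'p crossings \<Rightarrow> nat \<Rightarrow> real" where
  "seg_start \<gamma> i = (if i = 0 then 0 else ctime \<gamma> (i - 1))"

definition seg_end :: "'p crossings \<Rightarrow> nat \<Rightarrow> real" where
  "seg_end \<gamma> i = (if i \<le> clast \<gamma> then ctime \<gamma> i else 1)"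

definition segment :: "'p crossings \<Rightarrow> nat \<Rightarrow> complex set" where
  "segment \<gamma> i = clift \<gamma> i ` {seg_start \<gamma> i..seg_end \<gamma> i}"

locale crosses_along =
  fixes \<P> :: "'p polygon set" and \<alpha> :: "'p curve" and \<gamma> :: "'p crossings"
  assumes times: "\<And>i. i \<le> clast \<gamma> + 1 \<Longrightarrow> seg_start \<gamma> i < seg_end \<gamma> i"
    and polys: "\<And>i. i \<le> clast \<gamma> + 1 \<Longrightarrow> cpoly \<gamma> i \<in> \<P>"
    and lift_cont: "\<And>i. i \<le> clast \<gamma> + 1 \<Longrightarrow> continuous_on {seg_start \<gamma> i..seg_end \<gamma> i} (clift \<gamma> i)"
    and lift_inj: "\<And>i. i \<le> clast \<gamma> + 1 \<Longrightarrow> inj_on (clift \<gamma> i) {seg_start \<gamma> i..seg_end \<gamma> i}"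
    and lift_closed: "\<And>i. i \<le> clast \<gamma> + 1 \<Longrightarrow> segment \<gamma> i \<subseteq> cball 0 1"
    and lift_inside: "\<And>i t. i \<le> clast \<gamma> + 1 \<Longrightarrow> t \<in> {seg_start \<gamma> i<..<seg_end \<gamma> i} \<Longrightarrow>
          clift \<gamma> i t \<in> ball 0 1"
    and lift: "\<And>i t. i \<le> clast \<gamma> + 1 \<Longrightarrow> t \<in> {seg_start \<gamma> i..seg_end \<gamma> i} \<Longrightarrow>
          param (cpoly \<gamma> i) (clift \<gamma> i t) = \<alpha> t"
    and entry: "\<And>i. 1 \<le> i \<Longrightarrow> i \<le> clast \<gamma> + 1 \<Longrightarrow>
          1 \<le> cin \<gamma> i \<and> cin \<gamma> i \<le> num_edges (cpoly \<gamma> i) \<and> cin_pos \<gamma> i \<in> {0<..<1} \<and>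
          clift \<gamma> i (seg_start \<gamma> i) = side (cpoly \<gamma> i) (cin \<gamma> i) (cin_pos \<gamma> i)"
    and exit: "\<And>i. i \<le> clast \<gamma> \<Longrightarrow>
          1 \<le> cout \<gamma> i \<and> cout \<gamma> i \<le> num_edges (cpoly \<gamma> i) \<and> cout_pos \<gamma> i \<in> {0<..<1} \<and>
          clift \<gamma> i (seg_end \<gamma> i) = side (cpoly \<gamma> i) (cout \<gamma> i) (cout_pos \<gamma> i)"
    and opposite_sides: "\<And>i. i \<le> clast \<gamma> \<Longrightarrow>
          edge_arc (cpoly \<gamma> i) (cout \<gamma> i) = edge_arc (cpoly \<gamma> (i + 1)) (cin \<gamma> (i + 1)) \<and>
          snd (edge (cpoly \<gamma> i) (cout \<gamma> i)) \<noteq> snd (edge (cpoly \<gamma> (i + 1)) (cin \<gamma> (i + 1)))"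

definition crossed_arc :: "'p crossings \<Rightarrow> nat \<Rightarrow> 'p curve" where
  "crossed_arc \<gamma> i = edge_arc (cpoly \<gamma> i) (cout \<gamma> i)"

text \<open>The \<open>i\<close>-th segment cuts off the corner between the edges number \<open>e\<close> and \<open>f\<close>, the second one
  being the successor of the first one; \<open>u\<close> and \<open>v\<close> are the positions of the ends of the segment on
  these edges. In a punctured monogon, where \<open>e = f\<close>, the segment has one of its ends on the
  last part of the edge and the other one on the first part.\<close>

definition cuts_corner :: "'p crossings \<Rightarrow> nat \<Rightarrow> nat \<Rightarrow> real \<Rightarrow> nat \<Rightarrow> real \<Rightarrow> bool" where
  "cuts_corner \<gamma> i e u f v \<longleftrightarrow>
     has_next (cpoly \<gamma> i) e \<and> f = next_edge (cpoly \<gamma> i) e \<and> (e = f \<longrightarrow> v < u)"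

definition triangle :: "'p crossings \<Rightarrow> nat \<Rightarrow> nat \<Rightarrow> complex set" where
  "triangle \<gamma> i e = connected_component_set (cball 0 1 - segment \<gamma> i) (side (cpoly \<gamma> i) e 1)"

definition puncture_outside :: "'p marked_surface \<Rightarrow> 'p crossings \<Rightarrow> nat \<Rightarrow> nat \<Rightarrow> bool" where
  "puncture_outside S \<gamma> i e \<longleftrightarrow>
     (\<forall>z\<in>ball 0 1. param (cpoly \<gamma> i) z \<in> punctures S \<longrightarrow> z \<notin> triangle \<gamma> i e)"

definition to_successor :: "'p crossings \<Rightarrow> nat \<Rightarrow> bool" where
  "to_successor \<gamma> i \<longleftrightarrow> cuts_corner \<gamma> i (cin \<gamma> i) (cin_pos \<gamma> i) (cout \<gamma> i) (cout_pos \<gamma> i)"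

definition to_predecessor :: "'p crossings \<Rightarrow> nat \<Rightarrow> bool" where
  "to_predecessor \<gamma> i \<longleftrightarrow> cuts_corner \<gamma> i (cout \<gamma> i) (cout_pos \<gamma> i) (cin \<gamma> i) (cin_pos \<gamma> i)"

definition zigzag_arc :: "'p marked_surface \<Rightarrow> 'p curve set \<Rightarrow> 'p polygon set \<Rightarrow> 'p curve \<Rightarrow>
    'p crossings \<Rightarrow> bool" where
  "zigzag_arc S \<Delta> \<P> \<alpha> \<gamma> \<longleftrightarrow>
     white_arc S \<alpha> \<and> minimal_position S \<Delta> \<alpha> \<and> crosses_along \<P> \<alpha> \<gamma> \<and>
     (\<forall>i\<in>{1..clast \<gamma>}. let P = cpoly \<gamma> i; exceptional = (\<not> punctured P \<or> num_edges P = 2) in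
        to_successor \<gamma> i \<and> (exceptional \<or> puncture_outside S \<gamma> i (cin \<gamma> i)) \<or>
        to_predecessor \<gamma> i \<and> (exceptional \<or> puncture_outside S \<gamma> i (cout \<gamma> i)))"

definition zigzag_letter :: "'p marked_surface \<Rightarrow> 'p crossings \<Rightarrow> nat \<Rightarrow> 'p angle letter \<Rightarrow> bool" where
  "zigzag_letter S \<gamma> i l \<longleftrightarrow>
     l = ((cpoly \<gamma> i, cin \<gamma> i), True) \<and> to_successor \<gamma> i \<and> puncture_outside S \<gamma> i (cin \<gamma> i) \<or>
     l = ((cpoly \<gamma> i, cout \<gamma> i), False) \<and> to_predecessor \<gamma> i \<and> puncture_outside S \<gamma> i (cout \<gamma> i)"

definition associated_string :: "'p marked_surface \<Rightarrow> 'p crossings \<Rightarrow> 'p angle letter list \<Rightarrow> bool" where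
  "associated_string S \<gamma> w \<longleftrightarrow> length w = clast \<gamma> \<and> (\<forall>i\<in>{1..clast \<gamma>}. zigzag_letter S \<gamma> i (w ! (i - 1)))"

definition zigzag_module :: "'p curve set \<Rightarrow> 'p polygon set \<Rightarrow> 'p crossings \<Rightarrow> 'p angle letter list \<Rightarrow>
    (nat, ('p curve, 'p angle) qpath, 'k::field) rmod" where
  "zigzag_module \<Delta> \<P> \<gamma> w = string_module (gentle_quiver \<Delta> \<P>) (crossed_arc \<gamma> 0) w"

definition start_weight :: "'p crossings \<Rightarrow> nat" where
  "start_weight \<gamma> = num_edges (cpoly \<gamma> 0) - cout \<gamma> 0"

definition end_weight :: "'p crossings \<Rightarrow> nat" where
  "end_weight \<gamma> = num_edges (cpoly \<gamma> (clast \<gamma> + 1)) - cin \<gamma> (clast \<gamma> + 1)"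

text \<open>The links of the diagrams \<open>P\<^sub>n \<rightarrow> \<dots> \<rightarrow> P\<^sub>c\<close> and \<open>P\<^sub>c \<leftarrow> \<dots> \<leftarrow> P\<^sub>n\<close>, where \<open>P\<^sub>i\<close> is the
  projective at the \<open>i\<close>-th edge of a polygon with \<open>n\<close> edges.\<close>

definition descending_links :: "'p polygon \<Rightarrow> nat \<Rightarrow> ('p curve, 'p angle) qpath link list" where
  "descending_links P c = map (\<lambda>i. Rightwards (angle_path P i)) (rev [c..<num_edges P])"

definition ascending_links :: "'p polygon \<Rightarrow> nat \<Rightarrow> ('p curve, 'p angle) qpath link list" where
  "ascending_links P c = map (\<lambda>i. Leftwards (angle_path P i)) [c..<num_edges P]"

end

theory Submission
  imports Defs
begin

text \<open>The vertices of the quiver are the arcs, and each of them has two sides, namely its two ends: at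
  each end of an arc at most one arrow starts, and the product of two arrows is a relation iff they
  meet at different ends of the arc between them. So a nonzero path turns around one marked point,
  and of two nonzero paths that start at the same side of a vertex one continues the other.

  A nonzero path that repeats an arrow would turn around a marked point on the boundary by a full
  cycle of angles. These angles would fill a neighbourhood of the point, up to the point itself, with
  points that are not on the boundary, which is absurd (\<open>no_cycle\<close>). Hence there are only finitely
  many nonzero paths (\<open>finite_nonzero_paths\<close>), long paths are zero, and submodules of the radical
  of a projective module are superfluous (\<open>radical_superfluous\<close>).

  In a complex given by a diagram, the pairs of a node and a nonzero path that starts at its vertex
  form a basis. For the diagrams in question the differential is given by a partial map between
  these bases, so that exactness and minimality become statements about paths (\<open>resolved\<close>).

  The module of a string is generated by the peaks of the string, where on neither side an arrow
  of the string ends. Its relations are of two kinds. The valley between two neighbouring peaks is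
  reached from both; taking the generators with alternating signs, the sum of the images vanishes.
  And a path that leaves the string at one of its ends acts as zero. The arrow \<open>x\<^sub>1\<close> by which it
  leaves is unique, if there is one; the paths annihilated by multiplication by \<open>x\<^sub>1\<close> are those that
  start with the arrow \<open>x\<^sub>2\<close> for which \<open>x\<^sub>1 x\<^sub>2\<close> is a relation, and so on. This gives the two ends
  of the resolution (\<open>string_module_resolved\<close>).

  Peaks and valleys are the places where a maximal inverse and a maximal direct part of the string
  meet; the first vertex is a peak iff the string starts with a direct part, and the last one is a
  peak iff it ends with an inverse part. These alternatives make up the four cases
  (\<open>maximal_parts_resolved\<close>). Finally, the polygon that contains an end of the curve has no
  puncture, because this end lies on the boundary, and the angles of this polygon that follow the
  edge crossed by the curve form the sequence \<open>x\<^sub>1, x\<^sub>2, \<dots>\<close> (\<open>relation_chain_polygon\<close>); its length is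
  the weight of the curve at this end.\<close>

section \<open>Charts\<close>

lemma chart_inj:
  assumes "surface_chart X U \<phi>"
  shows "inj_on \<phi> U"
proof -
  have "U \<subseteq> topspace X" using assms openin_subset[of X U] unfolding surface_chart_def by blast
  then have U: "topspace (subtopology X U) = U" by (simp add: inf.absorb2)
  have "homeomorphic_map (subtopology X U) (top_of_set (\<phi> ` U)) \<phi>"
    using assms unfolding surface_chart_def by blast
  from homeomorphic_imp_injective_map[OF this] show ?thesis unfolding U .
qed

lemma chart_inverse:
  assumes "surface_chart X U \<phi>"
  shows "x \<in> U \<Longrightarrow> inv_into U \<phi> (\<phi> x) = x"
    and "z \<in> \<phi> ` U \<Longrightarrow> inv_into U \<phi> z \<in> U \<and> \<phi> (inv_into U \<phi> z) = z"
  by (simp_all add: chart_inj[OF assms] inv_into_into f_inv_into_f)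

lemma chart_homeomorphic_inverse:
  assumes "surface_chart X U \<phi>"
  shows "homeomorphic_map (top_of_set (\<phi> ` U)) (subtopology X U) (inv_into U \<phi>)"
proof -
  have h: "homeomorphic_map (subtopology X U) (top_of_set (\<phi> ` U)) \<phi>" and U: "openin X U"
    using assms by (simp_all add: surface_chart_def)
  obtain g where g: "homeomorphic_maps (subtopology X U) (top_of_set (\<phi> ` U)) \<phi> g"
    using h unfolding homeomorphic_map_maps by blast
  then have "homeomorphic_maps (top_of_set (\<phi> ` U)) (subtopology X U) g \<phi>"
    by (rule iffD1[OF homeomorphic_maps_sym])
  then have "homeomorphic_map (top_of_set (\<phi> ` U)) (subtopology X U) g"
    by (rule homeomorphic_maps_imp_map)
  moreover have "g (\<phi> x) = x" if "x \<in> U" for x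
  proof -
    have "x \<in> topspace (subtopology X U)" using that openin_subset[OF U] by auto
    then show ?thesis using g unfolding homeomorphic_maps_def by blast
  qed
  then have "g z = inv_into U \<phi> z" if z: "z \<in> \<phi> ` U" for z
  proof -
    obtain x where "x \<in> U" "z = \<phi> x" using z by blast
    then show ?thesis using chart_inverse(1)[OF assms] \<open>\<And>x. x \<in> U \<Longrightarrow> g (\<phi> x) = x\<close> by simp
  qed
  ultimately show ?thesis
    using homeomorphic_map_eq[of "top_of_set (\<phi> ` U)" "subtopology X U" g "inv_into U \<phi>"] by simp
qed

lemma chart_inverse_continuous:
  assumes "surface_chart X U \<phi>"
  shows "continuous_map (top_of_set (\<phi> ` U)) X (inv_into U \<phi>)"
  using homeomorphic_imp_continuous_map[OF chart_homeomorphic_inverse[OF assms]]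
  by (simp add: continuous_map_in_subtopology)

lemma chart_continuous:
  assumes "surface_chart X U \<phi>"
  shows "continuous_map (subtopology X U) euclidean \<phi>"
proof -
  have "continuous_map (subtopology X U) (top_of_set (\<phi> ` U)) \<phi>"
    using assms homeomorphic_imp_continuous_map[of "subtopology X U" "top_of_set (\<phi> ` U)" \<phi>]
    unfolding surface_chart_def by blast
  then show ?thesis by (simp add: continuous_map_in_subtopology)
qed

lemma chart_inverse_open:
  assumes c: "surface_chart X U \<phi>" and B: "B \<subseteq> \<phi> ` U" "openin (top_of_set half_plane) B"
  shows "openin X (inv_into U \<phi> ` B)"
proof -
  have U: "openin X U" "openin (top_of_set half_plane) (\<phi> ` U)"
    using c by (simp_all add: surface_chart_def)
  have "openin (top_of_set (\<phi> ` U)) B"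
    using openin_subset_trans[OF B(2,1) openin_imp_subset[OF U(2)]] .
  then have "openin (subtopology X U) (inv_into U \<phi> ` B)"
    using homeomorphic_imp_open_map[OF chart_homeomorphic_inverse[OF c]] unfolding open_map_def by blast
  then show ?thesis using openin_trans_full[OF _ U(1)] by blast
qed

lemma chart_open:
  assumes c: "surface_chart X U \<phi>" and W: "W \<subseteq> U" "openin X W"
  shows "openin (top_of_set half_plane) (\<phi> ` W)"
proof -
  have U: "openin X U" "openin (top_of_set half_plane) (\<phi> ` U)"
    and h: "homeomorphic_map (subtopology X U) (top_of_set (\<phi> ` U)) \<phi>"
    using c unfolding surface_chart_def by blast+
  have "openin (subtopology X U) W" using openin_open_subtopology[OF U(1)] W by blast
  then have "openin (top_of_set (\<phi> ` U)) (\<phi> ` W)"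
    using homeomorphic_imp_open_map[OF h] unfolding open_map_def by blast
  then show ?thesis using openin_trans[OF _ U(2)] by blast
qed

lemma half_plane_neighbourhood:
  assumes "openin (top_of_set half_plane) B" "z \<in> B"
  obtains \<epsilon> where "0 < \<epsilon>" "ball z \<epsilon> \<inter> half_plane \<subseteq> B"
proof -
  obtain T where T: "open T" "B = half_plane \<inter> T" using assms(1) by (auto simp: openin_open)
  then obtain \<epsilon> where "0 < \<epsilon>" "ball z \<epsilon> \<subseteq> T" using assms(2) open_contains_ball by blast
  then show thesis using that[of \<epsilon>] T by blast
qed

text \<open>A point that one chart sends to the interior of the half plane is not a boundary point, by
  invariance of domain.\<close>

lemma (in oriented_surface) interior_point:
  assumes U: "(U, \<phi>) \<in> \<A>" and x: "x \<in> U" and pos: "0 < Im (\<phi> x)"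
  shows "x \<notin> surface_boundary \<A>"
proof
  assume "x \<in> surface_boundary \<A>"
  then obtain V \<psi> where V: "(V, \<psi>) \<in> \<A>" "x \<in> V" "Im (\<psi> x) = 0" by (auto simp: surface_boundary_def)
  note cU = charts[OF U] and cV = charts[OF V(1)]
  define g where "g = inv_into U \<phi>"
  note g = chart_inverse[OF cU, folded g_def]
  have UV: "openin X (U \<inter> V)" using cU cV by (auto simp: surface_chart_def)
  obtain \<epsilon> where e: "0 < \<epsilon>" "ball (\<phi> x) \<epsilon> \<inter> half_plane \<subseteq> \<phi> ` (U \<inter> V)"
    using half_plane_neighbourhood[OF chart_open[OF cU _ UV], of "\<phi> x"] x V(2) by blast
  define D where "D = ball (\<phi> x) \<epsilon> \<inter> {z. 0 < Im z}"
  have D: "open D" "D \<subseteq> \<phi> ` (U \<inter> V)" "\<phi> x \<in> D"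
    using e pos by (auto simp: D_def half_plane_def open_halfspace_Im_gt)
  have DU: "D \<subseteq> \<phi> ` U" "g ` D \<subseteq> V" using D(2) g(1) by auto
  have "continuous_map (top_of_set D) (subtopology X V) g"
    using continuous_map_from_subtopology_mono[OF chart_inverse_continuous[OF cU, folded g_def] DU(1)] DU(2)
    by (auto simp: continuous_map_in_subtopology)
  then have "continuous_map (top_of_set D) euclidean (\<psi> \<circ> g)"
    using chart_continuous[OF cV] by (rule continuous_map_compose)
  then have "continuous_on D (\<psi> \<circ> g)" by simp
  moreover have "inj_on (\<psi> \<circ> g) D"
  proof (rule comp_inj_on)
    show "inj_on g D" using DU(1) g(2) by (intro inj_on_inverseI[of _ \<phi>]) auto
    show "inj_on \<psi> (g ` D)" using chart_inj[OF cV] DU(2) by (rule inj_on_subset)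
  qed
  ultimately have "open ((\<psi> \<circ> g) ` D)" using invariance_of_domain D(1) by blast
  moreover have "\<psi> x \<in> (\<psi> \<circ> g) ` D" using D(3) g(1)[OF x] by force
  ultimately obtain r where r: "0 < r" "ball (\<psi> x) r \<subseteq> (\<psi> \<circ> g) ` D" using open_contains_ball by blast
  have "\<psi> x - Complex 0 (r / 2) \<in> ball (\<psi> x) r" using r(1) by (simp add: dist_norm cmod_def)
  then have "\<psi> x - Complex 0 (r / 2) \<in> (\<psi> \<circ> g) ` D" using r(2) by blast
  then have "\<psi> x - Complex 0 (r / 2) \<in> \<psi> ` V" using DU(2) unfolding image_comp[symmetric] by blast
  then have "\<psi> x - Complex 0 (r / 2) \<in> half_plane"
    using cV openin_imp_subset unfolding surface_chart_def by blast
  then show False using V(3) r(1) by (simp add: half_plane_def)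
qed

section \<open>Polygons\<close>

lemma num_sides_pos: "polygon_in S P \<Longrightarrow> 0 < num_sides P"
  using polygon_in.punctured_polygon[of S P] by (auto simp: num_sides_def)

text \<open>The point at the position \<open>u\<close> of the circle, measured in sides from the start of part number
  \<open>0\<close>.\<close>

definition circle_point :: "'p polygon \<Rightarrow> real \<Rightarrow> complex" where
  "circle_point P u = cis (- 2 * pi * u / real (num_sides P))"

lemma side_eq: "side P i t = circle_point P (real i + t)"
  by (simp add: side_def circle_point_def)

lemma norm_side [simp]: "norm (side P i t) = 1"
  by (simp add: side_def)

lemma norm_circle_point [simp]: "norm (circle_point P u) = 1"
  by (simp add: circle_point_def)

lemma circle_point_turn:
  assumes "0 < num_sides P"
  shows "circle_point P (u + real (num_sides P) * of_int k) = circle_point P u"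
proof -
  have "- 2 * pi * (u + real (num_sides P) * of_int k) / real (num_sides P) =
    - 2 * pi * u / real (num_sides P) + 2 * pi * of_int (- k)"
    using assms by (simp add: field_simps)
  moreover have "cis (2 * pi * of_int (- k)) = 1" by (rule cis_multiple_2pi) simp
  ultimately show ?thesis unfolding circle_point_def by (simp only: cis_mult[symmetric]) simp
qed

lemma circle_point_exists:
  assumes N: "0 < num_sides P" and z: "norm z = 1"
  obtains u where "c \<le> u" "u < c + real (num_sides P)" "z = circle_point P u"
proof -
  let ?N = "real (num_sides P)"
  define u0 where "u0 = - Arg z * ?N / (2 * pi)"
  define k where "k = - \<lfloor>(u0 - c) / ?N\<rfloor>"
  have "z \<noteq> 0" using z by auto
  then have "z = cis (Arg z)" using z cis_Arg[of z] by (simp add: sgn_div_norm)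
  also have "\<dots> = circle_point P u0" using N by (simp add: circle_point_def u0_def)
  also have "\<dots> = circle_point P (u0 + ?N * of_int k)" using circle_point_turn[OF N] by simp
  finally have "z = circle_point P (u0 + ?N * of_int k)" .
  moreover have "real_of_int \<lfloor>(u0 - c) / ?N\<rfloor> * ?N \<le> u0 - c" "u0 - c < (real_of_int \<lfloor>(u0 - c) / ?N\<rfloor> + 1) * ?N"
    using N by (simp_all add: pos_le_divide_eq[symmetric] pos_divide_less_eq[symmetric])
  ultimately show thesis using that[of "u0 + ?N * of_int k"] by (simp add: k_def algebra_simps)
qed

text \<open>In a punctured polygon there is no part number \<open>0\<close>, and the parts are numbered from \<open>1\<close> on.\<close>

lemma circle_side:
  assumes "polygon_in S P" and z: "norm z = 1"
  obtains i t where "z = side P i t" "0 \<le> t" "t < 1" "i \<le> num_edges P" "i = 0 \<Longrightarrow> \<not> punctured P"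
proof -
  note N = num_sides_pos[OF assms(1)]
  let ?c = "if punctured P then 1 else 0 :: real"
  obtain u where u: "?c \<le> u" "u < ?c + real (num_sides P)" "z = circle_point P u"
    using circle_point_exists[OF N z] by blast
  define i where "i = nat \<lfloor>u\<rfloor>"
  have u0: "0 \<le> u" using u(1) by (auto split: if_splits)
  have i: "real i \<le> u" "u < real i + 1" using u0 unfolding i_def by linarith+
  have "z = side P i (u - real i)" using u(3) by (simp add: side_eq)
  moreover have "real i < real (num_edges P) + 1" using u(2) i by (auto simp: num_sides_def split: if_splits)
  moreover have "\<not> punctured P" if "i = 0" using that u(1) i(2) by (auto split: if_splits)
  ultimately show thesis using that[of i "u - real i"] i by simp
qed

text \<open>The corner of the angle \<open>(P, i)\<close>.\<close>

definition corner :: "'p angle \<Rightarrow> complex" where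
  "corner a = side (fst a) (snd a) 1"

text \<open>The part of the disc cut off around this corner by the chord between the midpoints of the two
  adjacent sides, without the corner. The chord itself is excluded from \<open>cap\<close> and included in
  \<open>closed_cap\<close>. The set \<open>half_cap\<close> is cut off by a parallel chord closer to the corner.\<close>

definition cap :: "'p angle \<Rightarrow> complex set" where
  "cap a = {z \<in> cball 0 1. cos (pi / real (num_sides (fst a))) < Re (z * cnj (corner a))} - {corner a}"

definition closed_cap :: "'p angle \<Rightarrow> complex set" where
  "closed_cap a = {z \<in> cball 0 1. cos (pi / real (num_sides (fst a))) \<le> Re (z * cnj (corner a))} - {corner a}"

definition half_cap :: "'p angle \<Rightarrow> complex set" where
  "half_cap a = {z \<in> cball 0 1. cos (pi / (2 * real (num_sides (fst a)))) \<le> Re (z * cnj (corner a))}"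

lemma corner_product:
  "Re (circle_point P (real i + 1 + v) * cnj (corner (P, i))) = cos (2 * pi * v / real (num_sides P))"
proof -
  have "circle_point P (real i + 1 + v) * cnj (corner (P, i)) = cis (- 2 * pi * v / real (num_sides P))"
    unfolding corner_def side_eq circle_point_def cis_cnj cis_mult fst_conv snd_conv
    by (rule arg_cong[of _ _ cis]) (simp add: divide_inverse algebra_simps)
  then show ?thesis by simp
qed

lemma circle_near_corner:
  assumes N: "0 < num_sides P" and z: "norm z = 1"
  obtains v where "\<bar>v\<bar> \<le> real (num_sides P) / 2" "z = circle_point P (real i + 1 + v)"
    "Re (z * cnj (corner (P, i))) = cos (2 * pi * \<bar>v\<bar> / real (num_sides P))"
proof -
  obtain u where u: "real i + 1 - real (num_sides P) / 2 \<le> u"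
      "u < real i + 1 - real (num_sides P) / 2 + real (num_sides P)" "z = circle_point P u"
    using circle_point_exists[OF N z] by blast
  define v where "v = u - real i - 1"
  have z': "z = circle_point P (real i + 1 + v)" using u(3) by (simp add: v_def)
  have "\<bar>v\<bar> \<le> real (num_sides P) / 2" using u unfolding v_def by (intro abs_leI) linarith+
  moreover have "cos (2 * pi * v / real (num_sides P)) = cos (2 * pi * \<bar>v\<bar> / real (num_sides P))"
    by (cases "0 \<le> v") (auto simp: cos_minus[symmetric, of "2 * pi * v / real (num_sides P)"] simp del: cos_minus)
  ultimately show thesis using that[of v] z' corner_product[of P i v] by simp
qed

lemma closed_cap_circle:
  assumes N: "0 < num_sides P" and z: "norm z = 1" "z \<in> closed_cap (P, i)"
  obtains v where "0 < v" "v \<le> 1 / 2" "z \<in> cap (P, i) \<Longrightarrow> v < 1 / 2"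
    "z = side P i (1 - v) \<or> z = circle_point P (real i + 1 + v)"
proof -
  let ?N = "real (num_sides P)"
  obtain v where v: "\<bar>v\<bar> \<le> ?N / 2" "z = circle_point P (real i + 1 + v)"
    "Re (z * cnj (corner (P, i))) = cos (2 * pi * \<bar>v\<bar> / ?N)"
    using circle_near_corner[OF N z(1)] by blast
  have c: "cos (pi / ?N) \<le> cos (2 * pi * \<bar>v\<bar> / ?N)" using z(2) v(3) by (simp add: closed_cap_def)
  have b: "2 * pi * \<bar>v\<bar> / ?N \<le> pi" using v(1) N by (simp add: field_simps)
  have "pi / ?N \<le> pi" using N by (simp add: field_simps)
  with b have "2 * pi * \<bar>v\<bar> / ?N \<le> pi / ?N"
    using c N cos_mono_le_eq[of "pi / ?N" "2 * pi * \<bar>v\<bar> / ?N"] by simp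
  then have "\<bar>v\<bar> \<le> 1 / 2" using N by (simp add: field_simps)
  moreover have "\<bar>v\<bar> < 1 / 2" if "z \<in> cap (P, i)"
  proof -
    have "\<bar>v\<bar> \<noteq> 1 / 2"
    proof
      assume "\<bar>v\<bar> = 1 / 2"
      then have eq: "2 * pi * \<bar>v\<bar> / ?N = pi / ?N" by simp
      have "cos (pi / ?N) < cos (2 * pi * \<bar>v\<bar> / ?N)" using that v(3) by (simp add: cap_def)
      then show False unfolding eq by simp
    qed
    then show ?thesis using \<open>\<bar>v\<bar> \<le> 1 / 2\<close> by simp
  qed
  moreover have "v \<noteq> 0" using z(2) v(2) by (auto simp: closed_cap_def corner_def side_eq)
  moreover have "z = side P i (1 - \<bar>v\<bar>) \<or> z = circle_point P (real i + 1 + \<bar>v\<bar>)"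
    using v(2) by (cases "0 \<le> v") (auto simp: side_eq add.assoc)
  ultimately show thesis using that[of "\<bar>v\<bar>"] by simp
qed

lemma cap_subset_closed_cap: "cap a \<subseteq> closed_cap a"
  by (auto simp: cap_def closed_cap_def)

lemma circle_cap:
  assumes N: "0 < num_sides P" and v: "0 < \<bar>v\<bar>" "\<bar>v\<bar> < 1 / 2"
  shows "circle_point P (real i + 1 + v) \<in> cap (P, i)"
proof -
  let ?N = "real (num_sides P)" and ?z = "circle_point P (real i + 1 + v)"
  have "cos (2 * pi * v / ?N) = cos (2 * pi * \<bar>v\<bar> / ?N)"
    by (cases "0 \<le> v") (auto simp: cos_minus[symmetric, of "2 * pi * v / ?N"] simp del: cos_minus)
  then have Re: "Re (?z * cnj (corner (P, i))) = cos (2 * pi * \<bar>v\<bar> / ?N)" unfolding corner_product .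
  have b: "0 < 2 * pi * \<bar>v\<bar> / ?N" "2 * pi * \<bar>v\<bar> / ?N < pi / ?N" "pi / ?N \<le> pi"
    using N v by (simp_all add: field_simps)
  have "cos (pi / ?N) < cos (2 * pi * \<bar>v\<bar> / ?N)"
    using b by (intro cos_monotone_0_pi) auto
  moreover have "cos (2 * pi * \<bar>v\<bar> / ?N) < cos 0"
    using b by (intro cos_monotone_0_pi) auto
  moreover have "?z \<noteq> corner (P, i)"
  proof
    assume eq: "?z = corner (P, i)"
    have "Re (corner (P, i) * cnj (corner (P, i))) = 1"
      using complex_norm_square[of "corner (P, i)"] by (metis Re_complex_of_real corner_def norm_side one_power2)
    then show False using Re calculation(2) unfolding eq by simp
  qed
  ultimately show ?thesis using Re by (simp add: cap_def)
qed

lemma next_corner: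
  assumes "has_next P i"
  shows "circle_point P (real i + 1 + v) = side P (next_edge P i) v"
proof (cases "i < num_edges P")
  case True
  then show ?thesis by (simp add: next_edge_def side_eq add_ac)
next
  case False
  then have "punctured P" "i = num_edges P" "1 \<le> i" using assms by (auto simp: has_next_def)
  then have "num_sides P = i" by (simp add: num_sides_def)
  then have "circle_point P (1 + v + real (num_sides P) * of_int 1) = circle_point P (1 + v)"
    using circle_point_turn[of P "1 + v" 1] \<open>1 \<le> i\<close> by simp
  then show ?thesis using False \<open>num_sides P = i\<close> by (simp add: next_edge_def side_eq add.commute add.left_commute)
qed

lemma half_cap_subset:
  assumes N: "0 < num_sides (fst a)"
  shows "half_cap a - {corner a} \<subseteq> cap a"
proof -
  let ?N = "real (num_sides (fst a))"
  have "cos (pi / ?N) < cos (pi / (2 * ?N))"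
    using N by (intro cos_monotone_0_pi) (auto simp: field_simps)
  then show ?thesis by (auto simp: half_cap_def cap_def)
qed

context simple_coordinate begin

abbreviation arc_points :: "'p set" where
  "arc_points \<equiv> \<Union>\<kappa>\<in>\<Delta>. \<kappa> ` {0..1}"

lemma arc_pointI: "\<kappa> \<in> \<Delta> \<Longrightarrow> 0 \<le> t \<Longrightarrow> t \<le> 1 \<Longrightarrow> \<kappa> t \<in> arc_points"
  by (rule UN_I) auto

lemma open_polygon:
  assumes "P \<in> \<P>"
  shows "param P ` ball 0 1 \<in> connected_components_of (subtopology (space_of S)
    (topspace (space_of S) - boundary_of S - arc_points))"
  using cut_components assms by (rule bij_betw_apply)

lemma open_polygon_interior:
  assumes "P \<in> \<P>" "z \<in> ball 0 1"
  shows "param P z \<in> topspace (space_of S)" "param P z \<notin> boundary_of S" "param P z \<notin> arc_points"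
proof -
  have "param P z \<in> topspace (subtopology (space_of S)
      (topspace (space_of S) - boundary_of S - arc_points))"
    using connected_components_of_subset[OF open_polygon[OF assms(1)]] assms(2) by blast
  then have "param P z \<in> topspace (space_of S) - boundary_of S - arc_points"
    unfolding topspace_subtopology by blast
  then show "param P z \<in> topspace (space_of S)" "param P z \<notin> boundary_of S" "param P z \<notin> arc_points"
    by blast+
qed

text \<open>The open polygons are different connected components, and are mapped injectively.\<close>

lemma open_polygons_disjoint:
  assumes P: "P \<in> \<P>" "P' \<in> \<P>" and z: "z \<in> ball 0 1" "z' \<in> ball 0 1" and eq: "param P z = param P' z'"
  shows "P = P' \<and> z = z'"
proof -
  have "\<not> disjnt (param P ` ball 0 1) (param P' ` ball 0 1)"
    unfolding disjnt_def using z eq by (metis IntI emptyE imageI)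
  then have "param P ` ball 0 1 = param P' ` ball 0 1"
    using pairwiseD[OF pairwise_disjoint_connected_components_of open_polygon[OF P(1)] open_polygon[OF P(2)]]
    by blast
  then have "P = P'" using inj_onD[OF bij_betw_imp_inj_on[OF cut_components], of P P'] P by simp
  moreover have "inj_on (param P) (ball 0 1)" using polygons[OF P(1)] by (rule polygon_in.param_inj)
  ultimately show ?thesis using z eq inj_onD[of "param P" "ball 0 1" z z'] by simp
qed

lemma arc_inner:
  assumes "\<kappa> \<in> \<Delta>" "0 < t" "t < 1"
  shows "\<kappa> t \<in> inner_points S"
proof -
  have "\<kappa> ` {0<..<1} \<subseteq> inner_points S"
    using arcs[OF assms(1)] unfolding black_arc_def is_curve_def by blast
  moreover have "t \<in> {0<..<1}" using assms(2,3) by simp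
  ultimately show ?thesis by blast
qed

lemma arc_ends:
  assumes "\<kappa> \<in> \<Delta>"
  shows "\<kappa> 0 \<in> boundary_of S" "\<kappa> 1 \<in> boundary_of S"
  using arcs[OF assms(1)] black_boundary unfolding black_arc_def by blast+

lemma inner_not_boundary: "x \<in> inner_points S \<Longrightarrow> x \<notin> boundary_of S"
  by (simp add: inner_points_def)

lemma edge_point:
  assumes "P \<in> \<P>" "1 \<le> i" "i \<le> num_edges P" "0 \<le> t" "t \<le> 1"
  shows "param P (side P i t) = edge_arc P i (if snd (edge P i) then t else 1 - t)" "edge_arc P i \<in> \<Delta>"
  using polygon_in.edges[OF polygons[OF assms(1)] assms(2,3), of t] assms(4,5) polygon_edges[OF assms(1-3)]
  by (simp_all add: traverse_def edge_arc_def)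

lemma boundary_side:
  assumes "P \<in> \<P>" "\<not> punctured P" "0 \<le> t" "t \<le> 1"
  shows "param P (side P 0 t) \<in> boundary_of S"
proof -
  have "param P ` side P 0 ` {0..1} \<subseteq> boundary_of S"
    using polygon_in.unpunctured_polygon[OF polygons[OF assms(1)] assms(2)] by blast
  moreover have "t \<in> {0..1}" using assms(3,4) by simp
  ultimately show ?thesis by blast
qed

lemma circle_image:
  assumes "P \<in> \<P>" "norm z = 1"
  shows "param P z \<in> boundary_of S \<union> arc_points"
proof -
  obtain i t where it: "z = side P i t" "0 \<le> t" "t < 1" "i \<le> num_edges P" "i = 0 \<Longrightarrow> \<not> punctured P"
    using circle_side[OF polygons[OF assms(1)] assms(2)] by blast
  show ?thesis
  proof (cases "i = 0")
    case True
    then show ?thesis using boundary_side[OF assms(1) it(5)] it(1-3) by simp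
  next
    case False
    then have "param P z = edge_arc P i (if snd (edge P i) then t else 1 - t)" "edge_arc P i \<in> \<Delta>"
      using edge_point[OF assms(1), of i t] it by simp_all
    then show ?thesis using it(2,3) arc_pointI by simp
  qed
qed

text \<open>The preimages of an inner point of an arc in a closed polygon lie on edges given by that arc.\<close>

lemma arc_fibre:
  assumes P: "P \<in> \<P>" "z \<in> cball 0 1" and \<kappa>: "\<kappa> \<in> \<Delta>" "0 < t" "t < 1" and eq: "param P z = \<kappa> t"
  obtains i s where "1 \<le> i" "i \<le> num_edges P" "z = side P i s" "edge_arc P i = \<kappa>"
    "s = (if snd (edge P i) then t else 1 - t)"
proof -
  have "\<kappa> t \<in> arc_points" using \<kappa> by (intro arc_pointI) auto
  then have "z \<notin> ball 0 1" using open_polygon_interior(3)[OF P(1)] eq by metis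
  then have "norm z = 1" using P(2) by (simp add: dist_norm)
  then obtain i s where it: "z = side P i s" "0 \<le> s" "s < 1" "i \<le> num_edges P" "i = 0 \<Longrightarrow> \<not> punctured P"
    using circle_side[OF polygons[OF P(1)]] by blast
  have nb: "\<kappa> t \<notin> boundary_of S" using arc_inner[OF \<kappa>] inner_not_boundary by blast
  have i: "i \<noteq> 0"
  proof
    assume "i = 0"
    then show False using boundary_side[OF P(1) it(5), of s] it(1-3) eq nb by simp
  qed
  define s' where "s' = (if snd (edge P i) then s else 1 - s)"
  have p: "param P z = edge_arc P i s'" "edge_arc P i \<in> \<Delta>"
    using edge_point[OF P(1), of i s] it i by (simp_all add: s'_def)
  have "s' \<noteq> 0" "s' \<noteq> 1" using p eq nb arc_ends by metis+
  then have s': "0 < s'" "s' < 1" using it(2,3) by (auto simp: s'_def split: if_splits)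
  have "edge_arc P i = \<kappa>"
  proof (rule ccontr)
    assume "edge_arc P i \<noteq> \<kappa>"
    then have "edge_arc P i ` {0<..<1} \<inter> \<kappa> ` {0<..<1} = {}" using arcs_disjoint p(2) \<kappa>(1) by blast
    moreover have "edge_arc P i s' \<in> edge_arc P i ` {0<..<1}" "\<kappa> t \<in> \<kappa> ` {0<..<1}" using s' \<kappa> by auto
    ultimately show False using p(1) eq by auto
  qed
  moreover have "inj_on \<kappa> {0<..<1}" using arcs[OF \<kappa>(1)] by (simp add: simple_curve_def)
  ultimately have "s' = t" using p(1) eq s' \<kappa> by (auto dest: inj_onD)
  then show thesis using that[of i s] it i \<open>edge_arc P i = \<kappa>\<close> by (auto simp: s'_def)
qed

lemma edge_unique:
  assumes "P \<in> \<P>" "1 \<le> i" "i \<le> num_edges P" and "P' \<in> \<P>" "1 \<le> i'" "i' \<le> num_edges P'"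
    and "edge P i = edge P' i'"
  shows "P = P' \<and> i = i'"
proof -
  have "edge_arc P i \<in> \<Delta>" using polygon_edges assms by blast
  from cut_sides[OF this, of "snd (edge P i)"]
  have "\<exists>!x. (\<lambda>(P', i'). P' \<in> \<P> \<and> 1 \<le> i' \<and> i' \<le> num_edges P' \<and> edge P' i' = edge P i) x"
    by (simp add: edge_arc_def)
  then have "(P, i) = (P', i')"
    by (rule ex1E) (use assms in auto)
  then show ?thesis by simp
qed

lemma arc_on_edge:
  assumes "\<kappa> \<in> \<Delta>"
  obtains P i where "P \<in> \<P>" "1 \<le> i" "i \<le> num_edges P" "edge P i = (\<kappa>, d)"
  using cut_sides[OF assms, of d] by auto

section \<open>Corners at a marked point\<close>

abbreviation closed_polygons :: "'p set" where
  "closed_polygons \<equiv> \<Union>P\<in>\<P>. param P ` cball 0 1"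

lemma polygon_image_closed:
  assumes "P \<in> \<P>" "closed B" "B \<subseteq> cball 0 1"
  shows "closedin (space_of S) (param P ` B)"
proof -
  have "compact (B \<inter> cball 0 1)" using assms(2) by (intro closed_Int_compact) auto
  then have "compactin (top_of_set (cball 0 1)) B"
    using assms(3) by (simp add: compactin_subtopology Int_absorb2)
  then have "compactin (space_of S) (param P ` B)"
    using polygon_in.param_cont[OF polygons[OF assms(1)]] by (rule image_compactin)
  then show ?thesis using hausdorff compactin_imp_closedin by blast
qed

text \<open>A point outside the closed polygons would have a neighbourhood of such points. But each open set
  contains interior points, and these lie on an arc or in an open polygon.\<close>

lemma closed_polygons_cover: "topspace (space_of S) \<subseteq> closed_polygons"
proof (rule ccontr)
  assume "\<not> topspace (space_of S) \<subseteq> closed_polygons"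
  then obtain x where x: "x \<in> topspace (space_of S) - closed_polygons" by blast
  then have "x \<in> (\<Union>(U, \<phi>)\<in>atlas_of S. U)" using cover by blast
  then obtain U \<phi> where U: "(U, \<phi>) \<in> atlas_of S" "x \<in> U" by auto
  note c = charts[OF U(1)]
  have "closedin (space_of S) closed_polygons"
  proof (rule closedin_Union)
    show "finite ((\<lambda>P. param P ` cball 0 1) ` \<P>)" using finite_polygons by simp
    fix T assume "T \<in> (\<lambda>P. param P ` cball 0 1) ` \<P>"
    then show "closedin (space_of S) T" using polygon_image_closed[OF _ closed_cball subset_refl] by blast
  qed
  then have "openin (space_of S) (topspace (space_of S) - closed_polygons)" by (simp add: closedin_def)
  moreover have Uo: "openin (space_of S) U" "openin (top_of_set half_plane) (\<phi> ` U)"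
    using c by (simp_all add: surface_chart_def)
  ultimately have "openin (space_of S) (U \<inter> (topspace (space_of S) - closed_polygons))"
    by (intro openin_Int)
  then have "openin (top_of_set half_plane) (\<phi> ` (U \<inter> (topspace (space_of S) - closed_polygons)))"
    by (intro chart_open[OF c]) auto
  moreover have "\<phi> x \<in> \<phi> ` (U \<inter> (topspace (space_of S) - closed_polygons))" using U(2) x by blast
  ultimately obtain \<epsilon> where e: "0 < \<epsilon>"
      "ball (\<phi> x) \<epsilon> \<inter> half_plane \<subseteq> \<phi> ` (U \<inter> (topspace (space_of S) - closed_polygons))"
    by (rule half_plane_neighbourhood)
  have "\<phi> x \<in> half_plane" using openin_imp_subset[OF Uo(2)] U(2) by blast
  then have h: "\<phi> x + Complex 0 (\<epsilon> / 2) \<in> ball (\<phi> x) \<epsilon> \<inter> half_plane" "0 < Im (\<phi> x + Complex 0 (\<epsilon> / 2))"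
    using e(1) by (simp_all add: half_plane_def dist_norm cmod_def)
  then have "\<phi> x + Complex 0 (\<epsilon> / 2) \<in> \<phi> ` (U \<inter> (topspace (space_of S) - closed_polygons))"
    using e(2) by blast
  then obtain y where y': "\<phi> x + Complex 0 (\<epsilon> / 2) = \<phi> y" "y \<in> U \<inter> (topspace (space_of S) - closed_polygons)"
    by (rule imageE)
  have y: "y \<in> U" "y \<in> topspace (space_of S)" "y \<notin> closed_polygons" "0 < Im (\<phi> y)"
    using y'(2) h(2) unfolding y'(1) by blast+
  have "y \<notin> boundary_of S" using interior_point[OF U(1) y(1,4)] .
  moreover have "y \<notin> arc_points"
  proof
    assume "y \<in> arc_points"
    then obtain \<kappa> where k0: "\<kappa> \<in> \<Delta>" "y \<in> \<kappa> ` {0..1}" by blast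
    then obtain t where k: "\<kappa> \<in> \<Delta>" "0 \<le> t" "t \<le> 1" "y = \<kappa> t" by auto
    obtain P i where P: "P \<in> \<P>" "1 \<le> i" "i \<le> num_edges P" "edge P i = (\<kappa>, True)"
      using arc_on_edge[OF k(1)] by blast
    have "param P (side P i t) = y" using edge_point[OF P(1-3) k(2,3)] P(4) k(4) by (simp add: edge_arc_def)
    moreover have "side P i t \<in> cball 0 1" by simp
    ultimately show False using y(3) P(1) by blast
  qed
  ultimately have "y \<in> \<Union> (connected_components_of (subtopology (space_of S)
      (topspace (space_of S) - boundary_of S - arc_points)))"
    unfolding Union_connected_components_of using y(2) by simp
  then obtain B where B: "B \<in> connected_components_of (subtopology (space_of S)
      (topspace (space_of S) - boundary_of S - arc_points))" "y \<in> B" by blast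
  have "B \<in> (\<lambda>P. param P ` ball 0 1) ` \<P>" using cut_components B(1) unfolding bij_betw_def by blast
  then obtain P where "P \<in> \<P>" "y \<in> param P ` ball 0 1" using B(2) by blast
  then show False using y(3) ball_subset_cball by blast
qed

text \<open>The finitely many closed polygons are compact and cover the surface, so the surface carries the
  quotient topology.\<close>

lemma openin_by_preimages:
  assumes "G \<subseteq> topspace (space_of S)"
    and "\<And>P. P \<in> \<P> \<Longrightarrow> \<exists>T. open T \<and> {z \<in> cball 0 1. param P z \<in> G} = cball 0 1 \<inter> T"
  shows "openin (space_of S) G"
proof -
  let ?B = "\<lambda>P. {z \<in> cball 0 1. param P z \<notin> G}"
  have "topspace (space_of S) - G = (\<Union>P\<in>\<P>. param P ` ?B P)"
  proof
    show "topspace (space_of S) - G \<subseteq> (\<Union>P\<in>\<P>. param P ` ?B P)"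
    proof
      fix x assume x: "x \<in> topspace (space_of S) - G"
      then have "x \<in> closed_polygons" using closed_polygons_cover by blast
      then obtain P z where "P \<in> \<P>" "z \<in> cball 0 1" "x = param P z" by blast
      then show "x \<in> (\<Union>P\<in>\<P>. param P ` ?B P)" using x by blast
    qed
    have "param P z \<in> topspace (space_of S)" if "P \<in> \<P>" "z \<in> cball 0 1" for P z
      using polygon_in.param_cont[OF polygons[OF that(1)]] that(2) by (auto simp: continuous_map_def)
    then show "(\<Union>P\<in>\<P>. param P ` ?B P) \<subseteq> topspace (space_of S) - G" by blast
  qed
  moreover have "closedin (space_of S) (param P ` ?B P)" if P: "P \<in> \<P>" for P
  proof -
    obtain T where T: "open T" "{z \<in> cball 0 1. param P z \<in> G} = cball 0 1 \<inter> T" using assms(2)[OF P] by blast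
    have "?B P = cball 0 1 - T" using T(2) by blast
    then show ?thesis using T(1) polygon_image_closed[OF P, of "?B P"] by (simp add: closed_Diff)
  qed
  then have "closedin (space_of S) (\<Union>P\<in>\<P>. param P ` ?B P)"
    using finite_polygons by (intro closedin_Union) (simp, blast)
  ultimately have "closedin (space_of S) (topspace (space_of S) - G)" by (simp only:)
  then show ?thesis using assms(1) by (simp add: openin_closedin_eq)
qed

lemma angle_ends:
  "angle_tail_end (P, i) = (edge_arc P i, if snd (edge P i) then 1 else 0)"
  "angle_head_end (P, i) = (edge_arc P (next_edge P i), if snd (edge P (next_edge P i)) then 0 else 1)"
  by (simp_all add: angle_tail_end_def angle_head_end_def last_end_def first_end_def edge_arc_def)

lemma has_next_bounds:
  assumes "has_next P i"
  shows "1 \<le> i" "i \<le> num_edges P" "1 \<le> next_edge P i" "next_edge P i \<le> num_edges P"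
  using assms by (auto simp: has_next_def next_edge_def)

text \<open>An inner point of an edge near a corner of a cycle of angles is also near a corner of this cycle
  in the polygon on the other side of the edge.\<close>

lemma cap_preimage:
  assumes C: "\<And>P i. (P, i) \<in> C \<Longrightarrow> P \<in> \<P> \<and> has_next P i"
    and succ: "\<And>a. a \<in> C \<Longrightarrow> \<exists>b\<in>C. angle_tail_end b = angle_head_end a"
    and pred: "\<And>a. a \<in> C \<Longrightarrow> \<exists>b\<in>C. angle_head_end b = angle_tail_end a"
    and a: "(P, i) \<in> C" "z \<in> cap (P, i)" and z': "P' \<in> \<P>" "z' \<in> cball 0 1" "param P' z' = param P z"
  shows "\<exists>j. (P', j) \<in> C \<and> z' \<in> cap (P', j)"
proof -
  have P: "P \<in> \<P>" "has_next P i" using C[OF a(1)] by auto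
  note b = has_next_bounds[OF P(2)]
  have zc: "z \<in> cball 0 1" using a(2) by (simp add: cap_def)
  show ?thesis
  proof (cases "z \<in> ball 0 1")
    case True
    have "z' \<in> ball 0 1"
    proof (rule ccontr)
      assume "z' \<notin> ball 0 1"
      then have "norm z' = 1" using z'(2) by (simp add: dist_norm)
      then have "param P z \<in> boundary_of S \<union> arc_points" using circle_image[OF z'(1)] z'(3) by metis
      then show False using open_polygon_interior[OF P(1) True] by blast
    qed
    then have "P' = P \<and> z' = z" using open_polygons_disjoint[OF z'(1) P(1) _ True z'(3)] by blast
    then show ?thesis using a by blast
  next
    case False
    then have n: "norm z = 1" using zc by (simp add: dist_norm)
    note N = num_sides_pos[OF polygons[OF P(1)]]
    obtain v where v: "0 < v" "v < 1 / 2" "z = side P i (1 - v) \<or> z = circle_point P (real i + 1 + v)"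
      using closed_cap_circle[OF N n subsetD[OF cap_subset_closed_cap a(2)]] a(2) by blast
    from v(3) show ?thesis
    proof
      assume z: "z = side P i (1 - v)"
      define t where "t = (if snd (edge P i) then 1 - v else v)"
      have t: "0 < t" "t < 1" using v by (auto simp: t_def)
      have pz: "param P z = edge_arc P i t" "edge_arc P i \<in> \<Delta>"
        using edge_point[OF P(1) b(1,2), of "1 - v"] v z by (simp_all add: t_def)
      obtain j s where j: "1 \<le> j" "j \<le> num_edges P'" "z' = side P' j s" "edge_arc P' j = edge_arc P i"
          "s = (if snd (edge P' j) then t else 1 - t)"
        using arc_fibre[OF z'(1,2) pz(2) t] z'(3) pz(1) by metis
      show ?thesis
      proof (cases "snd (edge P' j) = snd (edge P i)")
        case True
        then have "P' = P \<and> j = i"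
          using edge_unique[OF z'(1) j(1,2) P(1) b(1,2)] j(4) by (simp add: edge_arc_def prod_eq_iff)
        then have "z' = z" using j(3,5) z by (auto simp: t_def)
        then show ?thesis using a \<open>P' = P \<and> j = i\<close> by blast
      next
        case False
        obtain P2 i2 where p: "(P2, i2) \<in> C" "angle_head_end (P2, i2) = angle_tail_end (P, i)"
          using pred[OF a(1)] by (metis prod.collapse)
        have P2: "P2 \<in> \<P>" "has_next P2 i2" using C[OF p(1)] by auto
        have "edge P2 (next_edge P2 i2) = edge P' j"
          using p(2) j(4) False by (auto simp: angle_ends edge_arc_def prod_eq_iff split: if_splits)
        then have eq: "P2 = P' \<and> next_edge P2 i2 = j"
          using edge_unique[OF P2(1) has_next_bounds(3,4)[OF P2(2)] z'(1) j(1,2)] by blast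
        have "z' = side P' j v" using j(3,5) False by (auto simp: t_def split: if_splits)
        then have "z' = circle_point P2 (real i2 + 1 + v)" 
          using next_corner[OF P2(2), of v] conjunct1[OF eq] conjunct2[OF eq] by simp
        moreover have "circle_point P2 (real i2 + 1 + v) \<in> cap (P2, i2)"
          using circle_cap[OF num_sides_pos[OF polygons[OF P2(1)]]] v by simp
        ultimately show ?thesis using p(1) eq by auto
      qed
    next
      assume "z = circle_point P (real i + 1 + v)"
      then have z: "z = side P (next_edge P i) v" using next_corner[OF P(2)] by simp
      define t where "t = (if snd (edge P (next_edge P i)) then v else 1 - v)"
      have t: "0 < t" "t < 1" using v by (auto simp: t_def)
      have pz: "param P z = edge_arc P (next_edge P i) t" "edge_arc P (next_edge P i) \<in> \<Delta>"
        using edge_point[OF P(1) b(3,4), of v] v z by (simp_all add: t_def)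
      obtain j s where j: "1 \<le> j" "j \<le> num_edges P'" "z' = side P' j s" "edge_arc P' j = edge_arc P (next_edge P i)"
          "s = (if snd (edge P' j) then t else 1 - t)"
        using arc_fibre[OF z'(1,2) pz(2) t] z'(3) pz(1) by metis
      show ?thesis
      proof (cases "snd (edge P' j) = snd (edge P (next_edge P i))")
        case True
        then have "P' = P \<and> j = next_edge P i"
          using edge_unique[OF z'(1) j(1,2) P(1) b(3,4)] j(4) by (simp add: edge_arc_def prod_eq_iff)
        then have "z' = z" using j(3,5) z by (auto simp: t_def)
        then show ?thesis using a \<open>P' = P \<and> j = next_edge P i\<close> by blast
      next
        case False
        obtain P2 i2 where p: "(P2, i2) \<in> C" "angle_tail_end (P2, i2) = angle_head_end (P, i)"
          using succ[OF a(1)] by (metis prod.collapse)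
        have P2: "P2 \<in> \<P>" "has_next P2 i2" using C[OF p(1)] by auto
        have "edge P2 i2 = edge P' j"
          using p(2) j(4) False by (auto simp: angle_ends edge_arc_def prod_eq_iff split: if_splits)
        then have eq: "P2 = P' \<and> i2 = j"
          using edge_unique[OF P2(1) has_next_bounds(1,2)[OF P2(2)] z'(1) j(1,2)] by blast
        have "z' = side P' j (1 - v)" using j(3,5) False by (auto simp: t_def split: if_splits)
        then have "z' = circle_point P2 (real i2 + 1 + (- v))" using eq by (simp add: side_eq add_diff_eq)
        moreover have "circle_point P2 (real i2 + 1 + (- v)) \<in> cap (P2, i2)"
          using circle_cap[OF num_sides_pos[OF polygons[OF P2(1)]], of "- v"] v by simp
        ultimately show ?thesis using p(1) eq by auto
      qed
    qed
  qed
qed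

lemma closed_cap_image:
  assumes "P \<in> \<P>" "has_next P i" "z \<in> closed_cap (P, i)"
  shows "param P z \<in> topspace (space_of S)" "param P z \<notin> boundary_of S"
proof -
  have zc: "z \<in> cball 0 1" using assms(3) by (simp add: closed_cap_def)
  then show "param P z \<in> topspace (space_of S)"
    using polygon_in.param_cont[OF polygons[OF assms(1)]] by (auto simp: continuous_map_def)
  note b = has_next_bounds[OF assms(2)]
  show "param P z \<notin> boundary_of S"
  proof (cases "z \<in> ball 0 1")
    case True
    then show ?thesis using open_polygon_interior[OF assms(1)] by blast
  next
    case False
    then have n: "norm z = 1" using zc by (simp add: dist_norm)
    obtain v where v: "0 < v" "v \<le> 1 / 2" "z = side P i (1 - v) \<or> z = circle_point P (real i + 1 + v)"
      using closed_cap_circle[OF num_sides_pos[OF polygons[OF assms(1)]] n assms(3)] by blast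
    from v(3) show ?thesis
    proof
      assume z: "z = side P i (1 - v)"
      have "param P z = edge_arc P i (if snd (edge P i) then 1 - v else v)" "edge_arc P i \<in> \<Delta>"
        using edge_point[OF assms(1) b(1,2), of "1 - v"] v z by simp_all
      then show ?thesis using arc_inner[of "edge_arc P i" "if snd (edge P i) then 1 - v else v"] v
          inner_not_boundary by (simp split: if_splits)
    next
      assume "z = circle_point P (real i + 1 + v)"
      then have z: "z = side P (next_edge P i) v" using next_corner[OF assms(2)] by simp
      have "param P z = edge_arc P (next_edge P i) (if snd (edge P (next_edge P i)) then v else 1 - v)"
          "edge_arc P (next_edge P i) \<in> \<Delta>"
        using edge_point[OF assms(1) b(3,4), of v] v z by simp_all
      then show ?thesis using arc_inner[of "edge_arc P (next_edge P i)" "if snd (edge P (next_edge P i)) then v else 1 - v"] v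
          inner_not_boundary by (simp split: if_splits)
    qed
  qed
qed

text \<open>A cycle of angles around a point would fill a neighbourhood of this point, except for the point
  itself, with inner points. But every neighbourhood of a marked point on the boundary contains other
  boundary points.\<close>

lemma no_cycle:
  assumes fin: "finite C" and ne: "C \<noteq> {}"
    and C: "\<And>P i. (P, i) \<in> C \<Longrightarrow> P \<in> \<P> \<and> has_next P i"
    and succ: "\<And>a. a \<in> C \<Longrightarrow> \<exists>b\<in>C. angle_tail_end b = angle_head_end a"
    and pred: "\<And>a. a \<in> C \<Longrightarrow> \<exists>b\<in>C. angle_head_end b = angle_tail_end a"
    and pt: "\<And>a. a \<in> C \<Longrightarrow> param (fst a) (corner a) = x" and x: "x \<in> boundary_of S"
  shows False
proof -
  let ?X = "space_of S"
  define G where "G = (\<Union>a\<in>C. param (fst a) ` cap a)"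
  have fstC: "fst a \<in> \<P>" "has_next (fst a) (snd a)" if "a \<in> C" for a
    using C[of "fst a" "snd a"] that by simp_all
  have N: "0 < num_sides (fst a)" if "a \<in> C" for a using num_sides_pos polygons fstC(1)[OF that] by blast
  have GX: "y \<in> topspace ?X \<and> y \<notin> boundary_of S" if "y \<in> G" for y
  proof -
    obtain a z where "a \<in> C" "z \<in> cap a" "y = param (fst a) z" using \<open>y \<in> G\<close> unfolding G_def by blast
    then show ?thesis using closed_cap_image[of "fst a" "snd a" z] fstC cap_subset_closed_cap[of a] by auto
  qed
  have xG: "x \<notin> G" using GX x by blast
  have G_open: "openin ?X G"
  proof (rule openin_by_preimages)
    show "G \<subseteq> topspace ?X" using GX by blast
    fix P assume P: "P \<in> \<P>"
    define T where "T = (\<Union>j\<in>{j. (P, j) \<in> C}.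
      {z. cos (pi / real (num_sides P)) < Re (z * cnj (corner (P, j)))} - {corner (P, j)})"
    have "open T" unfolding T_def
      by (intro open_UN ballI open_Diff open_Collect_less continuous_intros closed_singleton)
    moreover have "{z \<in> cball 0 1. param P z \<in> G} = cball 0 1 \<inter> T"
    proof
      show "{z \<in> cball 0 1. param P z \<in> G} \<subseteq> cball 0 1 \<inter> T"
      proof
        fix z assume z: "z \<in> {z \<in> cball 0 1. param P z \<in> G}"
        then obtain a z1 where a: "a \<in> C" "z1 \<in> cap a" "param P z = param (fst a) z1" unfolding G_def by blast
        have "\<exists>j. (P, j) \<in> C \<and> z \<in> cap (P, j)"
          by (rule cap_preimage[of C "fst a" "snd a" z1]) (use C succ pred a P z in simp_all)
        then obtain j where "(P, j) \<in> C" "z \<in> cap (P, j)" by blast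
        then show "z \<in> cball 0 1 \<inter> T" unfolding T_def cap_def by auto
      qed
      show "cball 0 1 \<inter> T \<subseteq> {z \<in> cball 0 1. param P z \<in> G}"
      proof
        fix z assume z: "z \<in> cball 0 1 \<inter> T"
        then obtain j where j: "(P, j) \<in> C" "z \<in> cap (P, j)" unfolding T_def cap_def by auto
        have "param P z \<in> param (fst (P, j)) ` cap (P, j)" using j(2) by simp
        then have "param P z \<in> G" unfolding G_def using j(1) by blast
        then show "z \<in> {z \<in> cball 0 1. param P z \<in> G}" using z by blast
      qed
    qed
    ultimately show "\<exists>T. open T \<and> {z \<in> cball 0 1. param P z \<in> G} = cball 0 1 \<inter> T" by blast
  qed
  have one: "corner a * cnj (corner a) = 1" for a
    using complex_norm_square[of "corner a"] by (simp add: corner_def)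
  have cos_less: "cos (pi / (2 * real (num_sides (fst a)))) < 1" "cos (pi / real (num_sides (fst a))) < 1" if "a \<in> C" for a
  proof -
    have "1 \<le> real (num_sides (fst a))" using N[OF that] by simp
    then have "0 < pi / (2 * real (num_sides (fst a)))" "pi / (2 * real (num_sides (fst a))) \<le> pi"
       "0 < pi / real (num_sides (fst a))" "pi / real (num_sides (fst a)) \<le> pi"
      by (simp_all add: divide_le_eq)
    then show "cos (pi / (2 * real (num_sides (fst a)))) < 1" "cos (pi / real (num_sides (fst a))) < 1"
      using cos_monotone_0_pi[of 0 "pi / (2 * real (num_sides (fst a)))"]
        cos_monotone_0_pi[of 0 "pi / real (num_sides (fst a))"] by simp_all
  qed
  \<comment> \<open>Away from the closed set \<open>F\<close>, which does not contain \<open>x\<close>, the set \<open>G\<close> agrees with the closed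
    set \<open>H\<close> minus \<open>x\<close>.\<close>
  define H where "H = (\<Union>a\<in>C. param (fst a) ` half_cap a)"
  define band where "band a = {z \<in> cball 0 1. cos (pi / real (num_sides (fst a))) \<le> Re (z * cnj (corner a)) \<and>
    Re (z * cnj (corner a)) \<le> cos (pi / (2 * real (num_sides (fst a))))}" for a :: "'p angle"
  define F where "F = (\<Union>a\<in>C. param (fst a) ` band a)"
  have closed_union: "closedin ?X (\<Union>a\<in>C. param (fst a) ` B a)"
    if B: "\<And>a. closed (B a)" "\<And>a. B a \<subseteq> cball 0 1" for B
  proof (rule closedin_Union)
    show "finite ((\<lambda>a. param (fst a) ` B a) ` C)" using fin by simp
    fix T assume "T \<in> (\<lambda>a. param (fst a) ` B a) ` C"
    then obtain a where a: "a \<in> C" "T = param (fst a) ` B a" by blast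
    show "closedin ?X T" unfolding a(2) using polygon_image_closed[OF fstC(1)[OF a(1)] B] .
  qed
  have H_closed: "closedin ?X H" unfolding H_def
  proof (rule closed_union)
    show "closed (half_cap a)" "half_cap a \<subseteq> cball 0 1" for a :: "'p angle"
    proof -
      have "half_cap a = cball 0 1 \<inter> {z. cos (pi / (2 * real (num_sides (fst a)))) \<le> Re (z * cnj (corner a))}"
        by (auto simp: half_cap_def)
      then show "closed (half_cap a)" "half_cap a \<subseteq> cball 0 1"
        by (auto intro!: closed_Int closed_Collect_le continuous_intros)
    qed
  qed
  have F_closed: "closedin ?X F" unfolding F_def
  proof (rule closed_union)
    show "closed (band a)" "band a \<subseteq> cball 0 1" for a :: "'p angle"
    proof -
      have "band a = cball 0 1 \<inter> {z. cos (pi / real (num_sides (fst a))) \<le> Re (z * cnj (corner a))} \<inter>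
        {z. Re (z * cnj (corner a)) \<le> cos (pi / (2 * real (num_sides (fst a))))}"
        by (auto simp: band_def)
      then show "closed (band a)" "band a \<subseteq> cball 0 1"
        by (auto intro!: closed_Int closed_Collect_le continuous_intros)
    qed
  qed
  have xF: "x \<notin> F"
  proof
    assume "x \<in> F"
    then obtain a z where a: "a \<in> C" "z \<in> band a" "x = param (fst a) z" unfolding F_def by blast
    have "Re (z * cnj (corner a)) \<le> cos (pi / (2 * real (num_sides (fst a))))"
      using a(2) by (simp only: band_def mem_Collect_eq)
    then have "Re (z * cnj (corner a)) \<noteq> 1" using cos_less(1)[OF a(1)] by linarith
    then have "z * cnj (corner a) \<noteq> 1" by (metis one_complex.sel(1))
    then have "z \<noteq> corner a" using one[of a] by blast
    then have "z \<in> closed_cap a" using a(2) by (simp add: band_def closed_cap_def)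
    then show False using closed_cap_image(2)[of "fst a" "snd a" z] fstC[OF a(1)] a(3) x by simp
  qed
  have GH: "y \<in> H" if yG: "y \<in> G" "y \<notin> F" for y
  proof -
    obtain a z where a: "a \<in> C" "z \<in> cap a" "y = param (fst a) z" using yG(1) unfolding G_def by blast
    have "z \<in> half_cap a"
    proof (rule ccontr)
      assume "z \<notin> half_cap a"
      then have "z \<in> band a" using a(2) by (auto simp: half_cap_def band_def cap_def)
      then show False using yG(2) a unfolding F_def by blast
    qed
    then show ?thesis using a unfolding H_def by blast
  qed
  have HG: "y \<in> G" if yH: "y \<in> H" "y \<noteq> x" for y
  proof -
    obtain a z where a: "a \<in> C" "z \<in> half_cap a" "y = param (fst a) z" using yH(1) unfolding H_def by blast
    have "z \<noteq> corner a" using pt[OF a(1)] a(3) yH(2) by blast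
    then have "z \<in> cap a" using half_cap_subset[OF N[OF a(1)]] a(2) by blast
    then show ?thesis using a unfolding G_def by blast
  qed
  \<comment> \<open>A half disc around \<open>x\<close> stays connected when \<open>x\<close> is removed.\<close>
  obtain U \<phi> where U: "(U, \<phi>) \<in> atlas_of S" "x \<in> U" "Im (\<phi> x) = 0"
    using x unfolding surface_boundary_def by blast
  note c = charts[OF U(1)]
  define g where "g = inv_into U \<phi>"
  note g = chart_inverse[OF c, folded g_def]
  have Uo: "openin ?X U" using c by (simp add: surface_chart_def)
  have xX: "x \<in> topspace ?X" using openin_subset[OF Uo] U(2) by blast
  have "openin ?X (U \<inter> (topspace ?X - F))" using Uo F_closed by (intro openin_Int) (auto simp: closedin_def)
  then have "openin (top_of_set half_plane) (\<phi> ` (U \<inter> (topspace ?X - F)))" by (intro chart_open[OF c]) auto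
  moreover have "\<phi> x \<in> \<phi> ` (U \<inter> (topspace ?X - F))" using U(2) xX xF by blast
  ultimately obtain \<epsilon> where e: "0 < \<epsilon>" "ball (\<phi> x) \<epsilon> \<inter> half_plane \<subseteq> \<phi> ` (U \<inter> (topspace ?X - F))"
    by (rule half_plane_neighbourhood)
  define B where "B = ball (\<phi> x) \<epsilon> \<inter> half_plane"
  define D where "D = B - {\<phi> x}"
  have BU: "B \<subseteq> \<phi> ` U" using e(2) unfolding B_def by blast
  have xB: "\<phi> x \<in> B" using e(1) U(3) by (simp add: B_def half_plane_def)
  have gB: "g z \<in> U \<and> g z \<notin> F \<and> \<phi> (g z) = z" if "z \<in> B" for z
  proof -
    obtain y where "y \<in> U" "y \<notin> F" "z = \<phi> y" using e(2) \<open>z \<in> B\<close> unfolding B_def by blast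
    then show ?thesis using g(1)[of y] by simp
  qed
  have "convex B" unfolding B_def half_plane_def
    by (intro convex_Int convex_ball) (simp add: convex_halfspace_Im_ge)
  have "starlike D" unfolding starlike_def
  proof (intro bexI ballI)
    let ?a = "\<phi> x + Complex 0 (\<epsilon> / 2)"
    have aB: "?a \<in> B" using e(1) U(3) by (simp add: B_def half_plane_def dist_norm cmod_def)
    then show "?a \<in> D" using e(1) by (simp add: D_def complex_eq_iff)
    fix z assume z: "z \<in> D"
    show "closed_segment ?a z \<subseteq> D"
    proof
      fix p assume p: "p \<in> closed_segment ?a z"
      then have "p \<in> B" using \<open>convex B\<close> aB z closed_segment_subset[of ?a B z] unfolding D_def by blast
      moreover have "p \<noteq> \<phi> x"
      proof
        assume px: "p = \<phi> x"
        obtain u where u: "0 \<le> u" "u \<le> 1" "p = (1 - u) *\<^sub>R ?a + u *\<^sub>R z"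
          using p unfolding in_segment by blast
        have "Im p = (1 - u) * (Im (\<phi> x) + \<epsilon> / 2) + u * Im z" unfolding u(3) by simp
        then have "(1 - u) * (\<epsilon> / 2) + u * Im z = 0" unfolding px U(3) by simp
        moreover have "0 \<le> u * Im z" using u z by (simp add: D_def B_def half_plane_def)
        moreover have "0 \<le> (1 - u) * (\<epsilon> / 2)" using u e(1) by simp
        ultimately have "(1 - u) * (\<epsilon> / 2) = 0" by linarith
        then have "u = 1" using e(1) by simp
        then show False using u(3) px z by (simp add: D_def)
      qed
      ultimately show "p \<in> D" by (simp add: D_def)
    qed
  qed
  then have "connected D" by (rule starlike_imp_connected)
  then have "connectedin (top_of_set (\<phi> ` U)) D"
    using BU by (auto simp: connectedin_subtopology D_def)
  then have T: "connectedin ?X (g ` D)"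
    using connectedin_continuous_map_image[OF chart_inverse_continuous[OF c]] unfolding g_def by blast
  have TF: "y \<notin> F" "y \<noteq> x" if "y \<in> g ` D" for y
  proof -
    obtain z where "z \<in> D" "y = g z" using \<open>y \<in> g ` D\<close> by blast
    then show "y \<notin> F" "y \<noteq> x" using gB[of z] by (auto simp: D_def)
  qed
  have TX: "g ` D \<subseteq> topspace ?X" using T by (simp add: connectedin_subset_topspace)
  show False
  proof (rule connectedinD[OF T G_open])
    show "openin ?X (topspace ?X - H)" using H_closed by (simp add: closedin_def)
    show "g ` D \<subseteq> G \<union> (topspace ?X - H)" using HG TF TX by blast
    show "G \<inter> (topspace ?X - H) \<inter> g ` D = {}" using GH TF by blast
    show "G \<inter> g ` D \<noteq> {}"
    proof -
      obtain a where a: "a \<in> C" using ne by blast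
      have "openin (top_of_set half_plane) B" unfolding B_def by (simp add: openin_Int_open Int_commute)
      then have "openin ?X (g ` B)" using chart_inverse_open[OF c BU] unfolding g_def by blast
      then have "openin (top_of_set (cball 0 1)) {z \<in> topspace (top_of_set (cball 0 1)). param (fst a) z \<in> g ` B}"
        using openin_continuous_map_preimage polygon_in.param_cont[OF polygons[OF fstC(1)[OF a]]] by blast
      then have "openin (top_of_set (cball 0 1)) {z \<in> cball 0 1. param (fst a) z \<in> g ` B}" by simp
      moreover have "corner a \<in> {z \<in> cball 0 1. param (fst a) z \<in> g ` B}"
        using pt[OF a] xB g(1)[OF U(2)] by (auto simp: corner_def intro!: image_eqI[of _ g "\<phi> x"])
      ultimately obtain r where r: "0 < r" "ball (corner a) r \<inter> cball 0 1 \<subseteq> {z \<in> cball 0 1. param (fst a) z \<in> g ` B}"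
        using openin_contains_ball by (metis (no_types, lifting))
      define cs where "cs = cos (pi / real (num_sides (fst a)))"
      have cs: "- 1 \<le> cs" "cs < 1" using cos_less(2)[OF a] by (simp_all add: cs_def)
      define \<delta> where "\<delta> = min (r / 2) ((1 - cs) / 2)"
      have d: "0 < \<delta>" "\<delta> < r" "cs < 1 - \<delta>" "\<delta> \<le> 1"
        using r(1) cs by (simp_all add: \<delta>_def min_def field_simps)
      define z where "z = (1 - \<delta>) *\<^sub>R corner a"
      have n: "norm (corner a) = 1" by (simp add: corner_def)
      have "corner a - z = \<delta> *\<^sub>R corner a" by (simp add: z_def algebra_simps)
      then have "dist (corner a) z = \<delta>" using d(1) n by (simp add: dist_norm)
      moreover have "norm z \<le> 1" using d n by (simp add: z_def)
      ultimately have "z \<in> ball (corner a) r \<inter> cball 0 1" using d(2) by (simp add: dist_norm)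
      then have pz: "param (fst a) z \<in> g ` B" using r(2) by blast
      have "z * cnj (corner a) = of_real (1 - \<delta>)" using one[of a] by (simp add: z_def scaleR_conv_of_real mult.assoc)
      then have "Re (z * cnj (corner a)) = 1 - \<delta>" by simp
      moreover have "z \<noteq> corner a" using \<open>dist (corner a) z = \<delta>\<close> d(1) by auto
      ultimately have "z \<in> cap a" using d(3) \<open>norm z \<le> 1\<close> by (simp add: cap_def cs_def)
      then have pG: "param (fst a) z \<in> G" unfolding G_def using a by blast
      obtain p where p: "p \<in> B" "param (fst a) z = g p" using pz by blast
      have "p \<noteq> \<phi> x" using p(2) pG xG g(1)[OF U(2)] by auto
      then have "param (fst a) z \<in> g ` D" using p by (simp add: D_def)
      then show ?thesis using pG by blast
    qed
    show "(topspace ?X - H) \<inter> g ` D \<noteq> {}"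
    proof -
      let ?b = "\<phi> x + of_real (\<epsilon> / 2)"
      have b: "?b \<in> D" using e(1) U(3) by (simp add: D_def B_def half_plane_def dist_norm)
      then have gb: "g ?b \<in> U" "\<phi> (g ?b) = ?b" using gB[of ?b] by (auto simp: D_def)
      have "Im (\<phi> (g ?b)) = 0" unfolding gb(2) using U(3) by simp
      then have "g ?b \<in> boundary_of S" unfolding surface_boundary_def using U(1) gb(1) by blast
      then have "g ?b \<notin> G" using GX by blast
      then have "g ?b \<notin> H" using HG TF(2) b by blast
      then show ?thesis using TX b by blast
    qed
  qed
qed

text \<open>The marked point at an end of an arc.\<close>

abbreviation end_point :: "'p curve \<times> real \<Rightarrow> 'p" where
  "end_point e \<equiv> fst e (snd e)"

lemma corner_image:
  assumes "P \<in> \<P>" "has_next P i"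
  shows "param P (corner (P, i)) = end_point (angle_tail_end (P, i))"
    "param P (corner (P, i)) = end_point (angle_head_end (P, i))"
proof -
  note b = has_next_bounds[OF assms(2)]
  show "param P (corner (P, i)) = end_point (angle_tail_end (P, i))"
    using edge_point(1)[OF assms(1) b(1,2), of 1] by (simp add: corner_def angle_ends)
  have "corner (P, i) = side P (next_edge P i) 0"
    using next_corner[OF assms(2), of 0] by (simp add: corner_def side_eq)
  then show "param P (corner (P, i)) = end_point (angle_head_end (P, i))"
    using edge_point(1)[OF assms(1) b(3,4), of 0] by (simp add: angle_ends)
qed

lemma finite_quiver: "finite (arcs (gentle_quiver \<Delta> \<P>))"
proof (rule finite_subset)
  show "arcs (gentle_quiver \<Delta> \<P>) \<subseteq> (SIGMA P:\<P>. {..num_edges P})"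
    by (auto simp: gentle_quiver_def has_next_def)
qed (use finite_polygons in auto)

lemma quiver_wf: "wf_digraph (gentle_quiver \<Delta> \<P>)"
  by unfold_locales (auto simp: gentle_quiver_def intro!: polygon_edges intro: has_next_bounds)

text \<open>Nonzero paths turn around a marked point on the boundary, hence they do not repeat an arrow.\<close>

lemma nonzero_path_distinct:
  assumes "w \<in> nonzero_paths (gentle_quiver \<Delta> \<P>) (gentle_relations \<Delta> \<P>)"
  shows "distinct (snd w)" "set (snd w) \<subseteq> arcs (gentle_quiver \<Delta> \<P>)" "fst w \<in> \<Delta>"
proof -
  let ?Q = "gentle_quiver \<Delta> \<P>"
  interpret wf_digraph ?Q by (rule quiver_wf)
  have walk: "awalk (fst w) (snd w) (path_end ?Q w)"
    and succ: "successively (\<lambda>a b. (a, b) \<notin> gentle_relations \<Delta> \<P>) (snd w)"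
    using assms by (auto simp: nonzero_paths_def)
  show sub: "set (snd w) \<subseteq> arcs ?Q" using walk by (auto simp: awalk_def)
  have "fst w \<in> verts ?Q" using walk by (simp add: awalk_def)
  then show "fst w \<in> \<Delta>" by (simp add: gentle_quiver_def)
  have "successively (\<lambda>a b. head ?Q a = tail ?Q b) l" if "cas u l v" for u l v
    using that by (induction l arbitrary: u rule: induct_list012) auto
  then have consec: "successively (\<lambda>a b. head ?Q a = tail ?Q b) (snd w)" using walk by (auto simp: awalk_def)
  have ends: "angle_head_end (snd w ! i) = angle_tail_end (snd w ! Suc i)" if "Suc i < length (snd w)" for i
  proof -
    have "head ?Q (snd w ! i) = tail ?Q (snd w ! Suc i)" "(snd w ! i, snd w ! Suc i) \<notin> gentle_relations \<Delta> \<P>"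
      using that consec succ unfolding successively_conv_nth by blast+
    moreover have "snd w ! i \<in> arcs ?Q" "snd w ! Suc i \<in> arcs ?Q" using that sub by (auto dest: nth_mem)
    ultimately show ?thesis by (simp add: gentle_relations_def)
  qed
  show "distinct (snd w)"
  proof (rule ccontr)
    assume "\<not> distinct (snd w)"
    then obtain as y bs cs where l: "snd w = as @ [y] @ bs @ [y] @ cs" using not_distinct_decomp by blast
    define n where "n = Suc (length bs)"
    define c where "c i = snd w ! (length as + i)" for i
    have len: "length as + n < length (snd w)" by (simp add: l n_def)
    have c0: "c 0 = y" "c n = y" by (simp_all add: c_def l n_def nth_append)
    have step: "angle_head_end (c i) = angle_tail_end (c (Suc i))" if "i < n" for i
      using ends[of "length as + i"] that len by (simp add: c_def)
    have arcC: "c i \<in> arcs ?Q" if "i \<le> n" for i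
      using that len sub unfolding c_def by (intro subsetD[OF sub] nth_mem) simp
    have cP: "P \<in> \<P> \<and> has_next P i" if Pi: "(P, i) \<in> c ` {..<n}" for P i
    proof -
      obtain j where "j < n" "(P, i) = c j" using Pi by blast
      then have "(P, i) \<in> arcs ?Q" using arcC[of j] by simp
      then show ?thesis by (simp add: gentle_quiver_def)
    qed
    have point: "param (fst (c i)) (corner (c i)) = end_point (angle_tail_end y)" if "i < n" for i
      using that
    proof (induction i)
      case 0
      then show ?case using cP[of "fst (c 0)" "snd (c 0)"] corner_image(1)[of "fst (c 0)" "snd (c 0)"] c0 by force
    next
      case (Suc i)
      have "param (fst (c (Suc i))) (corner (c (Suc i))) = end_point (angle_tail_end (c (Suc i)))"
        using cP[of "fst (c (Suc i))" "snd (c (Suc i))"] corner_image(1)[of "fst (c (Suc i))" "snd (c (Suc i))"] Suc.prems by force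
      also have "\<dots> = end_point (angle_head_end (c i))" using step[of i] Suc.prems by simp
      also have "\<dots> = param (fst (c i)) (corner (c i))"
        using cP[of "fst (c i)" "snd (c i)"] corner_image(2)[of "fst (c i)" "snd (c i)"] Suc.prems by force
      finally show ?case using Suc by simp
    qed
    show False
    proof (rule no_cycle[of "c ` {..<n}" "end_point (angle_tail_end y)"])
      show "c ` {..<n} \<noteq> {}" by (simp add: n_def lessThan_empty_iff)
      show "P \<in> \<P> \<and> has_next P i" if "(P, i) \<in> c ` {..<n}" for P i using cP that .
      show "\<exists>b\<in>c ` {..<n}. angle_tail_end b = angle_head_end a" if a: "a \<in> c ` {..<n}" for a
      proof -
        obtain i where i: "i < n" "a = c i" using a by auto
        show ?thesis
        proof (cases "Suc i < n")
          case True
          then show ?thesis using step[OF i(1)] i(2) by (intro bexI[of _ "c (Suc i)"]) auto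
        next
          case False
          then have "Suc i = n" using i(1) by simp
          then show ?thesis using step[OF i(1)] i(2) c0 by (intro bexI[of _ "c 0"]) (auto simp: n_def)
        qed
      qed
      show "\<exists>b\<in>c ` {..<n}. angle_head_end b = angle_tail_end a" if a: "a \<in> c ` {..<n}" for a
      proof -
        obtain i where i: "i < n" "a = c i" using a by auto
        show ?thesis
        proof (cases i)
          case 0
          have "n - 1 < n" "Suc (n - 1) = n" by (simp_all add: n_def)
          then show ?thesis using step[of "n - 1"] i(2) 0 c0 by (intro bexI[of _ "c (n - 1)"]) auto
        next
          case (Suc j)
          then show ?thesis using step[of j] i by (intro bexI[of _ "c j"]) auto
        qed
      qed
      show "param (fst a) (corner a) = end_point (angle_tail_end y)" if "a \<in> c ` {..<n}" for a
        using that point by auto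
      show "end_point (angle_tail_end y) \<in> boundary_of S"
      proof -
        have "y \<in> c ` {..<n}" using c0(1) by (auto simp: n_def)
        then have y: "fst y \<in> \<P>" "has_next (fst y) (snd y)" using cP[of "fst y" "snd y"] by simp_all
        have "edge_arc (fst y) (snd y) \<in> \<Delta>" using polygon_edges[OF y(1) has_next_bounds(1,2)[OF y(2)]] .
        then show ?thesis using arc_ends angle_ends(1)[of "fst y" "snd y"] by auto
      qed
    qed simp
  qed
qed

lemma finite_nonzero_paths: "finite (nonzero_paths (gentle_quiver \<Delta> \<P>) (gentle_relations \<Delta> \<P>))"
proof (rule finite_subset)
  show "nonzero_paths (gentle_quiver \<Delta> \<P>) (gentle_relations \<Delta> \<P>)
    \<subseteq> \<Delta> \<times> {l. set l \<subseteq> arcs (gentle_quiver \<Delta> \<P>) \<and> distinct l}"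
    using nonzero_path_distinct by fastforce
  show "finite (\<Delta> \<times> {l. set l \<subseteq> arcs (gentle_quiver \<Delta> \<P>) \<and> distinct l})"
    using finite_arcs finite_subset_distinct[OF finite_quiver] by (rule finite_cartesian_product)
qed

end

section \<open>Spaces of functions\<close>

lemma fun_subspaceI:
  assumes "0 \<in> U" "\<And>f g. f \<in> U \<Longrightarrow> g \<in> U \<Longrightarrow> f + g \<in> U" "\<And>c f. f \<in> U \<Longrightarrow> fscale c f \<in> U"
  shows "fun_subspace U"
  using assms by (auto simp: fun_space.subspace_def)

lemma sum_fun_apply: "(\<Sum>i\<in>I. f i) x = (\<Sum>i\<in>I. f i x)"
  by (induction I rule: infinite_finite_induct) auto

lemma supported_in_span:
  assumes "finite X"
  shows "{f :: 'b \<Rightarrow> 'k::field. \<forall>x. x \<notin> X \<longrightarrow> f x = 0} \<subseteq> fun_span ((\<lambda>x y. if y = x then 1 else 0) ` X)"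
proof
  fix f :: "'b \<Rightarrow> 'k" assume f: "f \<in> {f. \<forall>x. x \<notin> X \<longrightarrow> f x = 0}"
  have "f = (\<Sum>x\<in>X. fscale (f x) (\<lambda>y. if y = x then 1 else 0))"
  proof
    fix y
    have "(\<Sum>x\<in>X. fscale (f x) (\<lambda>y. if y = x then 1 else 0)) y = (\<Sum>x\<in>X. if y = x then f x else 0)"
      unfolding sum_fun_apply by (intro sum.cong) (auto simp: fscale_def)
    also have "\<dots> = f y" using f assms by auto
    finally show "f y = (\<Sum>x\<in>X. fscale (f x) (\<lambda>y. if y = x then 1 else 0)) y" by simp
  qed
  also have "\<dots> \<in> fun_span ((\<lambda>x y. if y = x then 1 else 0) ` X)"
    by (intro fun_space.span_sum fun_space.span_scale fun_space.span_base) auto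
  finally show "f \<in> fun_span ((\<lambda>x y. if y = x then 1 else 0) ` X)" .
qed

lemma fd_moduleI:
  fixes M :: "('b, 'x, 'k::field) rmod"
  assumes "right_module A M" "finite X" "\<And>f x. f \<in> mcarrier M \<Longrightarrow> x \<notin> X \<Longrightarrow> f x = 0"
  shows "fd_module A M"
proof -
  have "mcarrier M \<subseteq> fun_span ((\<lambda>x y. if y = x then 1 else 0) ` X)"
    using assms(3) supported_in_span[OF assms(2), where ?'k = 'k] by blast
  then show ?thesis using assms(1,2) unfolding fd_module_def by blast
qed

lemma subspace_zero: "fun_subspace U \<Longrightarrow> 0 \<in> U"
  by (simp add: fun_space.subspace_def)

lemma subspace_sum:
  assumes "fun_subspace U" "\<And>i. i \<in> I \<Longrightarrow> f i \<in> U"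
  shows "(\<Sum>i\<in>I. f i) \<in> U"
  using fun_space.subspace_sum assms by blast

lemma module_hom_zero:
  assumes "module_hom A M N f" "right_module A M"
  shows "f 0 = 0"
proof -
  have "0 \<in> mcarrier M" using assms(2) by (simp add: right_module_def subspace_zero)
  then have "f (fscale 0 0) = fscale 0 (f 0)" using assms(1) unfolding module_hom_def by blast
  then show ?thesis by simp
qed

lemma module_hom_sum:
  assumes "module_hom A M N f" "right_module A M" "finite I" "\<And>i. i \<in> I \<Longrightarrow> g i \<in> mcarrier M"
  shows "f (\<Sum>i\<in>I. g i) = (\<Sum>i\<in>I. f (g i))"
  using assms(3,4)
proof (induction I rule: finite_induct)
  case empty then show ?case using module_hom_zero[OF assms(1,2)] by (simp add: zero_fun_def)
next
  case (insert x F)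
  have "(\<Sum>i\<in>F. g i) \<in> mcarrier M"
    using insert assms(2) by (intro subspace_sum) (auto simp: right_module_def)
  then have "f (g x + (\<Sum>i\<in>F. g i)) = f (g x) + f (\<Sum>i\<in>F. g i)"
    using insert(4) assms(1) unfolding module_hom_def by blast
  also have "f (\<Sum>i\<in>F. g i) = (\<Sum>i\<in>F. f (g i))" using insert by blast
  finally show ?case unfolding sum.insert[OF insert(1,2)] .
qed

section \<open>Bound quiver algebras\<close>

lemma path_end_eq: "path_end Q (v, p) = (if p = [] then v else head Q (last p))"
proof (induction p arbitrary: v)
  case (Cons a p)
  have "pre_digraph.awalk_verts Q u p \<noteq> []" for u
    by (cases p) (auto simp: pre_digraph.awalk_verts.simps)
  then show ?case using Cons by (simp add: path_end_def pre_digraph.awalk_verts.simps)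
qed (simp add: path_end_def pre_digraph.awalk_verts.simps)

lemma path_end_append: "path_end Q (v, p @ q) = path_end Q (path_end Q (v, p), q)"
  by (simp add: path_end_eq)

text \<open>A quiver with relations of length two for which the algebra is finite-dimensional, as the nonzero
  paths form a basis.\<close>

locale bound_quiver = wf_digraph Q for Q :: "('v, 'a) pre_digraph" +
  fixes R :: "('a \<times> 'a) set"
  assumes finite_paths: "finite (nonzero_paths Q R)"
begin

abbreviation NP :: "('v, 'a) qpath set" where
  "NP \<equiv> nonzero_paths Q R"

abbreviation A :: "(('v, 'a) qpath, 'k::field) alg" where
  "A \<equiv> bound_quiver_algebra Q R"

lemma trivial_path_iff: "(v, []) \<in> NP \<longleftrightarrow> v \<in> verts Q"
  by (simp add: nonzero_paths_def awalk_Nil_iff path_end_eq)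

lemma append_path_iff:
  "(v, p @ q) \<in> NP \<longleftrightarrow> (v, p) \<in> NP \<and> (path_end Q (v, p), q) \<in> NP \<and>
     (p \<noteq> [] \<longrightarrow> q \<noteq> [] \<longrightarrow> (last p, hd q) \<notin> R)"
proof -
  have "awlast v p = path_end Q (v, p)" "awlast v (p @ q) = path_end Q (v, p @ q)" for v p q
    by (simp_all add: path_end_def)
  then show ?thesis
    by (auto simp: nonzero_paths_def successively_append_iff path_end_append)
qed

lemma take_path: "(v, p) \<in> NP \<Longrightarrow> (v, take i p) \<in> NP"
  using append_path_iff[of v "take i p" "drop i p"] by simp

lemma drop_path: "(v, p) \<in> NP \<Longrightarrow> (path_end Q (v, take i p), drop i p) \<in> NP"
  using append_path_iff[of v "take i p" "drop i p"] by simp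

lemma path_start_vertex: "w \<in> NP \<Longrightarrow> fst w \<in> verts Q"
  by (auto simp: nonzero_paths_def)

lemma path_end_vertex: "w \<in> NP \<Longrightarrow> path_end Q w \<in> verts Q"
  by (auto simp: nonzero_paths_def)

lemma acarrier_iff: "x \<in> acarrier A \<longleftrightarrow> (\<forall>w. x w \<noteq> 0 \<longrightarrow> w \<in> NP)"
proof -
  have "finite {w. x w \<noteq> 0}" if "{w. x w \<noteq> 0} \<subseteq> NP"
    using finite_subset[OF that finite_paths] .
  moreover have "{w. x w \<noteq> 0} \<subseteq> NP \<longleftrightarrow> (\<forall>w. x w \<noteq> 0 \<longrightarrow> w \<in> NP)" by blast
  ultimately show ?thesis unfolding bound_quiver_algebra_def by auto
qed

lemma amult_apply:
  "amult A x y w = (if w \<in> NP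
         then \<Sum>i\<le>length (snd w). x (fst w, take i (snd w)) *
                y (path_end Q (fst w, take i (snd w)), drop i (snd w))
         else 0)"
  by (simp add: bound_quiver_algebra_def)

lemma amult_closed: "amult A x y \<in> acarrier A"
  by (simp add: acarrier_iff amult_apply)

lemma amult_add_left: "amult A (x + x') y = amult A x y + amult A x' y"
  by (auto simp: fun_eq_iff amult_apply distrib_right sum.distrib)

lemma amult_add_right: "amult A x (y + y') = amult A x y + amult A x y'"
  by (auto simp: fun_eq_iff amult_apply distrib_left sum.distrib)

lemma amult_scale_left: "amult A (fscale c x) y = fscale c (amult A x y)"
  by (auto simp: fun_eq_iff amult_apply fscale_def sum_distrib_left mult.assoc)

lemma amult_scale_right: "amult A x (fscale c y) = fscale c (amult A x y)"
  by (auto simp: fun_eq_iff amult_apply fscale_def sum_distrib_left mult.left_commute)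

lemma amult_zero_left: "amult A (\<lambda>_. 0) y = (\<lambda>_. 0)"
  by (auto simp: fun_eq_iff amult_apply)

lemma sum_pairs_reindex:
  fixes h :: "nat \<Rightarrow> nat \<Rightarrow> 'c::comm_monoid_add"
  shows "(\<Sum>i\<le>n. \<Sum>j\<le>i. h j i) = (\<Sum>j\<le>n. \<Sum>k\<le>n - j. h j (j + k))"
proof -
  have "(\<Sum>i\<le>n. \<Sum>j\<le>i. h j i) = (\<Sum>(i, j)\<in>(SIGMA i:{..n}. {..i}). h j i)"
    by (simp add: sum.Sigma)
  also have "\<dots> = (\<Sum>(j, k)\<in>(SIGMA j:{..n}. {..n - j}). h j (j + k))"
    by (rule sum.reindex_bij_witness[of _ "\<lambda>(j, k). (j + k, j)" "\<lambda>(i, j). (j, i - j)"]) auto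
  also have "\<dots> = (\<Sum>j\<le>n. \<Sum>k\<le>n - j. h j (j + k))"
    by (simp add: sum.Sigma)
  finally show ?thesis .
qed

lemma amult_assoc: "amult A (amult A x y) z = amult A x (amult A y z)"
proof
  fix w :: "('v, 'a) qpath"
  obtain v p where w: "w = (v, p)" by (cases w)
  show "amult A (amult A x y) z w = amult A x (amult A y z) w"
  proof (cases "w \<in> NP")
    case False then show ?thesis by (simp add: amult_apply)
  next
    case True
    let ?e = "\<lambda>i. path_end Q (v, take i p)"
    define h where "h j i = x (v, take j p) * (y (?e j, drop j (take i p)) * z (?e i, drop i p))" for j i
    have "amult A (amult A x y) z w
        = (\<Sum>i\<le>length p. amult A x y (v, take i p) * z (?e i, drop i p))"
      using True by (simp add: amult_apply[of "amult A x y"] w)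
    also have "\<dots> = (\<Sum>i\<le>length p. \<Sum>j\<le>i. h j i)"
    proof (rule sum.cong)
      fix i assume i: "i \<in> {..length p}"
      have "amult A x y (v, take i p) = (\<Sum>j\<le>i. x (v, take j p) * y (?e j, drop j (take i p)))"
        using take_path[of v p i] True i by (auto simp: amult_apply w min_def intro!: sum.cong)
      then show "amult A x y (v, take i p) * z (?e i, drop i p) = (\<Sum>j\<le>i. h j i)"
        by (simp add: h_def sum_distrib_right mult.assoc)
    qed simp
    also have "\<dots> = (\<Sum>j\<le>length p. \<Sum>k\<le>length p - j. h j (j + k))"
      by (rule sum_pairs_reindex)
    also have "\<dots> = (\<Sum>j\<le>length p. x (v, take j p) * amult A y z (?e j, drop j p))"
    proof (rule sum.cong)
      fix j assume j: "j \<in> {..length p}"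
      have *: "path_end Q (?e j, take k (drop j p)) = ?e (j + k)" for k
        by (metis path_end_append take_add)
      have "amult A y z (?e j, drop j p) = (\<Sum>k\<le>length p - j.
          y (?e j, take k (drop j p)) * z (?e (j + k), drop k (drop j p)))"
        using drop_path[of v p j] True * by (simp add: amult_apply w)
      also have "\<dots> = (\<Sum>k\<le>length p - j. y (?e j, drop j (take (j + k) p)) * z (?e (j + k), drop (j + k) p))"
        by (simp add: drop_take add.commute)
      finally show "(\<Sum>k\<le>length p - j. h j (j + k)) = x (v, take j p) * amult A y z (?e j, drop j p)"
        by (simp add: h_def sum_distrib_left)
    qed simp
    also have "\<dots> = amult A x (amult A y z) w" using True by (simp add: amult_apply[of x] w)
    finally show ?thesis .
  qed
qed

text \<open>The residue class of a path, multiplied from the left, shifts the coefficients along the path.\<close>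

lemma amult_path_elem:
  "amult A (path_elem u) y w =
     (if w \<in> NP \<and> fst w = fst u \<and> take (length (snd u)) (snd w) = snd u
      then y (path_end Q u, drop (length (snd u)) (snd w)) else 0)"
proof (cases "w \<in> NP")
  case True
  obtain v p where w: "w = (v, p)" by (cases w)
  have "amult A (path_elem u) y w = (\<Sum>i\<le>length p. if i = length (snd u) \<and> v = fst u \<and> take i p = snd u
     then y (path_end Q u, drop (length (snd u)) p) else 0)"
    using True by (auto simp: amult_apply w path_elem_def intro!: sum.cong)
  also have "\<dots> = (\<Sum>i\<in>{..length p} \<inter> {i. i = length (snd u) \<and> v = fst u \<and> take i p = snd u}. y (path_end Q u, drop (length (snd u)) p))"
    by (simp add: sum.If_cases)
  also have "\<dots> = (if v = fst u \<and> take (length (snd u)) p = snd u then y (path_end Q u, drop (length (snd u)) p) else 0)"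
  proof (cases "v = fst u \<and> take (length (snd u)) p = snd u")
    case c: True
    have "length (snd u) \<le> length p" using c by (metis length_take min.cobounded1)
    then have "{..length p} \<inter> {i. i = length (snd u) \<and> v = fst u \<and> take i p = snd u} = {length (snd u)}"
      using c by auto
    then show ?thesis using c by simp
  next
    case False
    then have "{..length p} \<inter> {i. i = length (snd u) \<and> v = fst u \<and> take i p = snd u} = {}" by auto
    then show ?thesis using False by auto
  qed
  finally show ?thesis using True by (simp add: w)
qed (simp add: amult_apply)

lemma amult_trivial: "amult A (path_elem (v, [])) y w = (if w \<in> NP \<and> fst w = v then y w else 0)"
  by (cases w) (auto simp: amult_path_elem path_end_eq)

lemma indec_projective_carrier:
  "f \<in> mcarrier (indec_projective A v) \<longleftrightarrow> (\<forall>w. f w \<noteq> 0 \<longrightarrow> w \<in> NP \<and> fst w = v)"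
proof
  assume "f \<in> mcarrier (indec_projective A v)"
  then show "\<forall>w. f w \<noteq> 0 \<longrightarrow> w \<in> NP \<and> fst w = v"
    by (auto simp: indec_projective_def amult_trivial split: if_splits)
next
  assume f: "\<forall>w. f w \<noteq> 0 \<longrightarrow> w \<in> NP \<and> fst w = v"
  then have "f = amult A (path_elem (v, [])) f" by (auto simp: fun_eq_iff amult_trivial)
  moreover have "f \<in> acarrier A" using f by (auto simp: acarrier_iff)
  ultimately show "f \<in> mcarrier (indec_projective A v)" by (auto simp: indec_projective_def)
qed

lemma amult_one:
  assumes "\<And>w. x w \<noteq> 0 \<Longrightarrow> w \<in> NP"
  shows "amult A x (aone A) = x"
proof
  fix w :: "('v, 'a) qpath"
  obtain v p where w: "w = (v, p)" by (cases w)
  show "amult A x (aone A) w = x w"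
  proof (cases "w \<in> NP")
    case True
    have "x (fst w, take i (snd w)) * aone A (path_end Q (fst w, take i (snd w)), drop i (snd w)) =
        (if i = length p then x w else 0)" if "i \<in> {..length p}" for i
      using path_end_vertex[OF True] that by (auto simp: w bound_quiver_algebra_def)
    then have "amult A x (aone A) w = (\<Sum>i\<le>length p. if i = length p then x w else 0)"
      using True unfolding amult_apply by (auto simp: w intro!: sum.cong)
    then show ?thesis by simp
  next
    case False
    then have "x w = 0" using assms by blast
    then show ?thesis using False by (simp add: amult_apply)
  qed
qed

end

section \<open>Complexes given by diagrams of projectives\<close>

lemma act_zero:
  assumes "right_module A N" "x \<in> acarrier A"
  shows "mact N 0 x = 0"
proof -
  have "0 \<in> mcarrier N" using assms(1) by (simp add: right_module_def subspace_zero)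
  then have "mact N (fscale 0 0) x = fscale 0 (mact N 0 x)"
    using assms unfolding right_module_def by blast
  then show ?thesis by simp
qed

lemma hom_kernel_submodule:
  assumes f: "module_hom A M N f" and M: "right_module A M" and N: "right_module A N"
  shows "submodule A M (hom_kernel M f)"
  unfolding submodule_def
proof (intro conjI ballI fun_subspaceI)
  show "hom_kernel M f \<subseteq> mcarrier M" by (auto simp: hom_kernel_def)
  show "0 \<in> hom_kernel M f"
    using module_hom_zero[OF f M] M unfolding hom_kernel_def right_module_def
    by (simp add: fun_space.subspace_def)
next
  fix g h assume gh: "g \<in> hom_kernel M f" "h \<in> hom_kernel M f"
  then have "g + h \<in> mcarrier M" using M unfolding right_module_def hom_kernel_def
    by (auto intro: fun_space.subspace_add)
  moreover have "f (g + h) = f g + f h" using gh f unfolding module_hom_def hom_kernel_def by blast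
  ultimately show "g + h \<in> hom_kernel M f" using gh by (auto simp: hom_kernel_def)
next
  fix c g assume g: "g \<in> hom_kernel M f"
  then have "fscale c g \<in> mcarrier M" using M unfolding right_module_def hom_kernel_def
    by (auto intro: fun_space.subspace_scale)
  moreover have "f (fscale c g) = fscale c (f g)" using g f unfolding module_hom_def hom_kernel_def by blast
  ultimately show "fscale c g \<in> hom_kernel M f" using g by (auto simp: hom_kernel_def)
next
  fix g x assume g: "g \<in> hom_kernel M f" and x: "x \<in> acarrier A"
  then have "mact M g x \<in> mcarrier M" using M unfolding right_module_def hom_kernel_def by blast
  moreover have "f (mact M g x) = mact N (f g) x" using g x f unfolding module_hom_def hom_kernel_def by blast
  ultimately show "mact M g x \<in> hom_kernel M f" using g act_zero[OF N x] by (auto simp: hom_kernel_def)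
qed

text \<open>There is a displayed map from node \<open>s'\<close> to node \<open>s\<close>, induced by the path \<open>u\<close>.\<close>

definition displayed_map :: "'w link list \<Rightarrow> nat \<Rightarrow> nat \<Rightarrow> 'w \<Rightarrow> bool" where
  "displayed_map L s' s u \<longleftrightarrow> s = Suc s' \<and> s' < length L \<and> L ! s' = Rightwards u \<or>
     s' = Suc s \<and> s < length L \<and> L ! s = Leftwards u"

text \<open>A diagram whose nodes have degrees, normalised to be natural numbers with minimum \<open>0\<close>: they are
  the negatives of the degrees in the complex. The number \<open>deg s\<close> is thus the place of the node \<open>s\<close>
  in a resolution.\<close>

locale graded_diagram = bound_quiver Q R for Q :: "('v, 'a) pre_digraph" and R +
  fixes V :: "'v list" and L :: "('v, 'a) qpath link list" and deg :: "nat \<Rightarrow> nat"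
  assumes length_nodes: "length V = length L + 1"
    and nodes: "s < length V \<Longrightarrow> V ! s \<in> verts Q"
    and degrees: "displayed_map L s' s u \<Longrightarrow> deg s' = deg s + 1"
    and top_degree: "\<exists>s<length V. deg s = 0"
    and paths: "displayed_map L s' s u \<Longrightarrow>
      u \<in> nonzero_paths Q R \<and> snd u \<noteq> [] \<and> fst u = V ! s \<and> path_end Q u = V ! s'"
begin

abbreviation C :: "nat \<Rightarrow> (nat \<times> ('v, 'a) qpath, ('v, 'a) qpath, 'k::field) rmod" where
  "C \<equiv> diagram_term A V L"

lemma displayed_map_nodes: "displayed_map L s' s u \<Longrightarrow> s' < length V \<and> s < length V"
  using length_nodes by (auto simp: displayed_map_def)

lemma relative_degree: "s \<le> length L \<Longrightarrow> relative_degree L s = int (deg 0) - int (deg s)"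
proof (induction s)
  case (Suc s)
  then have s: "s < length L" by simp
  show ?case
  proof (cases "L ! s")
    case (Rightwards u)
    then have "displayed_map L s (Suc s) u" using s by (simp add: displayed_map_def)
    from degrees[OF this] show ?thesis using Suc s Rightwards by (simp add: relative_degree_def)
  next
    case (Leftwards u)
    then have "displayed_map L (Suc s) s u" using s by (simp add: displayed_map_def)
    from degrees[OF this] show ?thesis using Suc s Leftwards by (simp add: relative_degree_def)
  qed
qed (simp add: relative_degree_def)

lemma node_degree: "s < length V \<Longrightarrow> node_degree V L s = - int (deg s)"
proof -
  assume s: "s < length V"
  have "Max (relative_degree L ` {..<length V}) = int (deg 0)"
  proof (rule Max_eqI)
    fix y assume "y \<in> relative_degree L ` {..<length V}"
    then show "y \<le> int (deg 0)" using relative_degree length_nodes by auto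
  next
    obtain t where "t < length V" "deg t = 0" using top_degree by blast
    then show "int (deg 0) \<in> relative_degree L ` {..<length V}"
      using relative_degree[of t] length_nodes by (intro image_eqI[of _ _ t]) auto
  qed simp
  then show ?thesis using s relative_degree[of s] length_nodes by (simp add: node_degree_def)
qed

definition nodes_of_degree :: "nat \<Rightarrow> nat set" where
  "nodes_of_degree d = {s. s < length V \<and> deg s = d}"

lemma finite_nodes_of_degree: "finite (nodes_of_degree d)"
  by (simp add: nodes_of_degree_def)

lemma term_carrier:
  "f \<in> mcarrier (C d) \<longleftrightarrow> (\<forall>s w. f (s, w) \<noteq> 0 \<longrightarrow> s \<in> nodes_of_degree d \<and> w \<in> NP \<and> fst w = V ! s)"
proof -
  have eq: "s < length V \<and> node_degree V L s = - int d \<longleftrightarrow> s \<in> nodes_of_degree d" for s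
    using node_degree by (auto simp: nodes_of_degree_def)
  have "f \<in> mcarrier (C d) \<longleftrightarrow> (\<forall>s. if s \<in> nodes_of_degree d
      then (\<lambda>w. f (s, w)) \<in> mcarrier (indec_projective A (V ! s)) else (\<lambda>w. f (s, w)) = 0)"
    unfolding diagram_term_def using eq by auto
  also have "\<dots> \<longleftrightarrow> (\<forall>s w. f (s, w) \<noteq> 0 \<longrightarrow> s \<in> nodes_of_degree d \<and> w \<in> NP \<and> fst w = V ! s)"
    unfolding indec_projective_carrier zero_fun_def fun_eq_iff by meson
  finally show ?thesis .
qed

lemma term_act: "mact (C d) f x (s, w) = amult A (\<lambda>w'. f (s, w')) x w"
  by (simp add: diagram_term_def)

lemma component_in_algebra: "f \<in> mcarrier (C d) \<Longrightarrow> (\<lambda>w. f (s, w)) \<in> acarrier A"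
  unfolding term_carrier acarrier_iff by blast

text \<open>Each path with a nonzero coefficient in a product is a product of paths with nonzero
  coefficients.\<close>

lemma amult_factors:
  assumes "amult A x y w \<noteq> 0"
  obtains p q where "x p \<noteq> 0" "y q \<noteq> 0" "fst p = fst w" "length (snd w) = length (snd p) + length (snd q)"
    "w \<in> NP"
proof -
  obtain v l where w: "w = (v, l)" by (cases w)
  have *: "w \<in> NP" "(\<Sum>i\<le>length l. x (v, take i l) * y (path_end Q (v, take i l), drop i l)) \<noteq> 0"
    using assms by (auto simp: amult_apply w split: if_splits)
  then obtain i where i: "i \<le> length l" "x (v, take i l) * y (path_end Q (v, take i l), drop i l) \<noteq> 0"
    by (meson atMost_iff sum.neutral)
  show thesis
    by (rule that[of "(v, take i l)" "(path_end Q (v, take i l), drop i l)"]) (use i * in \<open>auto simp: w\<close>)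
qed

lemma term_right_module: "right_module (A :: (_, 'k::field) alg) (C d)"
proof
  let ?C = "C d :: (_, _, 'k) rmod"
  show "fun_subspace (mcarrier ?C)"
  proof (rule fun_subspaceI)
    fix f g :: "nat \<times> ('v, 'a) qpath \<Rightarrow> 'k" assume "f \<in> mcarrier (C d)" "g \<in> mcarrier (C d)"
    then show "f + g \<in> mcarrier ?C"
      unfolding term_carrier plus_fun_def by (metis add.right_neutral add_0)
  qed (auto simp: term_carrier fscale_def)
next
  fix f :: "nat \<times> ('v, 'a) qpath \<Rightarrow> 'k" and x :: "('v, 'a) qpath \<Rightarrow> 'k"
  assume f: "f \<in> mcarrier (C d)" and x: "x \<in> acarrier A"
  show "mact (C d) f x \<in> mcarrier (C d)"
    unfolding term_carrier term_act
  proof (intro allI impI)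
    fix s w assume "amult A (\<lambda>w'. f (s, w')) x w \<noteq> 0"
    then obtain p where "f (s, p) \<noteq> 0" "fst p = fst w" "w \<in> NP" by (rule amult_factors)
    then show "s \<in> nodes_of_degree d \<and> w \<in> NP \<and> fst w = V ! s" using f unfolding term_carrier by metis
  qed
next
  fix f g :: "nat \<times> ('v, 'a) qpath \<Rightarrow> 'k" and x :: "('v, 'a) qpath \<Rightarrow> 'k"
  assume "f \<in> mcarrier (C d)" "g \<in> mcarrier (C d)" "x \<in> acarrier A"
  have "amult A (\<lambda>w. (f + g) (s, w)) x = amult A (\<lambda>w. f (s, w)) x + amult A (\<lambda>w. g (s, w)) x" for s
    unfolding amult_add_left[symmetric] by (simp add: plus_fun_def)
  then show "mact (C d) (f + g) x = mact (C d) f x + mact (C d) g x"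
    by (simp only: fun_eq_iff split_paired_All term_act plus_fun_apply) simp
next
  fix f :: "nat \<times> ('v, 'a) qpath \<Rightarrow> 'k" and x y :: "('v, 'a) qpath \<Rightarrow> 'k"
  assume "f \<in> mcarrier (C d)" "x \<in> acarrier A" "y \<in> acarrier A"
  show "mact (C d) f (x + y) = mact (C d) f x + mact (C d) f y"
    by (simp only: fun_eq_iff split_paired_All term_act plus_fun_apply amult_add_right) simp
next
  fix f :: "nat \<times> ('v, 'a) qpath \<Rightarrow> 'k" and x :: "('v, 'a) qpath \<Rightarrow> 'k" and c
  assume "f \<in> mcarrier (C d)" "x \<in> acarrier A"
  have "amult A (\<lambda>w. fscale c f (s, w)) x = fscale c (amult A (\<lambda>w. f (s, w)) x)" for s
    unfolding amult_scale_left[symmetric] by (simp add: fscale_def)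
  then show "mact (C d) (fscale c f) x = fscale c (mact (C d) f x)"
    by (simp only: fun_eq_iff split_paired_All fscale_def term_act) simp
next
  fix f :: "nat \<times> ('v, 'a) qpath \<Rightarrow> 'k" and x :: "('v, 'a) qpath \<Rightarrow> 'k" and c
  assume "f \<in> mcarrier (C d)" "x \<in> acarrier A"
  show "mact (C d) f (fscale c x) = fscale c (mact (C d) f x)"
    by (simp only: fun_eq_iff split_paired_All term_act amult_scale_right) (simp only: fscale_def term_act, simp)
next
  fix f :: "nat \<times> ('v, 'a) qpath \<Rightarrow> 'k" and x y :: "('v, 'a) qpath \<Rightarrow> 'k"
  assume "f \<in> mcarrier (C d)" "x \<in> acarrier A" "y \<in> acarrier A"
  show "mact (C d) f (amult A x y) = mact (C d) (mact (C d) f x) y"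
    by (simp only: fun_eq_iff split_paired_All term_act amult_assoc) simp
next
  fix f :: "nat \<times> ('v, 'a) qpath \<Rightarrow> 'k" assume f: "f \<in> mcarrier (C d)"
  have "amult A (\<lambda>w. f (s, w)) (aone A) = (\<lambda>w. f (s, w))" for s
    by (rule amult_one) (use f in \<open>unfold term_carrier, blast\<close>)
  then show "mact (C d) f (aone A) = f" by (simp only: fun_eq_iff split_paired_All term_act) simp
qed

lemma term_fd_module: "fd_module A (C d)"
proof (rule fd_moduleI[OF term_right_module, of "{..<length V} \<times> NP"])
  fix f :: "nat \<times> ('v, 'a) qpath \<Rightarrow> 'b" and x assume "f \<in> mcarrier (C d)" "x \<notin> {..<length V} \<times> NP"
  then show "f x = 0" unfolding term_carrier nodes_of_degree_def by (cases x) blast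
qed (use finite_paths in simp)

text \<open>The generator of the summand at node \<open>s\<close>.\<close>

definition gen :: "nat \<Rightarrow> nat \<times> ('v, 'a) qpath \<Rightarrow> 'k::field" where
  "gen s = (\<lambda>(t, w). if t = s \<and> w = (V ! s, []) then 1 else 0)"

lemma gen_carrier: "s \<in> nodes_of_degree d \<Longrightarrow> gen s \<in> mcarrier (C d)"
  by (auto simp: term_carrier gen_def trivial_path_iff nodes nodes_of_degree_def)

lemma gen_act:
  fixes f :: "_ \<Rightarrow> 'k::field"
  assumes "f \<in> mcarrier (C d)"
  shows "mact (C d) (gen s) (\<lambda>w. f (s, w)) (t, w) = (if t = s then f (s, w) else 0)"
proof -
  have 1: "(\<lambda>w'. gen s (s, w') :: 'k) = path_elem (V ! s, [])" by (auto simp: gen_def path_elem_def)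
  have 2: "(\<lambda>w'. gen s (t, w') :: 'k) = (\<lambda>_. 0)" if "t \<noteq> s" using that by (auto simp: gen_def)
  have "amult A (path_elem (V ! s, [])) (\<lambda>w. f (s, w)) w = f (s, w)"
    using assms unfolding term_carrier amult_trivial by (metis (full_types))
  then show ?thesis by (cases "t = s") (simp_all add: term_act 1 2 amult_zero_left)
qed

lemma gen_decomposition:
  assumes "f \<in> mcarrier (C d)"
  shows "f = (\<Sum>s\<in>nodes_of_degree d. mact (C d) (gen s) (\<lambda>w. f (s, w)))"
proof
  fix x :: "nat \<times> ('v, 'a) qpath"
  obtain t w where x: "x = (t, w)" by (cases x)
  have "(\<Sum>s\<in>nodes_of_degree d. mact (C d) (gen s) (\<lambda>w. f (s, w))) x =
    (\<Sum>s\<in>nodes_of_degree d. if t = s then f (s, w) else 0)"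
    unfolding sum_fun_apply x gen_act[OF assms] ..
  also have "\<dots> = (if t \<in> nodes_of_degree d then f x else 0)"
    using finite_nodes_of_degree[of d] by (simp add: x)
  also have "\<dots> = f x" using assms unfolding term_carrier x by metis
  finally show "f x = (\<Sum>s\<in>nodes_of_degree d. mact (C d) (gen s) (\<lambda>w. f (s, w))) x" by simp
qed

text \<open>The generators can be sent to any elements of a module. The element \<open>n s\<close> need not be multiplied
  by the idempotent of the vertex of \<open>s\<close>, since it is only acted on by paths starting there.\<close>

lemma hom_from_generators:
  fixes N :: "('c, ('v, 'a) qpath, 'k::field) rmod"
  assumes N: "right_module A N" and n: "\<And>s. s \<in> nodes_of_degree d \<Longrightarrow> n s \<in> mcarrier N"
  shows "module_hom A (C d) N (\<lambda>f. \<Sum>s\<in>nodes_of_degree d. mact N (n s) (\<lambda>w. f (s, w)))"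
proof -
  interpret N: right_module A N by fact
  note c = component_in_algebra
  show ?thesis
    unfolding module_hom_def
  proof (intro conjI ballI allI)
    fix f :: "nat \<times> ('v, 'a) qpath \<Rightarrow> 'k" assume f: "f \<in> mcarrier (C d)"
    show "(\<Sum>s\<in>nodes_of_degree d. mact N (n s) (\<lambda>w. f (s, w))) \<in> mcarrier N"
      using N.subspace by (rule subspace_sum) (intro N.act_closed n c[OF f])
    fix g :: "nat \<times> ('v, 'a) qpath \<Rightarrow> 'k" assume g: "g \<in> mcarrier (C d)"
    have "mact N (n s) (\<lambda>w. (f + g) (s, w)) = mact N (n s) (\<lambda>w. f (s, w)) + mact N (n s) (\<lambda>w. g (s, w))"
      if "s \<in> nodes_of_degree d" for s
      using N.act_add_right[OF n[OF that] c[OF f, of s] c[OF g, of s]] by (simp add: plus_fun_def)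
    then show "(\<Sum>s\<in>nodes_of_degree d. mact N (n s) (\<lambda>w. (f + g) (s, w))) =
      (\<Sum>s\<in>nodes_of_degree d. mact N (n s) (\<lambda>w. f (s, w))) + (\<Sum>s\<in>nodes_of_degree d. mact N (n s) (\<lambda>w. g (s, w)))"
      unfolding sum.distrib[symmetric] by (intro sum.cong) blast+
  next
    fix k and f :: "nat \<times> ('v, 'a) qpath \<Rightarrow> 'k" assume f: "f \<in> mcarrier (C d)"
    have "mact N (n s) (\<lambda>w. fscale k f (s, w)) = fscale k (mact N (n s) (\<lambda>w. f (s, w)))"
      if "s \<in> nodes_of_degree d" for s
      using N.act_scale_right[OF n[OF that] c[OF f, of s]] by (simp add: fscale_def)
    then show "(\<Sum>s\<in>nodes_of_degree d. mact N (n s) (\<lambda>w. fscale k f (s, w))) =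
      fscale k (\<Sum>s\<in>nodes_of_degree d. mact N (n s) (\<lambda>w. f (s, w)))"
      unfolding fun_space.scale_sum_right by (intro sum.cong) blast+
  next
    fix f x :: "_ \<Rightarrow> 'k" assume f: "f \<in> mcarrier (C d)" and x: "x \<in> acarrier A"
    have 1: "mact N (n s) (\<lambda>w. mact (C d) f x (s, w)) = mact N (mact N (n s) (\<lambda>w. f (s, w))) x"
      if "s \<in> nodes_of_degree d" for s
      using N.act_mult[OF n[OF that] c[OF f, of s] x] by (simp add: term_act)
    have "module_hom A N N (\<lambda>m. m)" by (simp add: module_hom_def)
    have 2: "mact N (\<Sum>s\<in>I. m s) x = (\<Sum>s\<in>I. mact N (m s) x)"
      if "finite I" "\<And>s. s \<in> I \<Longrightarrow> m s \<in> mcarrier N" for I :: "nat set" and m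
      using that
    proof (induction I rule: finite_induct)
      case empty
      show ?case using act_zero[OF N x] by (simp only: sum.empty)
    next
      case (insert i I)
      have "(\<Sum>s\<in>I. m s) \<in> mcarrier N" using N.subspace by (rule subspace_sum) (use insert in auto)
      then show ?case
        unfolding sum.insert[OF insert(1,2)]
        using insert.IH insert.prems N.act_add_left[of "m i" "\<Sum>s\<in>I. m s", OF _ _ x]
        by (simp only: insert_iff simp_thms)
    qed
    show "(\<Sum>s\<in>nodes_of_degree d. mact N (n s) (\<lambda>w. mact (C d) f x (s, w))) =
      mact N (\<Sum>s\<in>nodes_of_degree d. mact N (n s) (\<lambda>w. f (s, w))) x"
      by (subst 2[OF finite_nodes_of_degree N.act_closed[OF n c[OF f]]])
        (auto intro!: sum.cong 1)
  qed
qed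

lemma hom_on_generators:
  fixes h :: "_ \<Rightarrow> 'c \<Rightarrow> 'k::field"
  assumes "module_hom A (C d) N h" "f \<in> mcarrier (C d)"
  shows "h f = (\<Sum>s\<in>nodes_of_degree d. mact N (h (gen s)) (\<lambda>w. f (s, w)))"
proof -
  let ?c = "\<lambda>s w. f (s, w)"
  interpret right_module A "C d" by (rule term_right_module)
  have "h f = h (\<Sum>s\<in>nodes_of_degree d. mact (C d) (gen s) (?c s))"
    using gen_decomposition[OF assms(2)] by simp
  also have "\<dots> = (\<Sum>s\<in>nodes_of_degree d. h (mact (C d) (gen s) (?c s)))"
    by (rule module_hom_sum[OF assms(1) term_right_module finite_nodes_of_degree])
      (intro act_closed gen_carrier component_in_algebra[OF assms(2)])
  also have "\<dots> = (\<Sum>s\<in>nodes_of_degree d. mact N (h (gen s)) (?c s))"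
    using assms(1) gen_carrier component_in_algebra[OF assms(2)] unfolding module_hom_def
    by (intro sum.cong) blast+
  finally show ?thesis .
qed

lemma term_projective: "projective_module (A :: (_, 'k::field) alg) (C d)"
  unfolding projective_module_def
proof (intro conjI allI impI)
  fix N N' :: "(nat, ('v, 'a) qpath, 'k) rmod" and g f
  assume *: "fd_module A N \<and> fd_module A N' \<and> module_hom A N N' g \<and> g ` mcarrier N = mcarrier N' \<and>
    module_hom A (C d) N' f"
  have "\<exists>m\<in>mcarrier N. g m = f (gen s)" if "s \<in> nodes_of_degree d" for s
  proof -
    have "f (gen s) \<in> mcarrier N'" using * gen_carrier[OF that] unfolding module_hom_def by blast
    then show ?thesis using * by (metis imageE)
  qed
  then obtain n where n: "\<And>s. s \<in> nodes_of_degree d \<Longrightarrow> n s \<in> mcarrier N \<and> g (n s) = f (gen s)" by metis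
  let ?h = "\<lambda>x. \<Sum>s\<in>nodes_of_degree d. mact N (n s) (\<lambda>w. x (s, w))"
  have N: "right_module A N" using * by (simp add: fd_module_def)
  interpret N: right_module A N by fact
  have "module_hom A (C d) N ?h" using hom_from_generators[OF N] n by blast
  moreover have "g (?h x) = f x" if x: "x \<in> mcarrier (C d)" for x
  proof -
    have "g (?h x) = (\<Sum>s\<in>nodes_of_degree d. g (mact N (n s) (\<lambda>w. x (s, w))))"
      using * n by (intro module_hom_sum[OF _ N finite_nodes_of_degree])
        (blast intro: N.act_closed component_in_algebra[OF x])+
    also have "\<dots> = (\<Sum>s\<in>nodes_of_degree d. mact N' (f (gen s)) (\<lambda>w. x (s, w)))"
    proof (rule sum.cong[OF refl])
      fix s assume s: "s \<in> nodes_of_degree d"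
      have "g (mact N (n s) (\<lambda>w. x (s, w))) = mact N' (g (n s)) (\<lambda>w. x (s, w))"
        using * n[OF s] component_in_algebra[OF x] unfolding module_hom_def by blast
      then show "g (mact N (n s) (\<lambda>w. x (s, w))) = mact N' (f (gen s)) (\<lambda>w. x (s, w))"
        using n[OF s] by simp
    qed
    also have "\<dots> = f x" using hom_on_generators[of d N' f x] * x by simp
    finally show ?thesis .
  qed
  ultimately show "\<exists>h. module_hom A (C d) N h \<and> (\<forall>x\<in>mcarrier (C d). g (h x) = f x)" by blast
qed (rule term_fd_module)

text \<open>Nakayama's lemma: since long paths are zero, a submodule contained in the radical is
  superfluous.\<close>

lemma radical_superfluous:
  fixes K :: "(nat \<times> ('v, 'a) qpath \<Rightarrow> 'k::field) set"
  assumes K: "submodule A (C d) K"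
    and rad: "\<And>f s. f \<in> K \<Longrightarrow> s \<in> nodes_of_degree d \<Longrightarrow> f (s, (V ! s, [])) = 0"
  shows "superfluous A (C d) K"
  unfolding superfluous_def
proof (intro conjI allI impI K)
  fix U assume *: "submodule A (C d) U \<and> {u + v | u v. u \<in> U \<and> v \<in> K} = mcarrier (C d)"
  interpret T: right_module "A :: (_, 'k) alg" "C d" by (rule term_right_module)
  have U: "fun_subspace U" "\<And>u x. u \<in> U \<Longrightarrow> x \<in> acarrier A \<Longrightarrow> mact (C d) u x \<in> U" "U \<subseteq> mcarrier (C d)"
    using * unfolding submodule_def by blast+
  obtain N where N: "\<And>w. w \<in> NP \<Longrightarrow> length (snd w) < N"
    using finite_nat_set_iff_bounded[of "(length \<circ> snd) ` NP"] finite_paths by (auto simp: image_iff)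
  have "\<exists>u\<in>U. \<exists>k\<in>K. gen s = u + k" if "s \<in> nodes_of_degree d" for s
    using gen_carrier[OF that] * by blast
  then obtain u k where uk: "\<And>s. s \<in> nodes_of_degree d \<Longrightarrow> u s \<in> U \<and> k s \<in> K \<and> gen s = u s + k s"
    by metis
  have "\<forall>f\<in>mcarrier (C d). (\<forall>s w. f (s, w) \<noteq> 0 \<longrightarrow> N - n \<le> length (snd w)) \<longrightarrow> f \<in> U" for n
  proof (induction n)
    case 0
    show ?case
    proof (intro ballI impI)
      fix f :: "nat \<times> ('v, 'a) qpath \<Rightarrow> 'k"
      assume "f \<in> mcarrier (C d)" "\<forall>s w. f (s, w) \<noteq> 0 \<longrightarrow> N - 0 \<le> length (snd w)"
      then have "f (s, w) = 0" for s w using N[of w] unfolding term_carrier by (metis diff_zero leD)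
      then have "f = 0" by (auto simp: fun_eq_iff)
      then show "f \<in> U" using subspace_zero[OF U(1)] by simp
    qed
  next
    case (Suc n)
    show ?case
    proof (intro ballI impI)
      fix f :: "nat \<times> ('v, 'a) qpath \<Rightarrow> 'k"
      assume f: "f \<in> mcarrier (C d)" and len: "\<forall>s w. f (s, w) \<noteq> 0 \<longrightarrow> N - Suc n \<le> length (snd w)"
      let ?c = "\<lambda>s w. f (s, w)"
      have c: "?c s \<in> acarrier A" for s by (rule component_in_algebra[OF f])
      have kC: "k s \<in> mcarrier (C d)" and uC: "u s \<in> mcarrier (C d)" if "s \<in> nodes_of_degree d" for s
        using uk[OF that] K U(3) unfolding submodule_def by blast+
      have "f = (\<Sum>s\<in>nodes_of_degree d. mact (C d) (u s + k s) (?c s))"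
        using gen_decomposition[OF f] uk by simp
      also have "\<dots> = (\<Sum>s\<in>nodes_of_degree d. mact (C d) (u s) (?c s) + mact (C d) (k s) (?c s))"
        by (rule sum.cong[OF refl]) (rule T.act_add_left[OF uC kC c])
      finally have eq: "f = (\<Sum>s\<in>nodes_of_degree d. mact (C d) (u s) (?c s)) + (\<Sum>s\<in>nodes_of_degree d. mact (C d) (k s) (?c s))"
        unfolding sum.distrib .
      have 1: "(\<Sum>s\<in>nodes_of_degree d. mact (C d) (u s) (?c s)) \<in> U"
        using U(1) by (rule subspace_sum) (use U(2) uk c in blast)
      have "mact (C d) (k s) (?c s) \<in> U" if s: "s \<in> nodes_of_degree d" for s
      proof -
        have "N - n \<le> length (snd w)" if nz: "mact (C d) (k s) (?c s) (t, w) \<noteq> 0" for t w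
        proof -
          obtain p q where pq: "k s (t, p) \<noteq> 0" "f (s, q) \<noteq> 0" "length (snd w) = length (snd p) + length (snd q)"
            using nz unfolding term_act by (rule amult_factors)
          have t: "t \<in> nodes_of_degree d" "fst p = V ! t" using kC[OF s] pq(1) unfolding term_carrier by blast+
          have "snd p \<noteq> []"
            using rad[of "k s" t] uk[OF s] pq(1) t by (cases p) auto
          then have "length (snd p) \<ge> 1" by (simp add: Suc_leI)
          moreover have "N - Suc n \<le> length (snd q)" using len pq by blast
          ultimately show ?thesis using pq(3) by linarith
        qed
        then show ?thesis using Suc.IH T.act_closed[OF kC[OF s] c] by blast
      qed
      then have "(\<Sum>s\<in>nodes_of_degree d. mact (C d) (k s) (?c s)) \<in> U" by (rule subspace_sum[OF U(1)])
      with 1 show "f \<in> U" by (subst eq) (rule fun_space.subspace_add[OF U(1)])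
    qed
  qed
  from this[of N] have "mcarrier (C d) \<subseteq> U" by auto
  then show "U = mcarrier (C d)" using U(3) by blast
qed

end

(* Basis vectors are pairs, and quantifiers over basis vectors are not to be split. *)
declare split_paired_All [simp del] split_paired_Ex [simp del]

section \<open>A combinatorial criterion for minimal resolutions\<close>

text \<open>The pairs \<open>(s, w)\<close>, for a path \<open>w\<close> starting at the vertex of the node \<open>s\<close>, form a basis of a
  complex given by a diagram. The basis vector \<open>(s', q)\<close> is mapped to the sum of the basis
  vectors \<open>(s, w)\<close> that it covers: there is a displayed map from \<open>s'\<close> to \<open>s\<close> whose path \<open>u\<close> satisfies
  \<open>w = u q\<close>. If each basis vector is covered by at most one other, then the differential
  is composition with a partial map between the bases.\<close>

definition (in graded_diagram) covers ::
    "nat \<times> ('v, 'a) qpath \<Rightarrow> nat \<times> ('v, 'a) qpath \<Rightarrow> bool" where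
  "covers y x \<longleftrightarrow> (\<exists>u. displayed_map L (fst y) (fst x) u \<and> snd x \<in> NP \<and>
     snd x = path_append u (snd y) \<and> fst (snd y) = path_end Q u)"

locale basis_diagram = graded_diagram Q R V L deg
  for Q :: "('v, 'a) pre_digraph" and R and V and L and deg +
  assumes covered_once: "covers y x \<Longrightarrow> covers y' x \<Longrightarrow> y = y'"
begin

lemma covers_degree: "covers y x \<Longrightarrow> deg (fst y) = Suc (deg (fst x))"
  using degrees by (auto simp: covers_def)

lemma covers_nodes:
  assumes "covers y x"
  shows "fst y < length V" "fst x < length V" "snd x \<in> NP" "fst (snd x) = V ! fst x"
    "snd y \<in> NP" "fst (snd y) = V ! fst y"
proof -
  obtain u where u: "displayed_map L (fst y) (fst x) u" "snd x \<in> NP"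
     "snd x = path_append u (snd y)" "fst (snd y) = path_end Q u"
    using assms by (auto simp: covers_def)
  show "fst y < length V" "fst x < length V" "snd x \<in> NP" using u displayed_map_nodes by auto
  show "fst (snd x) = V ! fst x" using u paths[OF u(1)] by (simp add: path_append_def)
  show "fst (snd y) = V ! fst y" using u paths[OF u(1)] by simp
  have "(fst u, snd u @ snd (snd y)) \<in> NP" using u by (simp add: path_append_def)
  then show "snd y \<in> NP" unfolding append_path_iff using u(4) by (metis prod.collapse)
qed

lemma not_covered_trivial: "\<not> covers y (s, (v, []))"
  using paths by (fastforce simp: covers_def path_append_def)

lemma amult_path_elem_eq:
  assumes "w \<in> NP" "w = path_append u q" "fst q = path_end Q u"
  shows "amult A (path_elem u) g w = g q"
  using assms by (cases q) (auto simp: amult_path_elem path_append_def)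

lemma amult_path_elem_eq_0:
  assumes "\<not> (\<exists>q. w \<in> NP \<and> w = path_append u q \<and> fst q = path_end Q u)"
  shows "amult A (path_elem u) g w = 0"
proof (rule ccontr)
  assume "amult A (path_elem u) g w \<noteq> 0"
  then have *: "w \<in> NP" "fst w = fst u" "take (length (snd u)) (snd w) = snd u"
    by (auto simp: amult_path_elem split: if_splits)
  have "w = path_append u (path_end Q u, drop (length (snd u)) (snd w))"
    using * by (cases w) (auto simp: path_append_def, metis append_take_drop_id)
  then show False using assms * by auto
qed

text \<open>The two summands of the differential at the node \<open>s\<close>, coming from its two neighbours.\<close>

definition from_left :: "(nat \<times> ('v, 'a) qpath \<Rightarrow> 'k) \<Rightarrow> nat \<Rightarrow> ('v, 'a) qpath \<Rightarrow> 'k::field" where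
  "from_left f s = (if 0 < s \<and> s - 1 < length L
      then (case L ! (s - 1) of Rightwards u \<Rightarrow> amult A (path_elem u) (\<lambda>w. f (s - 1, w))
            | Leftwards u \<Rightarrow> (\<lambda>_. 0)) else (\<lambda>_. 0))"

definition from_right :: "(nat \<times> ('v, 'a) qpath \<Rightarrow> 'k) \<Rightarrow> nat \<Rightarrow> ('v, 'a) qpath \<Rightarrow> 'k::field" where
  "from_right f s = (if s < length L
      then (case L ! s of Rightwards u \<Rightarrow> (\<lambda>_. 0)
            | Leftwards u \<Rightarrow> amult A (path_elem u) (\<lambda>w. f (s + 1, w))) else (\<lambda>_. 0))"

lemma diff_split: "diagram_diff A L f (s, w) = from_left f s w + from_right f s w"
  unfolding diagram_diff_def from_left_def from_right_def prod.case
  by (intro arg_cong2[of _ _ _ _ "(+)"]) (auto split: link.splits)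

lemma from_left_covered:
  assumes "covers (s - 1, q) (s, w)" "0 < s"
  shows "from_left f s w = f (s - 1, q)"
proof -
  obtain u where u: "s - 1 < length L" "L ! (s - 1) = Rightwards u" "w \<in> NP" "w = path_append u q"
    "fst q = path_end Q u"
    using assms by (auto simp: covers_def displayed_map_def)
  show ?thesis using amult_path_elem_eq[OF u(3-5)] u(1,2) assms(2) by (simp add: from_left_def)
qed

lemma from_left_uncovered:
  assumes "\<And>q. \<not> covers (s - 1, q) (s, w)"
  shows "from_left f s w = 0"
proof (cases "0 < s \<and> s - 1 < length L")
  case True
  show ?thesis
  proof (cases "L ! (s - 1)")
    case (Rightwards u)
    then have "displayed_map L (s - 1) s u" using True by (auto simp: displayed_map_def)
    then have "\<not> (\<exists>q. w \<in> NP \<and> w = path_append u q \<and> fst q = path_end Q u)"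
      using assms by (auto simp: covers_def)
    from amult_path_elem_eq_0[OF this] show ?thesis using True Rightwards by (simp add: from_left_def)
  next
    case (Leftwards u)
    then show ?thesis by (simp add: from_left_def)
  qed
next
  case False
  then show ?thesis unfolding from_left_def by presburger
qed

lemma from_right_covered:
  assumes "covers (s + 1, q) (s, w)"
  shows "from_right f s w = f (s + 1, q)"
proof -
  obtain u where u: "s < length L" "L ! s = Leftwards u" "w \<in> NP" "w = path_append u q"
    "fst q = path_end Q u"
    using assms by (auto simp: covers_def displayed_map_def)
  show ?thesis using amult_path_elem_eq[OF u(3-5)] u(1,2) by (simp add: from_right_def)
qed

lemma from_right_uncovered:
  assumes "\<And>q. \<not> covers (s + 1, q) (s, w)"
  shows "from_right f s w = 0"
proof (cases "s < length L")
  case True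
  show ?thesis
  proof (cases "L ! s")
    case (Leftwards u)
    then have "displayed_map L (s + 1) s u" using True by (auto simp: displayed_map_def)
    then have "\<not> (\<exists>q. w \<in> NP \<and> w = path_append u q \<and> fst q = path_end Q u)"
      using assms by (auto simp: covers_def)
    from amult_path_elem_eq_0[OF this] show ?thesis using True Leftwards by (simp add: from_right_def)
  next
    case (Rightwards u)
    then show ?thesis by (simp add: from_right_def)
  qed
qed (simp add: from_right_def)

lemma covers_adjacent: "covers (s', q) (s, w) \<Longrightarrow> s' = s - 1 \<and> 0 < s \<or> s' = s + 1"
  by (auto simp: covers_def displayed_map_def)

lemma diff_covered:
  assumes "covers y x"
  shows "diagram_diff A L f x = f y"
proof -
  obtain s w s' q where x: "x = (s, w)" and y: "y = (s', q)" by (cases x, cases y)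
  consider "s' = s - 1" "0 < s" | "s' = s + 1" using covers_adjacent assms x y by blast
  then show ?thesis
  proof cases
    case 1
    have "\<not> covers (s + 1, q') (s, w)" for q' using assms covered_once 1 unfolding x y by fastforce
    then show ?thesis unfolding x y diff_split
      using from_left_covered[of s q w f] from_right_uncovered[of s w f] 1 assms x y by simp
  next
    case 2
    have "\<not> covers (s - 1, q') (s, w)" for q' using assms covered_once 2 unfolding x y by fastforce
    then show ?thesis unfolding x y diff_split
      using from_left_uncovered[of s w f] from_right_covered[of s q w f] 2 assms x y by simp
  qed
qed

lemma diff_uncovered: "(\<And>y. \<not> covers y x) \<Longrightarrow> diagram_diff A L f x = 0"
  by (cases x) (simp add: diff_split from_left_uncovered from_right_uncovered)

lemma diff_hom: "module_hom (A :: (_, 'k::field) alg) (C (Suc d)) (C d) (diagram_diff A L)"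
  unfolding module_hom_def
proof (intro conjI ballI allI)
  fix f :: "nat \<times> ('v, 'a) qpath \<Rightarrow> 'k" assume f: "f \<in> mcarrier (C (Suc d))"
  show "diagram_diff A L f \<in> mcarrier (C d)"
    unfolding term_carrier
  proof (intro allI impI)
    fix s w assume nz: "diagram_diff A L f (s, w) \<noteq> 0"
    then obtain y where y: "covers y (s, w)" using diff_uncovered by blast
    then have "f y \<noteq> 0" using nz diff_covered[OF y, of f] by metis
    then have "f (fst y, snd y) \<noteq> 0" by simp
    then have "fst y \<in> nodes_of_degree (Suc d)" using f unfolding term_carrier by blast
    then show "s \<in> nodes_of_degree d \<and> w \<in> NP \<and> fst w = V ! s"
      using covers_nodes[OF y] covers_degree[OF y] by (simp add: nodes_of_degree_def)
  qed
next
  fix f g :: "nat \<times> ('v, 'a) qpath \<Rightarrow> 'k"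
  show "diagram_diff A L (f + g) = diagram_diff A L f + diagram_diff A L g"
  proof
    fix x show "diagram_diff A L (f + g) x = (diagram_diff A L f + diagram_diff A L g) x"
      by (cases "\<exists>y. covers y x") (auto simp: diff_covered diff_uncovered)
  qed
next
  fix c and f :: "nat \<times> ('v, 'a) qpath \<Rightarrow> 'k"
  show "diagram_diff A L (fscale c f) = fscale c (diagram_diff A L f)"
  proof
    fix x show "diagram_diff A L (fscale c f) x = fscale c (diagram_diff A L f) x"
      by (cases "\<exists>y. covers y x") (auto simp: fscale_def diff_covered diff_uncovered)
  qed
next
  fix f :: "nat \<times> ('v, 'a) qpath \<Rightarrow> 'k" and x :: "('v, 'a) qpath \<Rightarrow> 'k"
  let ?fx = "mact (C (Suc d)) f x"
  have c: "(\<lambda>w. ?fx (s, w)) = amult A (\<lambda>w. f (s, w)) x" for s by (simp add: term_act)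
  have l: "from_left ?fx s = amult A (from_left f s) x" for s
    unfolding from_left_def c by (simp add: amult_assoc amult_zero_left split: link.splits)
  have r: "from_right ?fx s = amult A (from_right f s) x" for s
    unfolding from_right_def c by (simp add: amult_assoc amult_zero_left split: link.splits)
  show "diagram_diff A L ?fx = mact (C d) (diagram_diff A L f) x"
  proof
    fix z :: "nat \<times> ('v, 'a) qpath"
    obtain t w where z: "z = (t, w)" by (cases z)
    show "diagram_diff A L ?fx z = mact (C d) (diagram_diff A L f) x z"
      unfolding z term_act diff_split l r
      using amult_add_left[of "from_left f t" "from_right f t" x] by (simp add: plus_fun_def fun_eq_iff)
  qed
qed

end

text \<open>The remaining hypotheses say that the complex is exact and resolves \<open>M\<close>. In positive degrees, a
  basis vector is either covered, or it covers something, and not both; and it covers at most one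
  basis vector of positive degree. In degree \<open>0\<close>, the generator of the node \<open>s\<close> is sent to an
  element \<open>g s\<close> of \<open>M\<close>, and the path \<open>hit s j\<close>, if there is one, sends \<open>g s\<close> to the \<open>j\<close>-th basis
  vector of \<open>M\<close> with the sign \<open>sg s\<close>. Each of the latter is reached either by one basis vector of
  the complex, which is not covered, or by two of them, with opposite signs and covered by the same
  basis vector.\<close>

locale resolving_diagram = basis_diagram Q R V L deg
  for Q :: "('v, 'a) pre_digraph" and R and V and L and deg +
  fixes M :: "(nat, ('v, 'a) qpath, 'k::field) rmod" and n :: nat
    and g :: "nat \<Rightarrow> nat \<Rightarrow> 'k" and sg :: "nat \<Rightarrow> 'k" and hit :: "nat \<Rightarrow> nat \<Rightarrow> ('v, 'a) qpath option"
  assumes exact: "s < length V \<Longrightarrow> 0 < deg s \<Longrightarrow> w \<in> nonzero_paths Q R \<Longrightarrow> fst w = V ! s \<Longrightarrow>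
      (\<exists>y. covers y (s, w)) \<longleftrightarrow> \<not> (\<exists>x. covers (s, w) x)"
    and covers_one: "covers y x \<Longrightarrow> covers y x' \<Longrightarrow> 0 < deg (fst x) \<Longrightarrow> x = x'"
    and M: "fd_module (bound_quiver_algebra Q R) M"
    and M_carrier: "mcarrier M = {f. \<forall>j>n. f j = 0}"
    and g: "s < length V \<Longrightarrow> deg s = 0 \<Longrightarrow> g s \<in> mcarrier M"
    and g_act: "s < length V \<Longrightarrow> deg s = 0 \<Longrightarrow> a \<in> mcarrier (indec_projective (bound_quiver_algebra Q R) (V ! s)) \<Longrightarrow>
      mact M (g s) a j = sg s * (case hit s j of None \<Rightarrow> 0 | Some p \<Rightarrow> a p)"
    and sg: "sg s * sg s = 1"
    and hit: "s < length V \<Longrightarrow> deg s = 0 \<Longrightarrow> hit s j = Some p \<Longrightarrow> j \<le> n \<and> p \<in> nonzero_paths Q R \<and> fst p = V ! s"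
    and hit_inj: "s < length V \<Longrightarrow> deg s = 0 \<Longrightarrow> hit s j = Some p \<Longrightarrow> hit s j' = Some p \<Longrightarrow> j = j'"
    and fibre: "j \<le> n \<Longrightarrow>
      (\<exists>s p. s < length V \<and> deg s = 0 \<and> hit s j = Some p \<and> \<not> (\<exists>y. covers y (s, p)) \<and>
         (\<forall>t<length V. deg t = 0 \<longrightarrow> t \<noteq> s \<longrightarrow> hit t j = None)) \<or>
      (\<exists>s p t q y. s < length V \<and> deg s = 0 \<and> t < length V \<and> deg t = 0 \<and> s \<noteq> t \<and>
         hit s j = Some p \<and> hit t j = Some q \<and> sg t = - sg s \<and> covers y (s, p) \<and> covers y (t, q) \<and>
         (\<forall>t'<length V. deg t' = 0 \<longrightarrow> t' \<noteq> s \<longrightarrow> t' \<noteq> t \<longrightarrow> hit t' j = None))"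
    and uncovered: "s < length V \<Longrightarrow> deg s = 0 \<Longrightarrow> p \<in> nonzero_paths Q R \<Longrightarrow> fst p = V ! s \<Longrightarrow>
      \<not> (\<exists>y. covers y (s, p)) \<Longrightarrow> \<exists>j. hit s j = Some p"
    and covers_two: "covers y (s, p) \<Longrightarrow> covers y (t, q) \<Longrightarrow> (s, p) \<noteq> (t, q) \<Longrightarrow> deg s = 0 \<Longrightarrow>
      \<exists>j. hit s j = Some p \<and> hit t j = Some q"
begin

abbreviation K :: "nat \<Rightarrow> (nat \<times> ('v, 'a) qpath \<Rightarrow> 'k) set" where
  "K d \<equiv> hom_kernel (C d) (diagram_diff A L)"

text \<open>The augmentation.\<close>

definition eps :: "(nat \<times> ('v, 'a) qpath \<Rightarrow> 'k) \<Rightarrow> nat \<Rightarrow> 'k" where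
  "eps f = (\<Sum>s\<in>nodes_of_degree 0. mact M (g s) (\<lambda>w. f (s, w)))"

lemma M_module: "right_module A M"
  using M by (simp add: fd_module_def)

lemma eps_hom: "module_hom A (C 0) M eps"
  unfolding eps_def[abs_def] using g
  by (intro hom_from_generators M_module) (auto simp: nodes_of_degree_def)

lemma eps_apply:
  assumes f: "f \<in> mcarrier (C 0)"
  shows "eps f j = (\<Sum>s\<in>nodes_of_degree 0. sg s * (case hit s j of None \<Rightarrow> 0 | Some p \<Rightarrow> f (s, p)))"
  unfolding eps_def sum_fun_apply
proof (rule sum.cong[OF refl])
  fix s assume s: "s \<in> nodes_of_degree 0"
  have "(\<lambda>w. f (s, w)) \<in> mcarrier (indec_projective A (V ! s))"
    using f unfolding term_carrier indec_projective_carrier by blast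
  then show "mact M (g s) (\<lambda>w. f (s, w)) j = sg s * (case hit s j of None \<Rightarrow> 0 | Some p \<Rightarrow> f (s, p))"
    using g_act s by (simp add: nodes_of_degree_def)
qed

lemma eps_single:
  assumes f: "f \<in> mcarrier (C 0)" and s: "s < length V" "deg s = 0" and p: "hit s j = Some p"
    and o: "\<And>t. t < length V \<Longrightarrow> deg t = 0 \<Longrightarrow> t \<noteq> s \<Longrightarrow> hit t j = None"
  shows "eps f j = sg s * f (s, p)"
proof -
  have "eps f j = (\<Sum>t\<in>{s}. sg t * (case hit t j of None \<Rightarrow> 0 | Some p \<Rightarrow> f (t, p)))"
    unfolding eps_apply[OF f] by (rule sum.mono_neutral_right)
      (use s o finite_nodes_of_degree in \<open>auto simp: nodes_of_degree_def\<close>)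
  then show ?thesis using p by simp
qed

lemma eps_double:
  assumes f: "f \<in> mcarrier (C 0)" and s: "s < length V" "deg s = 0" "hit s j = Some p"
    and t: "t < length V" "deg t = 0" "hit t j = Some q" "s \<noteq> t" "sg t = - sg s"
    and o: "\<And>t'. t' < length V \<Longrightarrow> deg t' = 0 \<Longrightarrow> t' \<noteq> s \<Longrightarrow> t' \<noteq> t \<Longrightarrow> hit t' j = None"
  shows "eps f j = sg s * (f (s, p) - f (t, q))"
proof -
  have "eps f j = (\<Sum>t\<in>{s, t}. sg t * (case hit t j of None \<Rightarrow> 0 | Some p \<Rightarrow> f (t, p)))"
    unfolding eps_apply[OF f] by (rule sum.mono_neutral_right)
      (use s t o finite_nodes_of_degree in \<open>auto simp: nodes_of_degree_def\<close>)
  then show ?thesis using s t by (simp add: right_diff_distrib)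
qed

lemma sg_nonzero: "sg s \<noteq> 0"
  using sg[of s] by auto

lemma eps_onto: "eps ` mcarrier (C 0) = mcarrier M"
proof
  show "eps ` mcarrier (C 0) \<subseteq> mcarrier M" using eps_hom unfolding module_hom_def by blast
  show "mcarrier M \<subseteq> eps ` mcarrier (C 0)"
  proof
    fix m assume m: "m \<in> mcarrier M"
    have "\<exists>s. s < length V \<and> deg s = 0 \<and> hit s j \<noteq> None" if "j \<le> n" for j
      using fibre[OF that] by blast
    then obtain c where c: "\<And>j. j \<le> n \<Longrightarrow> c j < length V \<and> deg (c j) = 0 \<and> hit (c j) j \<noteq> None" by metis
    define f where "f = (\<lambda>(s, p). \<Sum>j\<le>n. if s = c j \<and> hit s j = Some p then sg s * m j else 0)"
    have f: "f \<in> mcarrier (C 0)"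
      unfolding term_carrier
    proof (intro allI impI)
      fix s w assume "f (s, w) \<noteq> 0"
      then obtain j where "j \<le> n" "s = c j" "hit s j = Some w"
        unfolding f_def by (auto elim!: sum.not_neutral_contains_not_neutral split: if_splits)
      then show "s \<in> nodes_of_degree 0 \<and> w \<in> NP \<and> fst w = V ! s"
        using c[of j] hit[of s j w] by (simp add: nodes_of_degree_def)
    qed
    have val: "sg s * (case hit s j of None \<Rightarrow> 0 | Some p \<Rightarrow> f (s, p)) = (if s = c j then m j else 0)"
      if "s \<in> nodes_of_degree 0" "j \<le> n" for s j
    proof (cases "hit s j")
      case None
      then show ?thesis using c[of j] that by auto
    next
      case (Some p)
      have "hit s j' = Some p \<longleftrightarrow> j' = j" for j'
        using hit_inj[of s j p j'] that Some by (auto simp: nodes_of_degree_def)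
      then have "f (s, p) = (\<Sum>j'\<le>n. if j' = j then (if s = c j then sg s * m j else 0) else 0)"
        unfolding f_def prod.case by (intro sum.cong refl) auto
      also have "\<dots> = (if s = c j then sg s * m j else 0)" using that by simp
      finally show ?thesis using Some sg[of s] by (auto simp: mult.assoc[symmetric])
    qed
    have "eps f j = m j" for j
    proof (cases "j \<le> n")
      case True
      have "eps f j = (\<Sum>s\<in>nodes_of_degree 0. if s = c j then m j else 0)"
        unfolding eps_apply[OF f] by (rule sum.cong[OF refl]) (use val True in blast)
      then show ?thesis using c[OF True] finite_nodes_of_degree by (simp add: nodes_of_degree_def)
    next
      case False
      moreover have "eps f \<in> mcarrier M" using eps_hom f unfolding module_hom_def by blast
      ultimately show ?thesis using m unfolding M_carrier by auto
    qed
    then have "m = eps f" by (simp add: fun_eq_iff)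
    then show "m \<in> eps ` mcarrier (C 0)" using f by blast
  qed
qed

lemma eps_kernel_constant:
  assumes f: "f \<in> hom_kernel (C 0) eps" and c: "covers y x" "covers y x'" and d: "deg (fst x) = 0"
  shows "f x = f x'"
proof (cases "x = x'")
  case False
  obtain s p t q where x: "x = (s, p)" "x' = (t, q)" by (cases x, cases x')
  obtain j where j: "hit s j = Some p" "hit t j = Some q"
    using covers_two[of y s p t q] c False d x by auto
  have dt: "deg t = 0" "deg s = 0" "s < length V" "t < length V"
    using covers_degree[OF c(1)] covers_degree[OF c(2)] d x covers_nodes[OF c(1)] covers_nodes[OF c(2)] by auto
  have "s \<noteq> t" using j False x by auto
  have "j \<le> n" using hit[OF dt(3,2) j(1)] by blast
  have f0: "f \<in> mcarrier (C 0)" "eps f j = 0" using f by (auto simp: hom_kernel_def)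
  from fibre[OF \<open>j \<le> n\<close>] show ?thesis
  proof (elim disjE exE conjE)
    fix s' p' assume *: "\<forall>t<length V. deg t = 0 \<longrightarrow> t \<noteq> s' \<longrightarrow> hit t j = None"
    have "s = s'" "t = s'" using spec[OF *, of s] spec[OF *, of t] j dt by auto
    then show ?thesis using \<open>s \<noteq> t\<close> by simp
  next
    fix s' p' t' q' y'
    assume *: "s' < length V" "deg s' = 0" "t' < length V" "deg t' = 0" "s' \<noteq> t'" "hit s' j = Some p'"
      "hit t' j = Some q'" "sg t' = - sg s'"
      "\<forall>u<length V. deg u = 0 \<longrightarrow> u \<noteq> s' \<longrightarrow> u \<noteq> t' \<longrightarrow> hit u j = None"
    have "s = s' \<or> s = t'" "t = s' \<or> t = t'" using spec[OF *(9), of s] spec[OF *(9), of t] j dt by auto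
    moreover have "f (s', p') = f (t', q')"
      using eps_double[OF f0(1) *(1,2,6,3,4,7,5,8)] *(9) f0(2) sg_nonzero[of s'] by auto
    ultimately show ?thesis using \<open>s \<noteq> t\<close> * j x by auto
  qed
qed simp

lemma eps_kernel_uncovered:
  assumes f: "f \<in> hom_kernel (C 0) eps" and u: "\<not> (\<exists>y. covers y x)"
  shows "f x = 0"
proof (rule ccontr)
  assume nz: "f x \<noteq> 0"
  obtain s p where x: "x = (s, p)" by (cases x)
  have f0: "f \<in> mcarrier (C 0)" "eps f = 0" using f by (auto simp: hom_kernel_def)
  then have s: "s < length V" "deg s = 0" "p \<in> NP" "fst p = V ! s"
    using nz unfolding term_carrier x nodes_of_degree_def by blast+
  obtain j where j: "hit s j = Some p" using uncovered[OF s] u x by blast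
  have "j \<le> n" using hit[OF s(1,2) j] by blast
  from fibre[OF this] show False
  proof (elim disjE exE conjE)
    fix s' p' assume *: "s' < length V" "deg s' = 0" "hit s' j = Some p'" "\<forall>t<length V. deg t = 0 \<longrightarrow> t \<noteq> s' \<longrightarrow> hit t j = None"
    have "s = s'" using spec[OF *(4), of s] j s by auto
    then have "eps f j = sg s * f (s, p)" using eps_single[OF f0(1) s(1,2) j] * by blast
    then show False using f0(2) nz x sg_nonzero by simp
  next
    fix s' p' t' q' y'
    assume *: "hit s' j = Some p'" "hit t' j = Some q'" "covers y' (s', p')" "covers y' (t', q')"
      "\<forall>u<length V. deg u = 0 \<longrightarrow> u \<noteq> s' \<longrightarrow> u \<noteq> t' \<longrightarrow> hit u j = None"
    have "s = s' \<or> s = t'" using spec[OF *(5), of s] j s by auto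
    then show False using * j u x by auto
  qed
qed

text \<open>A cycle is the differential of the function that takes at a basis vector \<open>y\<close> the value of the
  cycle at any of the basis vectors covered by \<open>y\<close>.\<close>

lemma boundary_of_cycle:
  assumes f: "f \<in> mcarrier (C d)"
    and const: "\<And>y x x'. covers y x \<Longrightarrow> covers y x' \<Longrightarrow> deg (fst x) = d \<Longrightarrow> f x = f x'"
    and unc: "\<And>x. \<not> (\<exists>y. covers y x) \<Longrightarrow> f x = 0"
  shows "f \<in> diagram_diff A L ` mcarrier (C (Suc d))"
proof
  let ?h = "\<lambda>y. if deg (fst y) = Suc d \<and> (\<exists>x. covers y x) then f (SOME x. covers y x) else 0"
  show "?h \<in> mcarrier (C (Suc d))"
    unfolding term_carrier
  proof (intro allI impI)
    fix s w assume "?h (s, w) \<noteq> 0"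
    then obtain x where "deg s = Suc d" "covers (s, w) x" by (auto split: if_splits)
    then show "s \<in> nodes_of_degree (Suc d) \<and> w \<in> NP \<and> fst w = V ! s"
      using covers_nodes[of "(s, w)" x] by (auto simp: nodes_of_degree_def)
  qed
  show "f = diagram_diff A L ?h"
  proof
    fix x
    show "f x = diagram_diff A L ?h x"
    proof (cases "\<exists>y. covers y x")
      case True
      then obtain y where y: "covers y x" by blast
      have s: "covers y (SOME x. covers y x)" using y by (rule someI)
      show ?thesis
      proof (cases "deg (fst x) = d")
        case True
        then have "deg (fst y) = Suc d \<and> (\<exists>x. covers y x)" using y covers_degree[OF y] by metis
        then have "?h y = f (SOME x. covers y x)" by (rule if_P)
        also have "\<dots> = f x" using const[OF y s True] by simp
        finally show ?thesis unfolding diff_covered[OF y, of ?h] by (rule sym)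
      next
        case False
        then have "f (fst x, snd x) = 0" using f unfolding term_carrier nodes_of_degree_def by blast
        moreover have "\<not> (deg (fst y) = Suc d \<and> (\<exists>x. covers y x))" using covers_degree[OF y] False by simp
        then have "?h y = 0" by (rule if_not_P)
        ultimately show ?thesis unfolding diff_covered[OF y, of ?h] by (metis prod.collapse)
      qed
    next
      case False
      have "diagram_diff A L ?h x = 0" by (rule diff_uncovered) (use False in blast)
      then show ?thesis using unc[OF False] by simp
    qed
  qed
qed

lemma kernel_covered:
  assumes f: "f \<in> K d" and c: "covers x z"
  shows "f x = 0"
  using diff_covered[OF c, of f] f by (simp add: hom_kernel_def)

lemma image_eq_kernel:
  assumes "0 < d"
  shows "diagram_diff A L ` mcarrier (C (Suc d)) = K d"
proof
  show "K d \<subseteq> diagram_diff A L ` mcarrier (C (Suc d))"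
  proof
    fix f :: "nat \<times> ('v, 'a) qpath \<Rightarrow> 'k" assume f: "f \<in> K d"
    then have fC: "f \<in> mcarrier (C d)" by (simp add: hom_kernel_def)
    show "f \<in> diagram_diff A L ` mcarrier (C (Suc d))"
    proof (rule boundary_of_cycle[OF fC])
      show "f x = f x'" if "covers y x" "covers y x'" "deg (fst x) = d" for y x x'
        using covers_one[OF that(1,2)] that(3) assms by simp
      show "f x = 0" if unc: "\<not> (\<exists>y. covers y x)" for x
      proof (rule ccontr)
        assume nz: "f x \<noteq> 0"
        obtain s w where x: "x = (s, w)" by (cases x)
        have "s < length V" "deg s = d" "w \<in> NP" "fst w = V ! s"
          using nz fC unfolding x term_carrier nodes_of_degree_def by blast+
        then obtain z where "covers (s, w) z" using exact[of s w] unc assms unfolding x by metis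
        then show False using kernel_covered[OF f] nz x by blast
      qed
    qed
  qed
  show "diagram_diff A L ` mcarrier (C (Suc d)) \<subseteq> K d"
  proof clarify
    fix h :: "nat \<times> ('v, 'a) qpath \<Rightarrow> 'k" assume h: "h \<in> mcarrier (C (Suc d))"
    have "diagram_diff A L h \<in> mcarrier (C d)" using diff_hom[of d] h unfolding module_hom_def by blast
    moreover have "diagram_diff A L (diagram_diff A L h) z = 0" for z
    proof (cases "\<exists>x. covers x z")
      case True
      then obtain x where x: "covers x z" by blast
      have "\<not> (\<exists>y. covers y x)"
        using exact[of "fst x" "snd x"] covers_nodes[OF x] covers_degree[OF x] x by auto
      then have "diagram_diff A L h x = 0" by (intro diff_uncovered) blast
      then show ?thesis using diff_covered[OF x, of "diagram_diff A L h"] by simp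
    qed (use diff_uncovered in blast)
    ultimately show "diagram_diff A L h \<in> K d" by (auto simp: hom_kernel_def fun_eq_iff)
  qed
qed

lemma image_eq_eps_kernel: "diagram_diff A L ` mcarrier (C 1) = hom_kernel (C 0) eps"
proof
  show "hom_kernel (C 0) eps \<subseteq> diagram_diff A L ` mcarrier (C 1)"
  proof
    fix f assume f: "f \<in> hom_kernel (C 0) eps"
    then have "f \<in> mcarrier (C 0)" by (simp add: hom_kernel_def)
    then have "f \<in> diagram_diff A L ` mcarrier (C (Suc 0))"
      using eps_kernel_constant[OF f] eps_kernel_uncovered[OF f] by (rule boundary_of_cycle)
    then show "f \<in> diagram_diff A L ` mcarrier (C 1)" by simp
  qed
  show "diagram_diff A L ` mcarrier (C 1) \<subseteq> hom_kernel (C 0) eps"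
  proof clarify
    fix h :: "nat \<times> ('v, 'a) qpath \<Rightarrow> 'k" assume h: "h \<in> mcarrier (C 1)"
    let ?f = "diagram_diff A L h"
    have f: "?f \<in> mcarrier (C 0)" using diff_hom[of 0] h unfolding module_hom_def by auto
    have "eps ?f j = 0" for j
    proof (cases "j \<le> n")
      case True
      from fibre[OF True] show ?thesis
      proof (elim disjE exE conjE)
        fix s p assume *: "s < length V" "deg s = 0" "hit s j = Some p" "\<not> (\<exists>y. covers y (s, p))"
          "\<forall>t<length V. deg t = 0 \<longrightarrow> t \<noteq> s \<longrightarrow> hit t j = None"
        have "?f (s, p) = 0" using *(4) diff_uncovered by blast
        then show ?thesis using eps_single[OF f *(1-3)] *(5) by simp
      next
        fix s p t q y
        assume *: "s < length V" "deg s = 0" "t < length V" "deg t = 0" "s \<noteq> t" "hit s j = Some p"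
          "hit t j = Some q" "sg t = - sg s" "covers y (s, p)" "covers y (t, q)"
          "\<forall>u<length V. deg u = 0 \<longrightarrow> u \<noteq> s \<longrightarrow> u \<noteq> t \<longrightarrow> hit u j = None"
        have "?f (s, p) = ?f (t, q)" using diff_covered[OF *(9), of h] diff_covered[OF *(10), of h] by simp
        then show ?thesis using eps_double[OF f *(1,2,6,3,4,7,5,8)] *(11) by simp
      qed
    next
      case False
      moreover have "eps ?f \<in> mcarrier M" using eps_hom f unfolding module_hom_def by blast
      ultimately show ?thesis unfolding M_carrier by auto
    qed
    then show "?f \<in> hom_kernel (C 0) eps" using f by (auto simp: hom_kernel_def fun_eq_iff)
  qed
qed

lemma kernel_superfluous:
  assumes "0 < d"
  shows "superfluous A (C d) (K d)"
proof (rule radical_superfluous)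
  obtain d' where "d = Suc d'" using assms by (cases d) auto
  then show "submodule A (C d) (K d)"
    using hom_kernel_submodule[OF diff_hom term_right_module term_right_module] by blast
  fix f s assume f: "f \<in> K d" and s: "s \<in> nodes_of_degree d"
  have "(V ! s, []) \<in> NP" using s nodes by (simp add: trivial_path_iff nodes_of_degree_def)
  then obtain z where "covers (s, (V ! s, [])) z"
    using exact[of s "(V ! s, [])"] s assms not_covered_trivial by (auto simp: nodes_of_degree_def)
  then show "f (s, (V ! s, [])) = 0" using kernel_covered[OF f] by blast
qed

lemma eps_kernel_superfluous: "superfluous A (C 0) (hom_kernel (C 0) eps)"
proof (rule radical_superfluous)
  show "submodule A (C 0) (hom_kernel (C 0) eps)"
    by (rule hom_kernel_submodule[OF eps_hom term_right_module M_module])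
  show "f (s, (V ! s, [])) = 0" if "f \<in> hom_kernel (C 0) eps" for f s
    using eps_kernel_uncovered[OF that] not_covered_trivial by blast
qed

text \<open>The diagram gives a minimal projective resolution of \<open>M\<close>.\<close>

lemma resolved: "resolved_by A M V L"
proof -
  have "projective_cover A (C (Suc d)) (diagram_diff A L) (K d)" if "1 \<le> d" for d
    using that term_projective image_eq_kernel[of d] kernel_superfluous[of "Suc d"]
    unfolding projective_cover_def by simp
  moreover have "projective_cover A (C 1) (diagram_diff A L) (hom_kernel (C 0) eps)"
    using term_projective image_eq_eps_kernel kernel_superfluous[of 1]
    unfolding projective_cover_def by simp
  moreover have "projective_cover A (C 0) eps (mcarrier M)"
    using term_projective eps_onto eps_kernel_superfluous unfolding projective_cover_def by blast
  ultimately have "minimal_projective_resolution A C (\<lambda>_. diagram_diff A L) eps M"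
    unfolding minimal_projective_resolution_def using M eps_hom diff_hom by blast
  then show ?thesis using length_nodes unfolding resolved_by_def by blast
qed

end

section \<open>String modules over gentle bound quivers\<close>

text \<open>Each vertex has two sides, named by the two truth values. The arrow \<open>a\<close> starts at the side \<open>te a\<close> of
  its tail and ends at the side \<open>he a\<close> of its head. At most one arrow starts at each side, and a product
  of two arrows is a relation iff the sides at which they meet are different. Several
  arrows may end at the same side.\<close>

locale gentle_bound_quiver = bound_quiver Q R
  for Q :: "('v, 'a) pre_digraph" and R +
  fixes te he :: "'a \<Rightarrow> bool"
  assumes start_side: "a \<in> arcs Q \<Longrightarrow> b \<in> arcs Q \<Longrightarrow> tail Q a = tail Q b \<Longrightarrow> te a = te b \<Longrightarrow> a = b"
    and relation_iff: "(a, b) \<in> R \<longleftrightarrow> a \<in> arcs Q \<and> b \<in> arcs Q \<and> head Q a = tail Q b \<and> he a \<noteq> te b"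
begin

text \<open>The sides at which an arrow starts and ends, each together with its vertex.\<close>

definition ht :: "'a \<Rightarrow> 'v \<times> bool" where "ht a = (tail Q a, te a)"
definition hh :: "'a \<Rightarrow> 'v \<times> bool" where "hh a = (head Q a, he a)"

text \<open>The other side of the same vertex.\<close>

definition opposite :: "'v \<times> bool \<Rightarrow> 'v \<times> bool" where
  "opposite h = (fst h, \<not> snd h)"

lemma ht_inj: "a \<in> arcs Q \<Longrightarrow> b \<in> arcs Q \<Longrightarrow> ht a = ht b \<Longrightarrow> a = b"
  using start_side by (simp add: ht_def)

text \<open>A ray is a nonzero path together with the side at which it starts; for a trivial path this side is
  arbitrary.\<close>

primrec ray :: "'v \<times> bool \<Rightarrow> 'a list \<Rightarrow> bool" where
  "ray h [] \<longleftrightarrow> True"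
| "ray h (a # l) \<longleftrightarrow> a \<in> arcs Q \<and> ht a = h \<and> ray (hh a) l"

primrec ray_end :: "'v \<times> bool \<Rightarrow> 'a list \<Rightarrow> 'v \<times> bool" where
  "ray_end h [] = h"
| "ray_end h (a # l) = ray_end (hh a) l"

lemma ray_append [simp]: "ray h (l @ m) \<longleftrightarrow> ray h l \<and> ray (ray_end h l) m"
  by (induction l arbitrary: h) auto

lemma ray_end_append [simp]: "ray_end h (l @ m) = ray_end (ray_end h l) m"
  by (induction l arbitrary: h) auto

lemma ray_start: "ray h l \<Longrightarrow> ray h' l \<Longrightarrow> l \<noteq> [] \<Longrightarrow> h = h'"
  by (cases l) auto

lemma fst_ray_end: "fst (ray_end h l) = path_end Q (fst h, l)"
  by (induction l arbitrary: h) (auto simp: path_end_eq hh_def)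

lemma nonzero_path_Cons:
  "(v, a # l) \<in> NP \<longleftrightarrow> a \<in> arcs Q \<and> tail Q a = v \<and> (head Q a, l) \<in> NP \<and> (l \<noteq> [] \<longrightarrow> (a, hd l) \<notin> R)"
proof -
  have "(v, [a]) \<in> NP \<longleftrightarrow> a \<in> arcs Q \<and> tail Q a = v"
    by (auto simp: nonzero_paths_def awalk_Cons_iff awalk_Nil_iff path_end_eq)
  then show ?thesis using append_path_iff[of v "[a]" l] by (auto simp: path_end_eq)
qed

lemma nonzero_path_iff_ray: "(v, l) \<in> NP \<longleftrightarrow> v \<in> verts Q \<and> (\<exists>e. ray (v, e) l)"
proof (induction l arbitrary: v)
  case Nil
  then show ?case by (simp add: trivial_path_iff)
next
  case (Cons a l)
  show ?case
  proof (cases l)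
    case Nil
    then show ?thesis by (auto simp: nonzero_path_Cons trivial_path_iff ht_def)
  next
    case (Cons b l')
    then show ?thesis
      unfolding nonzero_path_Cons Cons.IH by (auto simp: relation_iff ht_def hh_def)
  qed
qed

lemma nonzero_append_iff:
  assumes "ray h l" "l \<noteq> []" "fst h \<in> verts Q"
  shows "(fst h, l @ m) \<in> NP \<longleftrightarrow> ray (ray_end h l) m"
proof -
  obtain a l' where l: "l = a # l'" using assms(2) by (cases l) auto
  show ?thesis using assms unfolding nonzero_path_iff_ray l by (cases h) auto
qed

text \<open>A maximal sequence of arrows, starting at the side \<open>h\<close>, in which any two consecutive arrows form
  a relation: no arrow can be added at the end, and there is none at the side \<open>h\<close> if it is empty.\<close>

primrec relation_chain :: "'v \<times> bool \<Rightarrow> 'a list \<Rightarrow> bool" where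
  "relation_chain h [] \<longleftrightarrow> (\<forall>a\<in>arcs Q. ht a \<noteq> h)"
| "relation_chain h (a # l) \<longleftrightarrow> a \<in> arcs Q \<and> ht a = h \<and> relation_chain (opposite (hh a)) l"

lemma relation_chain_nth:
  assumes "relation_chain h l" "t < length l"
  shows "l ! t \<in> arcs Q \<and> ht (l ! t) = (if t = 0 then h else opposite (hh (l ! (t - 1))))"
  using assms
proof (induction l arbitrary: h t)
  case (Cons a l)
  show ?case
  proof (cases t)
    case (Suc i)
    then show ?thesis using Cons.IH[of "opposite (hh a)" i] Cons.prems by (cases i) auto
  qed (use Cons.prems in simp)
qed simp

lemma relation_chain_end:
  assumes "relation_chain h l" "a \<in> arcs Q"
  shows "ht a \<noteq> (if l = [] then h else opposite (hh (l ! (length l - 1))))"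
  using assms
proof (induction l arbitrary: h)
  case (Cons b l)
  then show ?case by (cases l) auto
qed simp

end

text \<open>At position \<open>j\<close> of the string \<open>w\<close> is the vertex \<open>\<kappa> j\<close>; the string leaves it on the right at the
  side \<open>\<not> d j\<close> and on the left at the side \<open>d j\<close>.\<close>

locale gentle_string = gentle_bound_quiver Q R te he
  for Q :: "('v, 'a) pre_digraph" and R and te and he +
  fixes \<kappa> :: "nat \<Rightarrow> 'v" and d :: "nat \<Rightarrow> bool" and w :: "'a letter list"
  assumes string_vertices: "j \<le> length w \<Longrightarrow> \<kappa> j \<in> verts Q"
    and direct_letter: "j < length w \<Longrightarrow> w ! j = (a, True) \<Longrightarrow>
      a \<in> arcs Q \<and> tail Q a = \<kappa> j \<and> te a = (\<not> d j) \<and> head Q a = \<kappa> (j + 1) \<and> he a = (\<not> d (j + 1))"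
    and inverse_letter: "j < length w \<Longrightarrow> w ! j = (a, False) \<Longrightarrow>
      a \<in> arcs Q \<and> tail Q a = \<kappa> (j + 1) \<and> te a = d (j + 1) \<and> head Q a = \<kappa> j \<and> he a = d j"
begin

abbreviation M :: "(nat, ('v, 'a) qpath, 'k::field) rmod" where
  "M \<equiv> string_module Q (\<kappa> 0) w"

abbreviation arrow_act :: "'a \<Rightarrow> (nat \<Rightarrow> 'k::field) \<Rightarrow> nat \<Rightarrow> 'k" where
  "arrow_act \<equiv> string_arrow_act w"

abbreviation path_act :: "('v, 'a) qpath \<Rightarrow> (nat \<Rightarrow> 'k::field) \<Rightarrow> nat \<Rightarrow> 'k" where
  "path_act \<equiv> string_path_act Q (\<kappa> 0) w"

text \<open>The component at the vertex \<open>v\<close> of an element of the module.\<close>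

definition at_vertex :: "'v \<Rightarrow> (nat \<Rightarrow> 'k::field) \<Rightarrow> nat \<Rightarrow> 'k" where
  "at_vertex v f = (\<lambda>j. if j \<le> length w \<and> \<kappa> j = v then f j else 0)"

lemma word_vertex: "j \<le> length w \<Longrightarrow> word_vertex Q (\<kappa> 0) w j = \<kappa> j"
proof (cases j)
  case (Suc i)
  assume "j \<le> length w"
  then show ?thesis using Suc direct_letter[of i] inverse_letter[of i]
    by (cases "w ! i"; cases "snd (w ! i)") (auto simp: word_vertex_def letter_target_def)
qed (simp add: word_vertex_def)

lemma path_act_eq: "path_act p f = fold arrow_act (snd p) (at_vertex (fst p) f)"
proof -
  have "(\<lambda>j. if j \<le> length w \<and> word_vertex Q (\<kappa> 0) w j = fst p then f j else 0) = at_vertex (fst p) f"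
    using word_vertex by (auto simp: at_vertex_def fun_eq_iff)
  then show ?thesis by (simp add: string_path_act_def)
qed

lemma arrow_act_at_head: "at_vertex (head Q a) (arrow_act a f) = arrow_act a f"
proof
  fix j
  show "at_vertex (head Q a) (arrow_act a f) j = arrow_act a f j"
    using direct_letter[of "j - 1" a] inverse_letter[of j a]
    by (cases j) (auto simp: at_vertex_def string_arrow_act_def)
qed

lemma arrow_act_relation: "(a, b) \<in> R \<Longrightarrow> arrow_act b (arrow_act a f) = (\<lambda>_. 0)"
proof
  fix j assume R: "(a, b) \<in> R"
  have 1: "arrow_act a f (j - 1) = 0" if "0 < j" "j \<le> length w" "w ! (j - 1) = (b, True)"
  proof -
    obtain i where i: "j = Suc i" using \<open>0 < j\<close> by (cases j) auto
    show ?thesis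
      using R that direct_letter[of i b] direct_letter[of "i - 1" a] inverse_letter[of i a] unfolding i
      by (cases i) (auto simp: string_arrow_act_def relation_iff)
  qed
  have 2: "arrow_act a f (j + 1) = 0" if "j < length w" "w ! j = (b, False)"
    using R that inverse_letter[of "j" b] inverse_letter[of "j + 1" a]
    by (auto simp: string_arrow_act_def relation_iff)
  show "arrow_act b (arrow_act a f) j = 0"
    using 1 2 by (subst string_arrow_act_def) auto
qed

lemma arrow_act_add: "arrow_act a (f + g) = arrow_act a f + arrow_act a g"
  by (auto simp: fun_eq_iff string_arrow_act_def)

lemma arrow_act_scale: "arrow_act a (fscale c f) = fscale c (arrow_act a f)"
  by (auto simp: fun_eq_iff string_arrow_act_def fscale_def distrib_left)

lemma arrow_act_zero: "arrow_act a (\<lambda>_. 0) = (\<lambda>_. 0)"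
  by (auto simp: fun_eq_iff string_arrow_act_def)

lemma fold_zero: "fold arrow_act l (\<lambda>_. 0) = (\<lambda>_. 0)"
  by (induction l) (simp_all add: arrow_act_zero)

lemma fold_add: "fold arrow_act l (f + g) = fold arrow_act l f + fold arrow_act l g"
proof (induction l arbitrary: f g)
  case (Cons a l)
  show ?case unfolding fold.simps comp_apply arrow_act_add Cons ..
qed simp

lemma fold_scale: "fold arrow_act l (fscale c f) = fscale c (fold arrow_act l f)"
proof (induction l arbitrary: f)
  case (Cons a l)
  show ?case unfolding fold.simps comp_apply arrow_act_scale Cons ..
qed simp

lemma path_act_add: "path_act p (f + g) = path_act p f + path_act p g"
proof -
  have "at_vertex (fst p) (f + g) = at_vertex (fst p) f + at_vertex (fst p) g"
    by (auto simp: at_vertex_def)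
  then show ?thesis unfolding path_act_eq using fold_add by metis
qed

lemma path_act_scale: "path_act p (fscale c f) = fscale c (path_act p f)"
proof -
  have "at_vertex (fst p) (fscale c f) = fscale c (at_vertex (fst p) f)"
    by (auto simp: at_vertex_def fscale_def)
  then show ?thesis unfolding path_act_eq using fold_scale by metis
qed

lemma path_act_sum:
  assumes "finite I"
  shows "path_act q (\<Sum>i\<in>I. fscale (c i) (f i)) = (\<Sum>i\<in>I. fscale (c i) (path_act q (f i)))"
  using assms
proof (induction I rule: finite_induct)
  case empty
  show ?case
    using path_act_scale[of q 0 "\<lambda>_. 0"] by (simp add: zero_fun_def)
next
  case (insert i I)
  show ?case
    unfolding sum.insert[OF insert(1,2)] path_act_add path_act_scale insert.IH ..
qed

lemma path_act_end: "at_vertex (path_end Q p) (path_act p f) = path_act p f"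
proof (cases "snd p" rule: rev_cases)
  case Nil
  then show ?thesis by (cases p) (auto simp: path_act_eq at_vertex_def path_end_eq)
next
  case (snoc l a)
  then have "path_end Q p = head Q a" by (cases p) (simp add: path_end_eq)
  then show ?thesis using snoc by (simp add: path_act_eq arrow_act_at_head)
qed

lemma path_act_append:
  assumes "path_end Q p = fst q"
  shows "path_act q (path_act p f) = path_act (path_append p q) f"
  unfolding path_act_eq[of q] assms[symmetric] path_act_end
  by (simp add: path_act_eq path_append_def)

lemma path_act_not_composable:
  assumes "path_end Q p \<noteq> fst q"
  shows "path_act q (path_act p f) = (\<lambda>_. 0)"
proof -
  have "at_vertex (fst q) (path_act p f) = (\<lambda>_. 0)"
    by (subst path_act_end[symmetric]) (use assms in \<open>auto simp: at_vertex_def\<close>)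
  then show ?thesis by (simp add: path_act_eq[of q] fold_zero)
qed

lemma path_act_zero_product:
  assumes "p \<in> NP" "q \<in> NP" "path_end Q p = fst q" "path_append p q \<notin> NP"
  shows "path_act q (path_act p f) = (\<lambda>_. 0)"
proof -
  have "snd p \<noteq> []" "snd q \<noteq> []" "(last (snd p), hd (snd q)) \<in> R"
    using assms append_path_iff[of "fst p" "snd p" "snd q"] by (auto simp: path_append_def)
  then obtain l a b m where *: "snd p = l @ [a]" "snd q = b # m" "(a, b) \<in> R"
    by (metis append_butlast_last_id list.collapse)
  show ?thesis unfolding path_act_append[OF assms(3)]
    by (simp add: path_act_eq path_append_def * arrow_act_relation fold_zero)
qed

lemma module_act:
  assumes "x \<in> acarrier A"
  shows "mact M f x = (\<Sum>p\<in>NP. fscale (x p) (path_act p f))"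
proof
  fix j
  have "{p. x p \<noteq> 0} \<subseteq> NP" using assms unfolding acarrier_iff by blast
  then show "mact M f x j = (\<Sum>p\<in>NP. fscale (x p) (path_act p f)) j"
    unfolding sum_fun_apply string_module_def fscale_def
    by (simp, intro sum.mono_neutral_left finite_paths) auto
qed

lemma path_act_support: "\<forall>j>length w. path_act p f j = 0"
  by (subst path_act_end[symmetric]) (auto simp: at_vertex_def)

text \<open>The decompositions of nonzero paths correspond to the pairs of paths with nonzero product.\<close>

lemma sum_products:
  fixes h :: "('v, 'a) qpath \<Rightarrow> ('v, 'a) qpath \<Rightarrow> 'c::comm_monoid_add"
  shows "(\<Sum>r\<in>NP. \<Sum>i\<le>length (snd r). h (fst r, take i (snd r)) (path_end Q (fst r, take i (snd r)), drop i (snd r)))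
    = (\<Sum>(p, q)\<in>{(p, q). p \<in> NP \<and> q \<in> NP \<and> path_end Q p = fst q \<and> path_append p q \<in> NP}. h p q)"
proof -
  have "(\<Sum>r\<in>NP. \<Sum>i\<le>length (snd r). h (fst r, take i (snd r)) (path_end Q (fst r, take i (snd r)), drop i (snd r)))
    = (\<Sum>(r, i)\<in>(SIGMA r:NP. {..length (snd r)}). h (fst r, take i (snd r)) (path_end Q (fst r, take i (snd r)), drop i (snd r)))"
    using finite_paths by (subst sum.Sigma) auto
  also have "\<dots> = (\<Sum>(p, q)\<in>{(p, q). p \<in> NP \<and> q \<in> NP \<and> path_end Q p = fst q \<and> path_append p q \<in> NP}. h p q)"
    by (rule sum.reindex_bij_witness[of _ "\<lambda>(p, q). (path_append p q, length (snd p))"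
        "\<lambda>(r, i). ((fst r, take i (snd r)), (path_end Q (fst r, take i (snd r)), drop i (snd r)))"])
      (auto simp: path_append_def take_path drop_path)
  finally show ?thesis .
qed

lemma string_module_right_module: "right_module (A :: (_, 'k::field) alg) M"
proof
  let ?M = "M :: (_, _, 'k) rmod"
  show "fun_subspace (mcarrier ?M)"
    by (rule fun_subspaceI) (auto simp: string_module_def fscale_def)
next
  fix f :: "nat \<Rightarrow> 'k" and x :: "('v, 'a) qpath \<Rightarrow> 'k"
  assume "f \<in> mcarrier M" "x \<in> acarrier A"
  have "(\<Sum>p\<in>NP. fscale (x p) (path_act p f)) j = 0" if "j > length w" for j
    unfolding sum_fun_apply using path_act_support that by (intro sum.neutral) (auto simp: fscale_def)
  then show "mact M f x \<in> mcarrier M"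
    unfolding module_act[OF \<open>x \<in> acarrier A\<close>] by (simp add: string_module_def)
next
  fix f g :: "nat \<Rightarrow> 'k" and x :: "('v, 'a) qpath \<Rightarrow> 'k"
  assume x: "x \<in> acarrier A"
  show "mact M (f + g) x = mact M f x + mact M g x"
    unfolding module_act[OF x] path_act_add fun_space.scale_right_distrib sum.distrib ..
next
  fix f :: "nat \<Rightarrow> 'k" and x y :: "('v, 'a) qpath \<Rightarrow> 'k"
  assume x: "x \<in> acarrier A" and y: "y \<in> acarrier A"
  have xy: "x + y \<in> acarrier A" using x y unfolding acarrier_iff plus_fun_def by (metis add_0)
  show "mact M f (x + y) = mact M f x + mact M f y"
    unfolding module_act[OF x] module_act[OF y] module_act[OF xy] plus_fun_apply
      fun_space.scale_left_distrib sum.distrib ..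
next
  fix f :: "nat \<Rightarrow> 'k" and x :: "('v, 'a) qpath \<Rightarrow> 'k" and c
  assume x: "x \<in> acarrier A"
  show "mact M (fscale c f) x = fscale c (mact M f x)"
    unfolding module_act[OF x] path_act_scale fun_space.scale_sum_right fun_space.scale_scale mult.commute[of c] ..
next
  fix f :: "nat \<Rightarrow> 'k" and x :: "('v, 'a) qpath \<Rightarrow> 'k" and c
  assume x: "x \<in> acarrier A"
  have cx: "fscale c x \<in> acarrier A" using x unfolding acarrier_iff fscale_def by (metis mult_zero_right)
  show "mact M f (fscale c x) = fscale c (mact M f x)"
    unfolding module_act[OF x] module_act[OF cx] fun_space.scale_sum_right fun_space.scale_scale
    by (simp add: fscale_def)
next
  fix f :: "nat \<Rightarrow> 'k" and x y :: "('v, 'a) qpath \<Rightarrow> 'k"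
  assume x: "x \<in> acarrier A" and y: "y \<in> acarrier A"
  let ?S = "{(p, q). p \<in> NP \<and> q \<in> NP \<and> path_end Q p = fst q \<and> path_append p q \<in> NP}"
  let ?h = "\<lambda>p q. fscale (x p * y q) (path_act q (path_act p f))"
  have "mact M (mact M f x) y = (\<Sum>q\<in>NP. fscale (y q) (\<Sum>p\<in>NP. fscale (x p) (path_act q (path_act p f))))"
    unfolding module_act[OF x] module_act[OF y] path_act_sum[OF finite_paths] ..
  also have "\<dots> = (\<Sum>q\<in>NP. \<Sum>p\<in>NP. ?h p q)"
    unfolding fun_space.scale_sum_right fun_space.scale_scale by (simp add: mult.commute)
  also have "\<dots> = (\<Sum>p\<in>NP. \<Sum>q\<in>NP. ?h p q)" by (rule sum.swap)
  also have "\<dots> = (\<Sum>(p, q)\<in>NP \<times> NP. ?h p q)" by (simp add: sum.cartesian_product)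
  also have "\<dots> = (\<Sum>(p, q)\<in>?S. ?h p q)"
  proof (rule sum.mono_neutral_right)
    have "path_act q (path_act p f) = (\<lambda>_. 0)" if "p \<in> NP" "q \<in> NP" "(p, q) \<notin> ?S" for p q
      using that path_act_not_composable[of p q f] path_act_zero_product[of p q f] by blast
    then show "\<forall>r\<in>NP \<times> NP - ?S. (case r of (p, q) \<Rightarrow> ?h p q) = 0"
      by (auto simp: fscale_def zero_fun_def)
  qed (use finite_paths in auto)
  also have "\<dots> = (\<Sum>(p, q)\<in>?S. fscale (x p * y q) (path_act (path_append p q) f))"
    by (rule sum.cong) (auto simp: path_act_append)
  also have "\<dots> = (\<Sum>r\<in>NP. fscale (amult A x y r) (path_act r f))"
  proof (subst sum_products[symmetric], rule sum.cong[OF refl])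
    fix r assume r: "r \<in> NP"
    have "(\<Sum>i\<le>length (snd r). fscale (x (fst r, take i (snd r)) * y (path_end Q (fst r, take i (snd r)), drop i (snd r)))
       (path_act (path_append (fst r, take i (snd r)) (path_end Q (fst r, take i (snd r)), drop i (snd r))) f))
      = (\<Sum>i\<le>length (snd r). fscale (x (fst r, take i (snd r)) * y (path_end Q (fst r, take i (snd r)), drop i (snd r)))
       (path_act r f))"
      by (simp add: path_append_def)
    also have "\<dots> = fscale (amult A x y r) (path_act r f)"
      using r by (simp add: amult_apply fun_space.scale_sum_left)
    finally show "(\<Sum>i\<le>length (snd r). fscale (x (fst r, take i (snd r)) * y (path_end Q (fst r, take i (snd r)), drop i (snd r)))
       (path_act (path_append (fst r, take i (snd r)) (path_end Q (fst r, take i (snd r)), drop i (snd r))) f))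
      = fscale (amult A x y r) (path_act r f)" .
  qed
  also have "\<dots> = mact M f (amult A x y)" unfolding module_act[OF amult_closed] ..
  finally show "mact M f (amult A x y) = mact M (mact M f x) y" by simp
next
  fix f :: "nat \<Rightarrow> 'k" assume f: "f \<in> mcarrier M"
  have one: "aone A \<in> acarrier (A :: (_, 'k) alg)"
    unfolding acarrier_iff by (auto simp: bound_quiver_algebra_def trivial_path_iff)
  show "mact M f (aone A) = f"
  proof
    fix j
    have "mact M f (aone A) j = (\<Sum>p\<in>NP. if p = (\<kappa> j, []) then f j else 0)"
      unfolding module_act[OF one] sum_fun_apply
    proof (rule sum.cong[OF refl])
      fix p assume "p \<in> NP"
      then have "fst p \<in> verts Q" by (rule path_start_vertex)
      then show "fscale (aone A p) (path_act p f) j = (if p = (\<kappa> j, []) then f j else 0)"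
        using f by (cases p) (auto simp: fscale_def bound_quiver_algebra_def path_act_eq at_vertex_def string_module_def)
    qed
    also have "\<dots> = (if (\<kappa> j, []) \<in> NP then f j else 0)" using finite_paths by simp
    also have "\<dots> = f j"
      using f string_vertices[of j] by (cases "j \<le> length w") (auto simp: trivial_path_iff string_module_def)
    finally show "mact M f (aone A) j = f j" .
  qed
qed

lemma string_module_fd: "fd_module (A :: (_, 'k::field) alg) M"
  by (rule fd_moduleI[OF string_module_right_module, of "{..length w}"]) (auto simp: string_module_def)

subsection \<open>Rays along the string\<close>

definition basis_vec :: "nat \<Rightarrow> nat \<Rightarrow> 'k::field" where
  "basis_vec i = (\<lambda>j. if j = i then 1 else 0)"

abbreviation arrows_between :: "nat \<Rightarrow> nat \<Rightarrow> 'a list" where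
  "arrows_between i j \<equiv> map (\<lambda>t. fst (w ! t)) [i..<j]"

text \<open>For a position \<open>j\<close> that is reached from \<open>i\<close> by direct letters only, or by inverse letters only
  when going left, the path sending the \<open>i\<close>-th basis vector of the module to the \<open>j\<close>-th one.\<close>

definition string_path :: "nat \<Rightarrow> nat \<Rightarrow> ('v, 'a) qpath" where
  "string_path i j = (\<kappa> i, if i \<le> j then arrows_between i j else rev (arrows_between j i))"

lemma length_string_path: "length (snd (string_path i j)) = (if i \<le> j then j - i else i - j)"
  by (simp add: string_path_def)

lemma letter_cases:
  assumes "j < length w"
  shows "snd (w ! j) \<Longrightarrow> fst (w ! j) \<in> arcs Q \<and> ht (fst (w ! j)) = (\<kappa> j, \<not> d j) \<and> hh (fst (w ! j)) = (\<kappa> (j + 1), \<not> d (j + 1))"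
    and "\<not> snd (w ! j) \<Longrightarrow> fst (w ! j) \<in> arcs Q \<and> ht (fst (w ! j)) = (\<kappa> (j + 1), d (j + 1)) \<and> hh (fst (w ! j)) = (\<kappa> j, d j)"
  using direct_letter[OF assms, of "fst (w ! j)"] inverse_letter[OF assms, of "fst (w ! j)"]
  by (auto simp: ht_def hh_def prod_eq_iff)

lemma right_string_ray:
  assumes "i \<le> j" "j \<le> length w" "\<And>t. i \<le> t \<Longrightarrow> t < j \<Longrightarrow> snd (w ! t)"
  shows "ray (\<kappa> i, \<not> d i) (arrows_between i j) \<and> ray_end (\<kappa> i, \<not> d i) (arrows_between i j) = (\<kappa> j, \<not> d j)"
  using assms
proof (induction j rule: dec_induct)
  case (step j)
  then have "snd (w ! j)" "j < length w" by auto
  then show ?case using letter_cases(1)[of j] step by simp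
qed simp

lemma left_string_ray:
  assumes "j \<le> i" "i \<le> length w" "\<And>t. j \<le> t \<Longrightarrow> t < i \<Longrightarrow> \<not> snd (w ! t)"
  shows "ray (\<kappa> i, d i) (rev (arrows_between j i)) \<and> ray_end (\<kappa> i, d i) (rev (arrows_between j i)) = (\<kappa> j, d j)"
  using assms
proof (induction j rule: inc_induct)
  case (step j)
  then have "\<not> snd (w ! j)" "j < length w" by auto
  moreover have "rev (arrows_between j i) = rev (arrows_between (Suc j) i) @ [fst (w ! j)]"
    using step by (simp add: upt_conv_Cons)
  ultimately show ?case using letter_cases(2)[of j] step by simp
qed simp

lemma arrow_act_right:
  assumes "a \<in> arcs Q" "ht a = (\<kappa> j, \<not> d j)" "j \<le> length w"
  shows "arrow_act a (basis_vec j) =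
    (if j < length w \<and> snd (w ! j) then basis_vec (j + 1) else (\<lambda>_. 0) :: nat \<Rightarrow> 'k::field)"
proof -
  have 1: "w ! j = (a, True) \<longleftrightarrow> snd (w ! j)" if "j < length w"
  proof
    assume "snd (w ! j)"
    then have "fst (w ! j) \<in> arcs Q" "ht (fst (w ! j)) = ht a" using letter_cases(1)[OF that] assms by auto
    then have "fst (w ! j) = a" using assms(1) by (intro ht_inj)
    then show "w ! j = (a, True)" using \<open>snd (w ! j)\<close> by (cases "w ! j") auto
  qed simp
  have 2: "w ! (j - 1) \<noteq> (a, False)" if "0 < j"
    using inverse_letter[of "j - 1" a] that assms by (cases j) (auto simp: ht_def)
  show ?thesis
  proof
    fix i
    have "(if 0 < i \<and> i \<le> length w \<and> w ! (i - 1) = (a, True) then basis_vec j (i - 1) else 0 :: 'k)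
        = (if j < length w \<and> snd (w ! j) \<and> i = j + 1 then 1 else 0)"
      using 1 by (cases "i = j + 1") (auto simp: basis_vec_def)
    moreover have "(if i < length w \<and> w ! i = (a, False) then basis_vec j (i + 1) else 0 :: 'k) = 0"
      using 2 by (cases "j = i + 1") (auto simp: basis_vec_def)
    ultimately show "arrow_act a (basis_vec j) i =
        (if j < length w \<and> snd (w ! j) then basis_vec (j + 1) else (\<lambda>_. 0) :: nat \<Rightarrow> 'k) i"
      unfolding string_arrow_act_def by (simp add: basis_vec_def)
  qed
qed

lemma arrow_act_left:
  assumes "a \<in> arcs Q" "ht a = (\<kappa> j, d j)" "j \<le> length w"
  shows "arrow_act a (basis_vec j) =
    (if 0 < j \<and> \<not> snd (w ! (j - 1)) then basis_vec (j - 1) else (\<lambda>_. 0) :: nat \<Rightarrow> 'k::field)"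
proof -
  have 1: "w ! (j - 1) = (a, False) \<longleftrightarrow> \<not> snd (w ! (j - 1))" if "0 < j"
  proof
    assume s: "\<not> snd (w ! (j - 1))"
    have j: "j - 1 < length w" "j - 1 + 1 = j" using that assms by auto
    have "fst (w ! (j - 1)) \<in> arcs Q" "ht (fst (w ! (j - 1))) = ht a"
      using letter_cases(2)[OF j(1) s, unfolded j(2)] assms by auto
    then have "fst (w ! (j - 1)) = a" using assms(1) by (intro ht_inj)
    then show "w ! (j - 1) = (a, False)" using s by (cases "w ! (j - 1)") auto
  qed simp
  have 2: "w ! j \<noteq> (a, True)" if "j < length w"
    using direct_letter[of j a] that assms by (auto simp: ht_def)
  show ?thesis
  proof
    fix i
    have "(if 0 < i \<and> i \<le> length w \<and> w ! (i - 1) = (a, True) then basis_vec j (i - 1) else 0 :: 'k) = 0"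
      using 2 by (cases "i = j + 1") (auto simp: basis_vec_def)
    moreover have "(if i < length w \<and> w ! i = (a, False) then basis_vec j (i + 1) else 0 :: 'k)
        = (if 0 < j \<and> \<not> snd (w ! (j - 1)) \<and> i = j - 1 then 1 else 0)"
      using 1 assms(3) by (cases "j = i + 1") (auto simp: basis_vec_def)
    ultimately show "arrow_act a (basis_vec j) i =
        (if 0 < j \<and> \<not> snd (w ! (j - 1)) then basis_vec (j - 1) else (\<lambda>_. 0) :: nat \<Rightarrow> 'k) i"
      unfolding string_arrow_act_def by (simp add: basis_vec_def)
  qed
qed

text \<open>A ray that leaves \<open>j\<close> on the right follows the string up to the next position \<open>D\<close> at which the
  direct letters end. A ray going beyond \<open>D\<close> annihilates the \<open>j\<close>-th basis vector. On the left,
  it follows the inverse letters in the same way.\<close>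

lemma right_ray_cases:
  assumes "j \<le> D" "D \<le> length w" "\<And>t. j \<le> t \<Longrightarrow> t < D \<Longrightarrow> snd (w ! t)" "D < length w \<Longrightarrow> \<not> snd (w ! D)"
    and "ray (\<kappa> j, \<not> d j) l"
  shows "(\<exists>t\<ge>j. t \<le> D \<and> l = arrows_between j t \<and> fold arrow_act l (basis_vec j) = (basis_vec t :: nat \<Rightarrow> 'k::field)) \<or>
    (\<exists>m. m \<noteq> [] \<and> l = arrows_between j D @ m \<and> ray (\<kappa> D, \<not> d D) m \<and>
      fold arrow_act l (basis_vec j) = (\<lambda>_. 0 :: 'k))"
  using assms
proof (induction l arbitrary: j)
  case Nil
  then show ?case by (intro disjI1 exI[of _ j]) auto
next
  case (Cons a l)
  have a: "a \<in> arcs Q" "ht a = (\<kappa> j, \<not> d j)" "ray (hh a) l" using Cons.prems by auto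
  show ?case
  proof (cases "j < D")
    case True
    have s: "snd (w ! j)" "j < length w" using Cons.prems True by auto
    have eq: "fst (w ! j) = a" using letter_cases(1)[OF s(2,1)] a ht_inj by metis
    have r: "ray (\<kappa> (Suc j), \<not> d (Suc j)) l" using letter_cases(1)[OF s(2,1)] a(3) eq by simp
    have act: "fold arrow_act (a # l) (basis_vec j) = fold arrow_act l (basis_vec (Suc j) :: nat \<Rightarrow> 'k)"
      using arrow_act_right[OF a(1,2), where ?'k = 'k] s by simp
    have up: "a # arrows_between (Suc j) t = arrows_between j t" if "Suc j \<le> t" for t
      using that eq by (simp add: upt_conv_Cons)
    have "(\<exists>t\<ge>Suc j. t \<le> D \<and> l = arrows_between (Suc j) t \<and>
         fold arrow_act l (basis_vec (Suc j)) = (basis_vec t :: nat \<Rightarrow> 'k)) \<or>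
      (\<exists>m. m \<noteq> [] \<and> l = arrows_between (Suc j) D @ m \<and> ray (\<kappa> D, \<not> d D) m \<and>
         fold arrow_act l (basis_vec (Suc j)) = (\<lambda>_. 0 :: 'k))"
      by (rule Cons.IH) (use Cons.prems True r in auto)
    then show ?thesis
    proof (elim disjE exE conjE)
      fix t assume "Suc j \<le> t" "t \<le> D" "l = arrows_between (Suc j) t"
        "fold arrow_act l (basis_vec (Suc j)) = (basis_vec t :: nat \<Rightarrow> 'k)"
      then show ?thesis using up[of t] act by (intro disjI1 exI[of _ t]) auto
    next
      fix m assume l: "l = arrows_between (Suc j) D @ m" and "m \<noteq> []" "ray (\<kappa> D, \<not> d D) m"
        "fold arrow_act l (basis_vec (Suc j)) = (\<lambda>_. 0 :: 'k)"
      moreover have "a # l = arrows_between j D @ m" using up[of D] True unfolding l by simp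
      ultimately show ?thesis using act by (intro disjI2 exI[of _ m]) simp
    qed
  next
    case False
    then have "j = D" using Cons.prems by simp
    have "fold arrow_act (a # l) (basis_vec j) = (\<lambda>_. 0 :: 'k)"
      using arrow_act_right[OF a(1,2), where ?'k = 'k] Cons.prems(2,4) \<open>j = D\<close> by (auto simp: fold_zero)
    then show ?thesis using Cons.prems(5) \<open>j = D\<close> by (intro disjI2 exI[of _ "a # l"]) simp
  qed
qed

lemma left_ray_cases:
  assumes "D \<le> j" "j \<le> length w" "\<And>t. D \<le> t \<Longrightarrow> t < j \<Longrightarrow> \<not> snd (w ! t)" "0 < D \<Longrightarrow> snd (w ! (D - 1))"
    and "ray (\<kappa> j, d j) l"
  shows "(\<exists>t\<le>j. D \<le> t \<and> l = rev (arrows_between t j) \<and> fold arrow_act l (basis_vec j) = (basis_vec t :: nat \<Rightarrow> 'k::field)) \<or>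
    (\<exists>m. m \<noteq> [] \<and> l = rev (arrows_between D j) @ m \<and> ray (\<kappa> D, d D) m \<and>
      fold arrow_act l (basis_vec j) = (\<lambda>_. 0 :: 'k))"
  using assms
proof (induction l arbitrary: j)
  case Nil
  then show ?case by (intro disjI1 exI[of _ j]) auto
next
  case (Cons a l)
  have a: "a \<in> arcs Q" "ht a = (\<kappa> j, d j)" "ray (hh a) l" using Cons.prems by auto
  show ?case
  proof (cases "D < j")
    case True
    then obtain i where i: "j = Suc i" by (cases j) auto
    have s: "\<not> snd (w ! i)" "i < length w" using Cons.prems True i by auto
    have eq: "fst (w ! i) = a" using letter_cases(2)[OF s(2,1)] a ht_inj i by auto
    have r: "ray (\<kappa> i, d i) l" using letter_cases(2)[OF s(2,1)] a(3) eq by simp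
    have act: "fold arrow_act (a # l) (basis_vec j) = fold arrow_act l (basis_vec i :: nat \<Rightarrow> 'k)"
      using arrow_act_left[OF a(1,2), where ?'k = 'k] s i Cons.prems(2) by simp
    have up: "a # rev (arrows_between t i) = rev (arrows_between t j)" if "t \<le> i" for t
      using that eq i by simp
    have "(\<exists>t\<le>i. D \<le> t \<and> l = rev (arrows_between t i) \<and>
         fold arrow_act l (basis_vec i) = (basis_vec t :: nat \<Rightarrow> 'k)) \<or>
      (\<exists>m. m \<noteq> [] \<and> l = rev (arrows_between D i) @ m \<and> ray (\<kappa> D, d D) m \<and>
         fold arrow_act l (basis_vec i) = (\<lambda>_. 0 :: 'k))"
      by (rule Cons.IH) (use Cons.prems True r i in auto)
    then show ?thesis
    proof (elim disjE exE conjE)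
      fix t assume "t \<le> i" "D \<le> t" "l = rev (arrows_between t i)"
        "fold arrow_act l (basis_vec i) = (basis_vec t :: nat \<Rightarrow> 'k)"
      then show ?thesis using up[of t] act i by (intro disjI1 exI[of _ t]) auto
    next
      fix m assume l: "l = rev (arrows_between D i) @ m" and "m \<noteq> []" "ray (\<kappa> D, d D) m"
        "fold arrow_act l (basis_vec i) = (\<lambda>_. 0 :: 'k)"
      moreover have "a # l = rev (arrows_between D j) @ m" using up[of D] True i unfolding l by simp
      ultimately show ?thesis using act by (intro disjI2 exI[of _ m]) simp
    qed
  next
    case False
    then have "j = D" using Cons.prems by simp
    have "fold arrow_act (a # l) (basis_vec j) = (\<lambda>_. 0 :: 'k)"
      using arrow_act_left[OF a(1,2), where ?'k = 'k] Cons.prems(2,4) \<open>j = D\<close> by (auto simp: fold_zero)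
    then show ?thesis using Cons.prems(5) \<open>j = D\<close> by (intro disjI2 exI[of _ "a # l"]) simp
  qed
qed

end

section \<open>The resolution of a string module\<close>

text \<open>The string has \<open>k\<close> peaks, at the positions \<open>pk i\<close>, separated by the valleys \<open>dp i\<close>; the ends of the
  string count as valleys, even if they are peaks. The diagram consists of the peaks and inner
  valleys, and of the ends of the arrows of the relation chains \<open>X\<close> and \<open>Y\<close> that start where the
  string can be prolonged on the left and on the right.\<close>

locale gentle_string_diagram = gentle_string Q R te he \<kappa> d w
  for Q :: "('v, 'a) pre_digraph" and R and te and he and \<kappa> and d and w +
  fixes k :: nat and pk dp :: "nat \<Rightarrow> nat" and X Y :: "'a list"
    and V :: "'v list" and L :: "('v, 'a) qpath link list"
  assumes k: "1 \<le> k" and dp_0: "dp 0 = 0" and dp_k: "dp k = length w"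
    and order: "i < k \<Longrightarrow> dp i \<le> pk i \<and> pk i \<le> dp (i + 1)"
    and strict_left: "0 < i \<Longrightarrow> i < k \<Longrightarrow> dp i < pk i"
    and strict_right: "i + 1 < k \<Longrightarrow> pk i < dp (i + 1)"
    and inverse_part: "i < k \<Longrightarrow> dp i \<le> t \<Longrightarrow> t < pk i \<Longrightarrow> \<not> snd (w ! t)"
    and direct_part: "i < k \<Longrightarrow> pk i \<le> t \<Longrightarrow> t < dp (i + 1) \<Longrightarrow> snd (w ! t)"
    and X: "relation_chain (\<kappa> 0, d 0) X"
    and Y: "relation_chain (\<kappa> (length w), \<not> d (length w)) Y"
    and length_V: "length V = length X + (2 * k - 1) + length Y"
    and length_L: "length L + 1 = length V"
    and V_left: "t < length X \<Longrightarrow> V ! (length X - 1 - t) = head Q (X ! t)"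
    and V_peak: "i < k \<Longrightarrow> V ! (length X + 2 * i) = \<kappa> (pk i)"
    and V_valley: "i + 1 < k \<Longrightarrow> V ! (length X + 2 * i + 1) = \<kappa> (dp (i + 1))"
    and V_right: "t < length Y \<Longrightarrow> V ! (length X + 2 * k - 1 + t) = head Q (Y ! t)"
    and maps: "displayed_map L s' s u \<longleftrightarrow>
      (\<exists>t<length X. s' = length X - 1 - t \<and> s = length X - t \<and>
         u = (if t = 0 then (\<kappa> (pk 0), snd (string_path (pk 0) 0) @ [X ! 0]) else (tail Q (X ! t), [X ! t]))) \<or>
      (\<exists>i. i + 1 < k \<and> s' = length X + 2 * i + 1 \<and> s = length X + 2 * i \<and>
         u = string_path (pk i) (dp (i + 1))) \<or>
      (\<exists>i. i + 1 < k \<and> s' = length X + 2 * i + 1 \<and> s = length X + 2 * i + 2 \<and>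
         u = string_path (pk (i + 1)) (dp (i + 1))) \<or>
      (\<exists>t<length Y. s' = length X + 2 * k - 1 + t \<and> s = length X + 2 * k - 2 + t \<and>
         u = (if t = 0 then (\<kappa> (pk (k - 1)), snd (string_path (pk (k - 1)) (length w)) @ [Y ! 0])
              else (tail Q (Y ! t), [Y ! t])))"
begin

lemma dp_le: "i \<le> j \<Longrightarrow> j \<le> k \<Longrightarrow> dp i \<le> dp j"
proof (induction j rule: dec_induct)
  case (step j)
  then show ?case using order[of j] by simp
qed simp

lemma dp_bound: "i \<le> k \<Longrightarrow> dp i \<le> length w"
  using dp_le[of i k] dp_k by simp

lemma right_part_ray:
  assumes "i < k" "pk i \<le> j" "j \<le> dp (i + 1)"
  shows "ray (\<kappa> (pk i), \<not> d (pk i)) (arrows_between (pk i) j) \<and>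
    ray_end (\<kappa> (pk i), \<not> d (pk i)) (arrows_between (pk i) j) = (\<kappa> j, \<not> d j)"
  by (rule right_string_ray) (use assms dp_bound[of "i + 1"] direct_part[of i] in auto)

lemma left_part_ray:
  assumes "i < k" "dp i \<le> j" "j \<le> pk i"
  shows "ray (\<kappa> (pk i), d (pk i)) (rev (arrows_between j (pk i))) \<and>
    ray_end (\<kappa> (pk i), d (pk i)) (rev (arrows_between j (pk i))) = (\<kappa> j, d j)"
  by (rule left_string_ray) (use assms dp_bound[of "i + 1"] order[of i] inverse_part[of i] in auto)

lemma string_path_left: "dp i \<le> j \<Longrightarrow> j \<le> pk i \<Longrightarrow> snd (string_path (pk i) j) = rev (arrows_between j (pk i))"
  by (cases "j = pk i") (auto simp: string_path_def)

text \<open>The displayed maps, with their lists of arrows \<open>l\<close> and the sides \<open>h\<close> and \<open>h'\<close> at which these start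
  and end. The paths of the maps at the first arrow of a relation chain, numbered \<open>0\<close>, start at the
  outermost peak and pass through the end of the string.\<close>

definition left_start :: "nat \<Rightarrow> 'v \<times> bool" where
  "left_start t = (if t = 0 then (\<kappa> (pk 0), d (pk 0)) else ht (X ! t))"

definition right_start :: "nat \<Rightarrow> 'v \<times> bool" where
  "right_start t = (if t = 0 then (\<kappa> (pk (k - 1)), \<not> d (pk (k - 1))) else ht (Y ! t))"

definition left_list :: "nat \<Rightarrow> 'a list" where
  "left_list t = (if t = 0 then rev (arrows_between 0 (pk 0)) @ [X ! 0] else [X ! t])"

definition right_list :: "nat \<Rightarrow> 'a list" where
  "right_list t = (if t = 0 then arrows_between (pk (k - 1)) (length w) @ [Y ! 0] else [Y ! t])"

definition sided_map :: "nat \<Rightarrow> nat \<Rightarrow> 'v \<times> bool \<Rightarrow> 'a list \<Rightarrow> 'v \<times> bool \<Rightarrow> bool" where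
  "sided_map s' s h l h' \<longleftrightarrow>
      (\<exists>t<length X. s' = length X - 1 - t \<and> s = length X - t \<and> h = left_start t \<and> l = left_list t \<and>
         h' = hh (X ! t)) \<or>
      (\<exists>i. i + 1 < k \<and> s' = length X + 2 * i + 1 \<and> s = length X + 2 * i \<and>
         h = (\<kappa> (pk i), \<not> d (pk i)) \<and> l = arrows_between (pk i) (dp (i + 1)) \<and>
         h' = (\<kappa> (dp (i + 1)), \<not> d (dp (i + 1)))) \<or>
      (\<exists>i. i + 1 < k \<and> s' = length X + 2 * i + 1 \<and> s = length X + 2 * i + 2 \<and>
         h = (\<kappa> (pk (i + 1)), d (pk (i + 1))) \<and> l = rev (arrows_between (dp (i + 1)) (pk (i + 1))) \<and>
         h' = (\<kappa> (dp (i + 1)), d (dp (i + 1)))) \<or>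
      (\<exists>t<length Y. s' = length X + 2 * k - 1 + t \<and> s = length X + 2 * k - 2 + t \<and> h = right_start t \<and>
         l = right_list t \<and> h' = hh (Y ! t))"

lemma displayed_map_iff: "displayed_map L s' s u \<longleftrightarrow> (\<exists>h l h'. sided_map s' s h l h' \<and> u = (fst h, l))"
proof -
  have 1: "(if t = 0 then (\<kappa> (pk 0), snd (string_path (pk 0) 0) @ [X ! 0]) else (tail Q (X ! t), [X ! t]))
    = (fst (left_start t), left_list t)" for t
    using string_path_left[of 0 0] dp_0 by (simp add: left_start_def left_list_def ht_def)
  have 2: "(if t = 0 then (\<kappa> (pk (k - 1)), snd (string_path (pk (k - 1)) (length w)) @ [Y ! 0]) else (tail Q (Y ! t), [Y ! t]))
    = (fst (right_start t), right_list t)" for t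
    using order[of "k - 1"] k dp_k by (simp add: right_start_def right_list_def ht_def string_path_def)
  have 3: "string_path (pk i) (dp (i + 1)) = (\<kappa> (pk i), arrows_between (pk i) (dp (i + 1)))" if "i + 1 < k" for i
    using order[of i] that by (simp add: string_path_def)
  have 4: "string_path (pk (i + 1)) (dp (i + 1)) = (\<kappa> (pk (i + 1)), rev (arrows_between (dp (i + 1)) (pk (i + 1))))"
    if "i + 1 < k" for i
    using strict_left[of "i + 1"] that by (simp add: string_path_def)
  show ?thesis
  proof
    assume "displayed_map L s' s u"
    then show "\<exists>h l h'. sided_map s' s h l h' \<and> u = (fst h, l)"
      unfolding maps 1 2
    proof (elim disjE exE conjE)
      fix t assume "t < length X" "s' = length X - 1 - t" "s = length X - t" "u = (fst (left_start t), left_list t)"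
      then show ?thesis unfolding sided_map_def by blast
    next
      fix i assume "i + 1 < k" "s' = length X + 2 * i + 1" "s = length X + 2 * i" "u = string_path (pk i) (dp (i + 1))"
      then show ?thesis unfolding sided_map_def
        by (intro exI[of _ "(\<kappa> (pk i), \<not> d (pk i))"] exI[of _ "arrows_between (pk i) (dp (i + 1))"]
            exI[of _ "(\<kappa> (dp (i + 1)), \<not> d (dp (i + 1)))"]) (use 3[of i] in auto)
    next
      fix i assume "i + 1 < k" "s' = length X + 2 * i + 1" "s = length X + 2 * i + 2" "u = string_path (pk (i + 1)) (dp (i + 1))"
      then show ?thesis unfolding sided_map_def
        by (intro exI[of _ "(\<kappa> (pk (i + 1)), d (pk (i + 1)))"] exI[of _ "rev (arrows_between (dp (i + 1)) (pk (i + 1)))"]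
            exI[of _ "(\<kappa> (dp (i + 1)), d (dp (i + 1)))"]) (use 4[of i] in auto)
    next
      fix t assume "t < length Y" "s' = length X + 2 * k - 1 + t" "s = length X + 2 * k - 2 + t" "u = (fst (right_start t), right_list t)"
      then show ?thesis unfolding sided_map_def by blast
    qed
  next
    assume "\<exists>h l h'. sided_map s' s h l h' \<and> u = (fst h, l)"
    then show "displayed_map L s' s u"
      unfolding maps 1 2 sided_map_def
    proof (elim disjE exE conjE, goal_cases)
      case (2 h l h' i)
      then have "u = string_path (pk i) (dp (i + 1))" using 3[of i] by simp
      then show ?case using 2 by blast
    next
      case (3 h l h' i)
      then have "u = string_path (pk (i + 1)) (dp (i + 1))" using 4[of i] by simp
      then show ?case using 3 by blast
    qed blast+
  qed
qed

text \<open>Peaks have degree \<open>0\<close>, inner valleys have degree \<open>1\<close>, and along the relation chains the degrees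
  increase outwards from \<open>1\<close>.\<close>

definition deg :: "nat \<Rightarrow> nat" where
  "deg s = (if s < length X then length X - s
     else if s \<le> length X + 2 * k - 2 then (s - length X) mod 2 else s - (length X + 2 * k - 2))"

lemma deg_simps:
  "t < length X \<Longrightarrow> deg (length X - 1 - t) = t + 1"
  "i < k \<Longrightarrow> deg (length X + 2 * i) = 0"
  "i + 1 < k \<Longrightarrow> deg (length X + 2 * i + 1) = 1"
  "deg (length X + 2 * k - 1 + t) = t + 1"
  using k by (auto simp: deg_def)

lemma node_cases:
  assumes "s < length V"
  obtains (left) t where "t < length X" "s = length X - 1 - t"
    | (peak) i where "i < k" "s = length X + 2 * i"
    | (valley) i where "i + 1 < k" "s = length X + 2 * i + 1"
    | (right) t where "t < length Y" "s = length X + 2 * k - 1 + t"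
proof -
  consider "s < length X" | "length X \<le> s" "s \<le> length X + 2 * k - 2" "even (s - length X)"
    | "length X \<le> s" "s \<le> length X + 2 * k - 2" "odd (s - length X)" | "length X + 2 * k - 2 < s" by linarith
  then show thesis
  proof cases
    case 1
    then show thesis using left[of "length X - 1 - s"] by simp
  next
    case 2
    then obtain i where "s - length X = 2 * i" by blast
    then show thesis using peak[of i] 2 k by simp
  next
    case 3
    obtain i where "s - length X = 2 * i + 1" using 3(3) by (rule oddE)
    then show thesis using valley[of i] 3 k by simp
  next
    case 4
    then show thesis using right[of "s - (length X + 2 * k - 1)"] assms length_V k by simp
  qed
qed

lemma deg_0_iff: "s < length V \<and> deg s = 0 \<longleftrightarrow> (\<exists>i<k. s = length X + 2 * i)"
proof
  assume s: "s < length V \<and> deg s = 0"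
  then have "s < length V" by simp
  then show "\<exists>i<k. s = length X + 2 * i"
  proof (cases rule: node_cases)
    case (left t)
    then show ?thesis using s deg_simps(1)[of t] by simp
  next
    case (valley i)
    then show ?thesis using s deg_simps(3)[of i] by simp
  next
    case (right t)
    then show ?thesis using s deg_simps(4)[of t] by simp
  qed blast
next
  assume "\<exists>i<k. s = length X + 2 * i"
  then show "s < length V \<and> deg s = 0" using length_V by (auto simp: deg_simps)
qed

lemma chain_heads_left: "0 < t \<Longrightarrow> t < length X \<Longrightarrow> ht (X ! t) = opposite (hh (X ! (t - 1)))"
  using relation_chain_nth[OF X, of t] by simp

lemma chain_heads_right: "0 < t \<Longrightarrow> t < length Y \<Longrightarrow> ht (Y ! t) = opposite (hh (Y ! (t - 1)))"
  using relation_chain_nth[OF Y, of t] by simp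

lemma left_map:
  assumes "t < length X"
  shows "ray (left_start t) (left_list t) \<and> ray_end (left_start t) (left_list t) = hh (X ! t) \<and>
    left_list t \<noteq> [] \<and> fst (left_start t) = V ! (length X - t) \<and> fst (hh (X ! t)) = V ! (length X - 1 - t)"
proof (cases "t = 0")
  case True
  have "ht (X ! 0) = (\<kappa> 0, d 0)" "X ! 0 \<in> arcs Q" using relation_chain_nth[OF X, of 0] assms True by auto
  then show ?thesis
    using left_part_ray[of 0 0] k dp_0 order[of 0] V_peak[of 0] V_left[of 0] assms
    by (simp add: left_start_def left_list_def hh_def True)
next
  case False
  then have t: "t - 1 < length X" "length X - 1 - (t - 1) = length X - t" using assms by auto
  have h: "ht (X ! t) = opposite (hh (X ! (t - 1)))" "X ! t \<in> arcs Q"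
    using relation_chain_nth[OF X, of t] assms False by auto
  then have "fst (ht (X ! t)) = V ! (length X - t)"
    using V_left[OF t(1)] t(2) by (simp add: opposite_def hh_def)
  then show ?thesis using False h V_left[OF assms] by (simp add: left_start_def left_list_def hh_def)
qed

lemma right_map:
  assumes "t < length Y"
  shows "ray (right_start t) (right_list t) \<and> ray_end (right_start t) (right_list t) = hh (Y ! t) \<and>
    right_list t \<noteq> [] \<and> fst (right_start t) = V ! (length X + 2 * k - 2 + t) \<and>
    fst (hh (Y ! t)) = V ! (length X + 2 * k - 1 + t)"
proof (cases "t = 0")
  case True
  have a: "ht (Y ! 0) = (\<kappa> (length w), \<not> d (length w))" "Y ! 0 \<in> arcs Q"
    using relation_chain_nth[OF Y, of 0] assms True by auto
  have "length X + 2 * (k - 1) = length X + 2 * k - 2" using k by simp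
  then show ?thesis
    using right_part_ray[of "k - 1" "length w"] k dp_k order[of "k - 1"] V_peak[of "k - 1"] V_right[of 0] assms a
    by (simp add: right_start_def right_list_def hh_def True)
next
  case False
  then have t: "t - 1 < length Y" "length X + 2 * k - 1 + (t - 1) = length X + 2 * k - 2 + t" using assms k by auto
  have h: "ht (Y ! t) = opposite (hh (Y ! (t - 1)))" "Y ! t \<in> arcs Q"
    using relation_chain_nth[OF Y, of t] assms False by auto
  then have "fst (ht (Y ! t)) = V ! (length X + 2 * k - 2 + t)"
    using V_right[OF t(1)] t(2) by (simp add: opposite_def hh_def)
  then show ?thesis using False h V_right[OF assms] by (simp add: right_start_def right_list_def hh_def)
qed

lemma sided_map_ray:
  assumes "sided_map s' s h l h'"
  shows "ray h l" "ray_end h l = h'" "l \<noteq> []" "fst h = V ! s" "fst h' = V ! s'" "deg s' = deg s + 1"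
    "s < length V" "s' < length V"
proof -
  have "ray h l \<and> ray_end h l = h' \<and> l \<noteq> [] \<and> fst h = V ! s \<and> fst h' = V ! s' \<and> deg s' = deg s + 1 \<and>
    s < length V \<and> s' < length V"
    using assms unfolding sided_map_def
  proof (elim disjE exE conjE)
    fix t assume *: "t < length X" "s' = length X - 1 - t" "s = length X - t" "h = left_start t" "l = left_list t"
         "h' = hh (X ! t)"
    have "deg s = t"
    proof (cases t)
      case 0
      then show ?thesis using deg_simps(2)[of 0] k * by simp
    next
      case (Suc i)
      then show ?thesis using deg_simps(1)[of i] * by simp
    qed
    then show ?thesis using * left_map[OF *(1)] deg_simps(1)[OF *(1)] length_V k by auto
  next
    fix i assume *: "i + 1 < k" "s' = length X + 2 * i + 1" "s = length X + 2 * i"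
         "h = (\<kappa> (pk i), \<not> d (pk i))" "l = arrows_between (pk i) (dp (i + 1))"
         "h' = (\<kappa> (dp (i + 1)), \<not> d (dp (i + 1)))"
    then show ?thesis
      using right_part_ray[of i "dp (i + 1)"] order[of i] strict_right[of i] V_peak[of i] V_valley[of i]
        deg_simps(2)[of i] deg_simps(3)[of i] length_V by (simp, arith)
  next
    fix i assume *: "i + 1 < k" "s' = length X + 2 * i + 1" "s = length X + 2 * i + 2"
         "h = (\<kappa> (pk (i + 1)), d (pk (i + 1)))" "l = rev (arrows_between (dp (i + 1)) (pk (i + 1)))"
         "h' = (\<kappa> (dp (i + 1)), d (dp (i + 1)))"
    then show ?thesis
      using left_part_ray[of "i + 1" "dp (i + 1)"] order[of "i + 1"] strict_left[of "i + 1"] V_peak[of "i + 1"] V_valley[of i]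
        deg_simps(2)[of "i + 1"] deg_simps(3)[of i] length_V by (simp, arith)
  next
    fix t assume *: "t < length Y" "s' = length X + 2 * k - 1 + t" "s = length X + 2 * k - 2 + t" "h = right_start t"
         "l = right_list t" "h' = hh (Y ! t)"
    have "deg s = t"
    proof (cases t)
      case 0
      then show ?thesis using deg_simps(2)[of "k - 1"] k * by (simp add: right_diff_distrib')
    next
      case (Suc i)
      then have "s = length X + 2 * k - 1 + i" using * k by simp
      then show ?thesis using deg_simps(4)[of i] Suc by simp
    qed
    then show ?thesis using * right_map[OF *(1)] deg_simps(4)[of t] length_V k by auto
  qed
  then show "ray h l" "ray_end h l = h'" "l \<noteq> []" "fst h = V ! s" "fst h' = V ! s'" "deg s' = deg s + 1"
    "s < length V" "s' < length V" by blast+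
qed

lemma node_vertex:
  assumes "s < length V"
  shows "V ! s \<in> verts Q"
  using assms
proof (cases rule: node_cases)
  case (left t)
  then show ?thesis using V_left[of t] relation_chain_nth[OF X, of t] head_in_verts by simp
next
  case (peak i)
  then show ?thesis using V_peak[of i] string_vertices[of "pk i"] order[of i] dp_bound[of "i + 1"] by simp
next
  case (valley i)
  then show ?thesis using V_valley[of i] string_vertices[of "dp (i + 1)"] dp_bound[of "i + 1"] by simp
next
  case (right t)
  then show ?thesis using V_right[of t] relation_chain_nth[OF Y, of t] head_in_verts by simp
qed

sublocale graded_diagram Q R V L deg
proof
  show "length V = length L + 1" using length_L by simp
  show "\<exists>s<length V. deg s = 0" using deg_0_iff[of "length X + 2 * 0"] k by (intro exI[of _ "length X"]) simp
  show "V ! s \<in> verts Q" if "s < length V" for s using node_vertex that .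
  fix s' s u assume "displayed_map L s' s u"
  then obtain h l h' where h: "sided_map s' s h l h'" "u = (fst h, l)" unfolding displayed_map_iff by blast
  note r = sided_map_ray[OF h(1)]
  show "deg s' = deg s + 1" by (rule r)
  have "u \<in> nonzero_paths Q R"
    unfolding h nonzero_path_iff_ray using r node_vertex[OF r(7)] by (metis prod.collapse)
  moreover have "path_end Q u = V ! s'"
    unfolding h using fst_ray_end[of h l] r by simp
  ultimately show "u \<in> nonzero_paths Q R \<and> snd u \<noteq> [] \<and> fst u = V ! s \<and> path_end Q u = V ! s'"
    using h r by simp
qed

lemma covers_iff:
  "covers y x \<longleftrightarrow> (\<exists>h l h'. sided_map (fst y) (fst x) h l h' \<and> snd x = (fst h, l @ snd (snd y)) \<and>
     ray h' (snd (snd y)) \<and> fst (snd y) = fst h')"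
proof
  assume "covers y x"
  then obtain h l h' where h: "sided_map (fst y) (fst x) h l h'" "snd x \<in> NP" "snd x = path_append (fst h, l) (snd y)"
      "fst (snd y) = path_end Q (fst h, l)"
    unfolding covers_def displayed_map_iff by blast
  note r = sided_map_ray[OF h(1)]
  have "ray h' (snd (snd y))"
    using nonzero_append_iff[OF r(1,3), of "snd (snd y)"] r h node_vertex[OF r(7)] by (simp add: path_append_def)
  moreover have "fst (snd y) = fst h'" using h(4) fst_ray_end[of h l] r by simp
  ultimately show "\<exists>h l h'. sided_map (fst y) (fst x) h l h' \<and> snd x = (fst h, l @ snd (snd y)) \<and>
     ray h' (snd (snd y)) \<and> fst (snd y) = fst h'"
    using h by (auto simp: path_append_def)
next
  assume "\<exists>h l h'. sided_map (fst y) (fst x) h l h' \<and> snd x = (fst h, l @ snd (snd y)) \<and>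
     ray h' (snd (snd y)) \<and> fst (snd y) = fst h'"
  then obtain h l h' where h: "sided_map (fst y) (fst x) h l h'" "snd x = (fst h, l @ snd (snd y))"
     "ray h' (snd (snd y))" "fst (snd y) = fst h'" by blast
  note r = sided_map_ray[OF h(1)]
  have "snd x \<in> NP"
    using nonzero_append_iff[OF r(1,3), of "snd (snd y)"] r h node_vertex[OF r(7)] by simp
  moreover have "fst (snd y) = path_end Q (fst h, l)" using h(4) fst_ray_end[of h l] r by simp
  moreover have "displayed_map L (fst y) (fst x) (fst h, l)" unfolding displayed_map_iff using h(1) by blast
  ultimately show "covers y x"
    unfolding covers_def using h by (intro exI[of _ "(fst h, l)"]) (simp add: path_append_def)
qed

lemma coversI:
  assumes "sided_map s' s h l h'" "ray h' q"
  shows "covers (s', (V ! s', q)) (s, (V ! s, l @ q))"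
  unfolding covers_iff using assms sided_map_ray[OF assms(1)]
  by (intro exI[of _ h] exI[of _ l] exI[of _ h']) simp

lemma sided_map_cases [consumes 1, case_names left_tail right left right_tail]:
  assumes "sided_map s' s h l h'"
  obtains t where "t < length X" "s' = length X - 1 - t" "s = length X - t" "h = left_start t"
      "l = left_list t" "h' = hh (X ! t)"
    | i where "i + 1 < k" "s' = length X + 2 * i + 1" "s = length X + 2 * i"
      "h = (\<kappa> (pk i), \<not> d (pk i))" "l = arrows_between (pk i) (dp (i + 1))"
      "h' = (\<kappa> (dp (i + 1)), \<not> d (dp (i + 1)))"
    | i where "i + 1 < k" "s' = length X + 2 * i + 1" "s = length X + 2 * i + 2"
      "h = (\<kappa> (pk (i + 1)), d (pk (i + 1)))" "l = rev (arrows_between (dp (i + 1)) (pk (i + 1)))"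
      "h' = (\<kappa> (dp (i + 1)), d (dp (i + 1)))"
    | t where "t < length Y" "s' = length X + 2 * k - 1 + t" "s = length X + 2 * k - 2 + t" "h = right_start t"
      "l = right_list t" "h' = hh (Y ! t)"
  using assms unfolding sided_map_def by blast

lemma sided_map_ends_unique:
  assumes "sided_map s' s h1 l1 h1'" "sided_map s' s h2 l2 h2'"
  shows "h1 = h2 \<and> l1 = l2 \<and> h1' = h2'"
  using assms(1)
proof (cases rule: sided_map_cases)
  case 1: (left_tail t)
  from assms(2) show ?thesis
  proof (cases rule: sided_map_cases)
    case 2: (left_tail t')
    then have "t' = t" using 1(1,3) by linarith
    then show ?thesis using 1 2 by simp
  qed (use 1(1-3) k in linarith)+
next
  case 1: (right i)
  from assms(2) show ?thesis
  proof (cases rule: sided_map_cases)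
    case 2: (right j)
    then have "j = i" using 1(3) by linarith
    then show ?thesis using 1 2 by simp
  qed (use 1(1-3) k in linarith)+
next
  case 1: (left i)
  from assms(2) show ?thesis
  proof (cases rule: sided_map_cases)
    case 2: (left j)
    then have "j = i" using 1(3) by linarith
    then show ?thesis using 1 2 by simp
  qed (use 1(1-3) k in linarith)+
next
  case 1: (right_tail t)
  from assms(2) show ?thesis
  proof (cases rule: sided_map_cases)
    case 2: (right_tail t')
    then have "t' = t" using 1(1,3) by linarith
    then show ?thesis using 1 2 by simp
  qed (use 1(1-3) k in linarith)+
qed

lemma sided_map_adjacent:
  assumes "sided_map s' s h l h'"
  shows "(s = Suc s' \<or> s' = Suc s) \<and> (s < length X \<longrightarrow> s = Suc s') \<and> (length X + 2 * k - 2 < s \<longrightarrow> s' = Suc s)"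
  using assms
proof (cases rule: sided_map_cases)
  case (left_tail t)
  then have "s = Suc s'" by linarith
  then show ?thesis using left_tail(1,3) k by linarith
next
  case (right i)
  then have "s' = Suc s" by linarith
  then show ?thesis using right(1,3) k by linarith
next
  case (left i)
  then have "s = Suc s'" by linarith
  then show ?thesis using left(1,3) k by linarith
next
  case (right_tail t)
  then have "s' = Suc s" using k by linarith
  then show ?thesis using right_tail(1,3) k by linarith
qed

text \<open>The path of a displayed map into a peak starts at the left side of the peak if the map comes from
  the left, and at the right side if it comes from the right.\<close>

lemma sided_map_start:
  assumes "sided_map s' s h l h'" "length X \<le> s" "s \<le> length X + 2 * k - 2"
  shows "snd h = (if s = Suc s' then d (pk ((s - length X) div 2)) else \<not> d (pk ((s - length X) div 2)))"
  using assms(1) unfolding sided_map_def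
proof (elim disjE exE conjE)
  fix t assume *: "t < length X" "s' = length X - 1 - t" "s = length X - t" "h = left_start t"
  then have "t = 0" using assms by simp
  then show ?thesis using * by (simp add: left_start_def)
next
  fix t assume *: "t < length Y" "s' = length X + 2 * k - 1 + t" "s = length X + 2 * k - 2 + t" "h = right_start t"
  then have "t = 0" using assms by simp
  moreover have "(length X + 2 * k - 2 - length X) div 2 = k - 1" using k by simp
  ultimately show ?thesis using * k by (simp add: right_start_def)
qed auto

lemma incoming_unique:
  assumes "sided_map s1 s h l1 h1" "sided_map s2 s h l2 h2"
  shows "s1 = s2 \<and> l1 = l2 \<and> h1 = h2"
proof -
  have "s1 = s2"
  proof (rule ccontr)
    assume "s1 \<noteq> s2"
    then have *: "s = Suc s1 \<longleftrightarrow> s \<noteq> Suc s2" "length X \<le> s" "s \<le> length X + 2 * k - 2"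
      using sided_map_adjacent[OF assms(1)] sided_map_adjacent[OF assms(2)] by force+
    then show False using sided_map_start[OF assms(1)] sided_map_start[OF assms(2)] by (auto split: if_splits)
  qed
  then show ?thesis using sided_map_ends_unique assms by blast
qed

text \<open>Inner valleys are the only nodes at which two displayed maps start.\<close>

lemma outgoing_unique:
  assumes "sided_map s s1 h1 l1 h1'" "sided_map s s2 h2 l2 h2'"
  shows "s1 = s2 \<and> h1 = h2 \<and> l1 = l2 \<and> h1' = h2' \<or>
    (\<exists>i. i + 1 < k \<and> s = length X + 2 * i + 1 \<and> h2' = opposite h1' \<and>
      (s1 = length X + 2 * i \<and> s2 = length X + 2 * (i + 1) \<or> s2 = length X + 2 * i \<and> s1 = length X + 2 * (i + 1)))"
  using assms(1)
proof (cases rule: sided_map_cases)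
  case 1: (left_tail t)
  from assms(2) show ?thesis
  proof (cases rule: sided_map_cases)
    case 2: (left_tail t')
    then have "t' = t" using 1(1,2) by linarith
    then show ?thesis using 1 2 by simp
  qed (use 1(1-3) k in linarith)+
next
  case 1: (right i)
  from assms(2) show ?thesis
  proof (cases rule: sided_map_cases)
    case 2: (right j)
    then have "j = i" using 1(2) by linarith
    then show ?thesis using 1 2 by simp
  next
    case 2: (left j)
    then have "j = i" using 1(2) by linarith
    then show ?thesis using 1 2 by (intro disjI2 exI[of _ i]) (simp add: opposite_def)
  qed (use 1(1-3) k in linarith)+
next
  case 1: (left i)
  from assms(2) show ?thesis
  proof (cases rule: sided_map_cases)
    case 2: (right j)
    then have "j = i" using 1(2) by linarith
    then show ?thesis using 1 2 by (intro disjI2 exI[of _ i]) (simp add: opposite_def)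
  next
    case 2: (left j)
    then have "j = i" using 1(2) by linarith
    then show ?thesis using 1 2 by simp
  qed (use 1(1-3) k in linarith)+
next
  case 1: (right_tail t)
  from assms(2) show ?thesis
  proof (cases rule: sided_map_cases)
    case 2: (right_tail t')
    then have "t' = t" using 1(1,2) k by linarith
    then show ?thesis using 1 2 by simp
  qed (use 1(1-3) k in linarith)+
qed

sublocale basis_diagram Q R V L deg
proof
  fix y x y' assume "covers y x" "covers y' x"
  then obtain h1 l1 h1' h2 l2 h2' where
    1: "sided_map (fst y) (fst x) h1 l1 h1'" "snd x = (fst h1, l1 @ snd (snd y))"
     "ray h1' (snd (snd y))" "fst (snd y) = fst h1'" and
    2: "sided_map (fst y') (fst x) h2 l2 h2'" "snd x = (fst h2, l2 @ snd (snd y'))"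
     "ray h2' (snd (snd y'))" "fst (snd y') = fst h2'"
    unfolding covers_iff by blast
  note r1 = sided_map_ray[OF 1(1)] and r2 = sided_map_ray[OF 2(1)]
  have "ray h1 (snd (snd x))" "snd (snd x) \<noteq> []" unfolding 1(2) using 1(3) r1 by simp_all
  moreover have "ray h2 (snd (snd x))" unfolding 2(2) using 2(3) r2 by simp
  ultimately have "h1 = h2" using ray_start by blast
  then have "fst y = fst y' \<and> l1 = l2 \<and> h1' = h2'" using incoming_unique 1(1) 2(1) by blast
  moreover from this have "snd (snd y) = snd (snd y')" using 1(2) 2(2) by simp
  ultimately show "y = y'" using 1(4) 2(4) by (simp add: prod_eq_iff)
qed

subsection \<open>The action of paths on the peaks\<close>

lemma peak_bound: "i < k \<Longrightarrow> pk i \<le> length w"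
  using order[of i] dp_bound[of "i + 1"] by simp

lemma valley_ends_right:
  assumes "i < k" "dp (i + 1) < length w"
  shows "i + 1 < k \<and> \<not> snd (w ! dp (i + 1))"
proof -
  have "i + 1 \<noteq> k" using assms dp_k by auto
  then have "i + 1 < k" using assms by simp
  then show ?thesis using inverse_part[of "i + 1" "dp (i + 1)"] strict_left[of "i + 1"] by simp
qed

lemma valley_ends_left: "i < k \<Longrightarrow> 0 < dp i \<Longrightarrow> 0 < i \<and> snd (w ! (dp i - 1))"
proof -
  assume i: "i < k" "0 < dp i"
  then obtain j where j: "i = Suc j" using dp_0 by (cases i) auto
  then show ?thesis using direct_part[of j "dp i - 1"] strict_right[of j] i by simp
qed

lemma path_act_at_peak:
  assumes "i < k" "fst p = \<kappa> (pk i)"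
  shows "path_act p (basis_vec (pk i)) = fold arrow_act (snd p) (basis_vec (pk i) :: nat \<Rightarrow> 'k::field)"
proof -
  have "at_vertex (fst p) (basis_vec (pk i)) = (basis_vec (pk i) :: nat \<Rightarrow> 'k)"
    using assms peak_bound[of i] by (auto simp: at_vertex_def basis_vec_def)
  then show ?thesis by (simp add: path_act_eq)
qed

text \<open>A nonzero path starting at the vertex of a peak follows the string in one of the two directions. If
  it goes on after the next valley then it acts as zero.\<close>

lemma peak_path_cases:
  assumes i: "i < k" and p: "p \<in> NP" "fst p = \<kappa> (pk i)"
  obtains (on_string) t where "dp i \<le> t" "t \<le> dp (i + 1)" "p = string_path (pk i) t"
      "path_act p (basis_vec (pk i)) = (basis_vec t :: nat \<Rightarrow> 'k::field)"
  | (beyond_right) m where "m \<noteq> []" "snd p = arrows_between (pk i) (dp (i + 1)) @ m"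
      "ray (\<kappa> (dp (i + 1)), \<not> d (dp (i + 1))) m" "path_act p (basis_vec (pk i)) = (\<lambda>_. 0 :: 'k)"
  | (beyond_left) m where "m \<noteq> []" "snd p = rev (arrows_between (dp i) (pk i)) @ m"
      "ray (\<kappa> (dp i), d (dp i)) m" "path_act p (basis_vec (pk i)) = (\<lambda>_. 0 :: 'k)"
proof -
  obtain e where e: "ray (\<kappa> (pk i), e) (snd p)"
    using p nonzero_path_iff_ray[of "fst p" "snd p"] by (metis prod.collapse)
  note act = path_act_at_peak[OF i p(2), where ?'k = 'k]
  consider "e = (\<not> d (pk i))" | "e = d (pk i)" by blast
  then show thesis
  proof cases
    case 1
    have "(\<exists>t\<ge>pk i. t \<le> dp (i + 1) \<and> snd p = arrows_between (pk i) t \<and>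
        fold arrow_act (snd p) (basis_vec (pk i)) = (basis_vec t :: nat \<Rightarrow> 'k)) \<or>
      (\<exists>m. m \<noteq> [] \<and> snd p = arrows_between (pk i) (dp (i + 1)) @ m \<and> ray (\<kappa> (dp (i + 1)), \<not> d (dp (i + 1))) m \<and>
        fold arrow_act (snd p) (basis_vec (pk i)) = (\<lambda>_. 0 :: 'k))"
      by (rule right_ray_cases)
        (use order[OF i] dp_bound[of "i + 1"] i direct_part[OF i] valley_ends_right[OF i] e 1 in auto)
    then show thesis
    proof (elim disjE exE conjE)
      fix t assume t: "pk i \<le> t" "t \<le> dp (i + 1)" "snd p = arrows_between (pk i) t"
        "fold arrow_act (snd p) (basis_vec (pk i)) = (basis_vec t :: nat \<Rightarrow> 'k)"
      have "p = string_path (pk i) t" using t p(2) by (simp add: string_path_def prod_eq_iff)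
      then show thesis using on_string[of t] t act order[OF i] by simp
    next
      fix m assume "m \<noteq> []" "snd p = arrows_between (pk i) (dp (i + 1)) @ m"
        "ray (\<kappa> (dp (i + 1)), \<not> d (dp (i + 1))) m" "fold arrow_act (snd p) (basis_vec (pk i)) = (\<lambda>_. 0 :: 'k)"
      then show thesis using beyond_right[of m] act by simp
    qed
  next
    case 2
    have "(\<exists>t\<le>pk i. dp i \<le> t \<and> snd p = rev (arrows_between t (pk i)) \<and>
        fold arrow_act (snd p) (basis_vec (pk i)) = (basis_vec t :: nat \<Rightarrow> 'k)) \<or>
      (\<exists>m. m \<noteq> [] \<and> snd p = rev (arrows_between (dp i) (pk i)) @ m \<and> ray (\<kappa> (dp i), d (dp i)) m \<and>
        fold arrow_act (snd p) (basis_vec (pk i)) = (\<lambda>_. 0 :: 'k))"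
      by (rule left_ray_cases)
        (use order[OF i] peak_bound[OF i] inverse_part[OF i] valley_ends_left[OF i] e 2 in auto)
    then show thesis
    proof (elim disjE exE conjE)
      fix t assume t: "t \<le> pk i" "dp i \<le> t" "snd p = rev (arrows_between t (pk i))"
        "fold arrow_act (snd p) (basis_vec (pk i)) = (basis_vec t :: nat \<Rightarrow> 'k)"
      have "p = string_path (pk i) t" using t p(2) string_path_left[of i t] by (simp add: prod_eq_iff) (simp add: string_path_def)
      then show thesis using on_string[of t] t act order[OF i] by simp
    next
      fix m assume "m \<noteq> []" "snd p = rev (arrows_between (dp i) (pk i)) @ m"
        "ray (\<kappa> (dp i), d (dp i)) m" "fold arrow_act (snd p) (basis_vec (pk i)) = (\<lambda>_. 0 :: 'k)"
      then show thesis using beyond_left[of m] act by simp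
    qed
  qed
qed

lemma string_path_ray:
  assumes "i < k" "dp i \<le> j" "j \<le> dp (i + 1)"
  shows "pk i \<le> j \<Longrightarrow> ray (\<kappa> (pk i), \<not> d (pk i)) (snd (string_path (pk i) j))"
    and "j \<le> pk i \<Longrightarrow> ray (\<kappa> (pk i), d (pk i)) (snd (string_path (pk i) j))"
  using right_part_ray[OF assms(1) _ assms(3)] left_part_ray[OF assms(1,2)] string_path_left[OF assms(2)]
  by (auto simp: string_path_def)

lemma string_path_nonzero:
  assumes "i < k" "dp i \<le> j" "j \<le> dp (i + 1)"
  shows "string_path (pk i) j \<in> NP" "fst (string_path (pk i) j) = \<kappa> (pk i)"
proof -
  show f: "fst (string_path (pk i) j) = \<kappa> (pk i)" by (simp add: string_path_def)
  have "\<exists>e. ray (\<kappa> (pk i), e) (snd (string_path (pk i) j))"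
    using string_path_ray[OF assms] linear by blast
  then show "string_path (pk i) j \<in> NP"
    using nonzero_path_iff_ray[of "fst (string_path (pk i) j)" "snd (string_path (pk i) j)"]
      string_vertices[OF peak_bound[OF assms(1)]] f by (metis prod.collapse)
qed

lemma string_path_act:
  assumes i: "i < k" and j: "dp i \<le> j" "j \<le> dp (i + 1)"
  shows "path_act (string_path (pk i) j) (basis_vec (pk i)) = (basis_vec j :: nat \<Rightarrow> 'k::field)"
proof -
  let ?l = "snd (string_path (pk i) j)"
  note act = path_act_at_peak[OF i string_path_nonzero(2)[OF i j], where ?'k = 'k]
  consider "pk i \<le> j" | "j < pk i" by linarith
  then show ?thesis
  proof cases
    case 1
    have "(\<exists>t\<ge>pk i. t \<le> dp (i + 1) \<and> ?l = arrows_between (pk i) t \<and>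
        fold arrow_act ?l (basis_vec (pk i)) = (basis_vec t :: nat \<Rightarrow> 'k)) \<or>
      (\<exists>m. m \<noteq> [] \<and> ?l = arrows_between (pk i) (dp (i + 1)) @ m \<and> ray (\<kappa> (dp (i + 1)), \<not> d (dp (i + 1))) m \<and>
        fold arrow_act ?l (basis_vec (pk i)) = (\<lambda>_. 0 :: 'k))"
      by (rule right_ray_cases)
        (use order[OF i] dp_bound[of "i + 1"] i direct_part[OF i] valley_ends_right[OF i] string_path_ray(1)[OF i j 1] in auto)
    then show ?thesis
    proof (elim disjE exE conjE)
      fix t assume t: "pk i \<le> t" "?l = arrows_between (pk i) t" "fold arrow_act ?l (basis_vec (pk i)) = (basis_vec t :: nat \<Rightarrow> 'k)"
      have "length ?l = t - pk i" unfolding t(2) by simp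
      then have "t = j" using 1 t(1) by (simp add: length_string_path)
      then show ?thesis using act t by simp
    next
      fix m assume m: "m \<noteq> []" "?l = arrows_between (pk i) (dp (i + 1)) @ m"
      have "length ?l = dp (i + 1) - pk i + length m" unfolding m(2) by simp
      then have "j - pk i = dp (i + 1) - pk i + length m" using 1 by (simp add: length_string_path)
      moreover have "0 < length m" using m(1) by simp
      ultimately show ?thesis using j(2) 1 by linarith
    qed
  next
    case 2
    have "(\<exists>t\<le>pk i. dp i \<le> t \<and> ?l = rev (arrows_between t (pk i)) \<and>
        fold arrow_act ?l (basis_vec (pk i)) = (basis_vec t :: nat \<Rightarrow> 'k)) \<or>
      (\<exists>m. m \<noteq> [] \<and> ?l = rev (arrows_between (dp i) (pk i)) @ m \<and> ray (\<kappa> (dp i), d (dp i)) m \<and>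
        fold arrow_act ?l (basis_vec (pk i)) = (\<lambda>_. 0 :: 'k))"
      by (rule left_ray_cases)
        (use order[OF i] peak_bound[OF i] inverse_part[OF i] valley_ends_left[OF i] string_path_ray(2)[OF i j] 2 in auto)
    then show ?thesis
    proof (elim disjE exE conjE)
      fix t assume t: "t \<le> pk i" "?l = rev (arrows_between t (pk i))" "fold arrow_act ?l (basis_vec (pk i)) = (basis_vec t :: nat \<Rightarrow> 'k)"
      have "length ?l = pk i - t" unfolding t(2) by simp
      then have "t = j" using 2 t(1) by (simp add: length_string_path)
      then show ?thesis using act t by simp
    next
      fix m assume m: "m \<noteq> []" "?l = rev (arrows_between (dp i) (pk i)) @ m"
      have "length ?l = pk i - dp i + length m" unfolding m(2) by simp
      then have "pk i - j = pk i - dp i + length m" using 2 by (simp add: length_string_path)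
      moreover have "0 < length m" using m(1) by simp
      ultimately show ?thesis using j(1) 2 by linarith
    qed
  qed
qed

lemma string_path_inj:
  assumes "i < k" "dp i \<le> j" "j \<le> dp (i + 1)" "dp i \<le> j'" "j' \<le> dp (i + 1)"
    and "string_path (pk i) j = string_path (pk i) j'"
  shows "j = j'"
proof -
  have "(basis_vec j :: nat \<Rightarrow> rat) j = basis_vec j' j"
    using string_path_act[OF assms(1-3), where ?'k = rat] string_path_act[OF assms(1,4,5), where ?'k = rat] assms(6) by simp
  then show ?thesis by (simp add: basis_vec_def split: if_splits)
qed

lemma peak_path_value:
  assumes i: "i < k" and p: "p \<in> NP" "fst p = \<kappa> (pk i)"
  shows "path_act p (basis_vec (pk i)) j =
    (if dp i \<le> j \<and> j \<le> dp (i + 1) \<and> p = string_path (pk i) j then 1 else 0 :: 'k::field)"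
proof (cases "dp i \<le> j \<and> j \<le> dp (i + 1) \<and> p = string_path (pk i) j")
  case True
  then show ?thesis using string_path_act[OF i, of j, where ?'k = 'k] by (simp add: basis_vec_def)
next
  case False
  show ?thesis
  proof (cases rule: peak_path_cases[OF i p, where ?'k = 'k])
    case (1 t)
    then have "t \<noteq> j" using False by blast
    then show ?thesis unfolding 1(4) if_not_P[OF False] by (simp add: basis_vec_def)
  qed (use False in auto)
qed

text \<open>The path to the position \<open>j\<close> of the string from the peak at the node \<open>s\<close>, if there is one.\<close>

definition hit :: "nat \<Rightarrow> nat \<Rightarrow> ('v, 'a) qpath option" where
  "hit s j = (let i = (s - length X) div 2 in
     if dp i \<le> j \<and> j \<le> dp (i + 1) then Some (string_path (pk i) j) else None)"

lemma hit_peak: "hit (length X + 2 * i) j =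
  (if dp i \<le> j \<and> j \<le> dp (i + 1) then Some (string_path (pk i) j) else None)"
  by (simp add: hit_def)

text \<open>The augmentation sends the generators at the peaks to the corresponding basis vectors of the
  string module with alternating signs, since the differential has no signs.\<close>

definition peak_sign :: "nat \<Rightarrow> 'k::field" where
  "peak_sign s = (-1) ^ ((s - length X) div 2)"

definition peak_gen :: "nat \<Rightarrow> nat \<Rightarrow> 'k::field" where
  "peak_gen s = fscale (peak_sign s) (basis_vec (pk ((s - length X) div 2)))"

lemma peak_gen_act:
  assumes i: "i < k" and a: "a \<in> mcarrier (indec_projective (A :: (_, 'k::field) alg) (\<kappa> (pk i)))"
  shows "mact M (peak_gen (length X + 2 * i)) a j =
    peak_sign (length X + 2 * i) * (case hit (length X + 2 * i) j of None \<Rightarrow> 0 | Some p \<Rightarrow> a p)"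
proof -
  let ?c = "peak_sign (length X + 2 * i) :: 'k"
  let ?P = "dp i \<le> j \<and> j \<le> dp (i + 1)"
  have a0: "w \<in> NP \<and> fst w = \<kappa> (pk i)" if "a w \<noteq> 0" for w
    using a that unfolding indec_projective_carrier by blast
  then have "a \<in> acarrier A" unfolding acarrier_iff by blast
  then have "mact M (peak_gen (length X + 2 * i)) a j =
      (\<Sum>p\<in>NP. a p * (?c * path_act p (basis_vec (pk i)) j))"
    unfolding module_act[OF \<open>a \<in> acarrier A\<close>] sum_fun_apply peak_gen_def path_act_scale
    by (simp add: fscale_def)
  also have "\<dots> = (\<Sum>p\<in>NP. if p = string_path (pk i) j then (if ?P then ?c * a p else 0) else 0)"
  proof (rule sum.cong[OF refl])
    fix p assume p: "p \<in> NP"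
    show "a p * (?c * path_act p (basis_vec (pk i)) j) =
      (if p = string_path (pk i) j then (if ?P then ?c * a p else 0) else 0)"
      using a0[of p] peak_path_value[OF i p, of j, where ?'k = 'k] by (cases "a p = 0") auto
  qed
  also have "\<dots> = (if string_path (pk i) j \<in> NP then (if ?P then ?c * a (string_path (pk i) j) else 0) else 0)"
    using finite_paths by simp
  also have "\<dots> = ?c * (case hit (length X + 2 * i) j of None \<Rightarrow> 0 | Some p \<Rightarrow> a p)"
    using string_path_nonzero(1)[OF i, of j] by (simp add: hit_peak)
  finally show ?thesis .
qed

subsection \<open>Exactness\<close>

lemma covers_ray:
  assumes "covers (s', q) (s, p)"
  shows "\<exists>h l h'. sided_map s' s h l h' \<and> ray h (snd p) \<and> snd p \<noteq> [] \<and> ray h' (snd q) \<and>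
    snd p = l @ snd q"
proof -
  obtain h l h' where *: "sided_map s' s h l h'" "p = (fst h, l @ snd q)" "ray h' (snd q)"
    using assms unfolding covers_iff by auto
  then have "ray h (snd p)" "snd p \<noteq> []" "snd p = l @ snd q" using sided_map_ray[OF *(1)] by simp_all
  then show ?thesis using * by blast
qed

lemma covered_byI:
  assumes "sided_map s' s h l h'" "ray h' q" "snd p = l @ q" "fst p = V ! s"
  shows "\<exists>y. covers y (s, p)"
proof -
  have "p = (V ! s, l @ q)" using assms(3,4) by (simp add: prod_eq_iff)
  then show ?thesis using coversI[OF assms(1,2)] by blast
qed

lemma covers_someI:
  assumes "sided_map s' s h l h'" "ray h' (snd p)" "fst p = V ! s'"
  shows "\<exists>x. covers (s', p) x"
proof -
  have "p = (V ! s', snd p)" using assms(3) by (simp add: prod_eq_iff)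
  then show ?thesis using coversI[OF assms(1,2)] by auto
qed

lemma valley_maps:
  assumes "i + 1 < k"
  shows "sided_map (length X + 2 * i + 1) (length X + 2 * i) (\<kappa> (pk i), \<not> d (pk i))
      (arrows_between (pk i) (dp (i + 1))) (\<kappa> (dp (i + 1)), \<not> d (dp (i + 1)))"
    and "sided_map (length X + 2 * i + 1) (length X + 2 * (i + 1)) (\<kappa> (pk (i + 1)), d (pk (i + 1)))
      (rev (arrows_between (dp (i + 1)) (pk (i + 1)))) (\<kappa> (dp (i + 1)), d (dp (i + 1)))"
  using assms unfolding sided_map_def by auto

lemma left_tail_map: "t < length X \<Longrightarrow>
    sided_map (length X - 1 - t) (length X - t) (left_start t) (left_list t) (hh (X ! t))"
  unfolding sided_map_def by blast

lemma right_tail_map: "t < length Y \<Longrightarrow>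
    sided_map (length X + 2 * k - 1 + t) (length X + 2 * k - 2 + t) (right_start t) (right_list t) (hh (Y ! t))"
  unfolding sided_map_def by blast

lemma valley_not_covered:
  assumes "i + 1 < k"
  shows "\<not> covers y (length X + 2 * i + 1, q)"
proof
  assume "covers y (length X + 2 * i + 1, q)"
  then obtain h l h' where "sided_map (fst y) (length X + 2 * i + 1) h l h'" unfolding covers_iff by auto
  then show False
  proof (cases rule: sided_map_cases)
    case (left_tail t)
    then show ?thesis by linarith
  next
    case (right j)
    then show ?thesis by presburger
  next
    case (left j)
    then show ?thesis by presburger
  next
    case (right_tail t)
    then show ?thesis using assms by linarith
  qed
qed

text \<open>At a node of a relation chain, there is one map out of the node, whose path ends at a side \<open>h\<close> of
  the vertex, and at most one into it, whose path starts at the opposite side. A path that starts at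
  the side \<open>h\<close> prolongs the former, and thus covers a basis vector; a path that starts at the
  opposite side begins with the latter, and is covered. Trivial paths count as starting at \<open>h\<close>.\<close>

lemma tail_exact:
  assumes side: "fst h = V ! s" "p \<in> NP" "fst p = V ! s"
    and out: "\<And>x. covers (s, p) x \<Longrightarrow> ray h (snd p)" "ray h (snd p) \<Longrightarrow> \<exists>x. covers (s, p) x"
    and inc: "\<And>y. covers y (s, p) \<Longrightarrow> snd p \<noteq> [] \<and> ray (opposite h) (snd p)"
      "snd p \<noteq> [] \<Longrightarrow> ray (opposite h) (snd p) \<Longrightarrow> \<exists>y. covers y (s, p)"
  shows "(\<exists>y. covers y (s, p)) \<longleftrightarrow> \<not> (\<exists>x. covers (s, p) x)"
proof -
  obtain e where e: "ray (V ! s, e) (snd p)"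
    using nonzero_path_iff_ray[of "fst p" "snd p"] side by (metis prod.collapse)
  have ne: "opposite h \<noteq> h" by (cases h) (auto simp: opposite_def)
  have "(V ! s, e) = h \<or> (V ! s, e) = opposite h" using side(1) by (cases h) (auto simp: opposite_def)
  then have "ray h (snd p) \<or> ray (opposite h) (snd p)" using e by metis
  moreover have "\<not> (ray h (snd p) \<and> ray (opposite h) (snd p))" if "snd p \<noteq> []"
    using ray_start[of h "snd p" "opposite h"] that ne by metis
  ultimately show ?thesis using out inc ray.simps(1) by metis
qed

lemma left_tail_exact:
  assumes t: "t < length X" and w: "p \<in> NP" "fst p = V ! (length X - 1 - t)"
  shows "(\<exists>y. covers y (length X - 1 - t, p)) \<longleftrightarrow> \<not> (\<exists>x. covers (length X - 1 - t, p) x)"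
proof (rule tail_exact[where h = "hh (X ! t)"])
  show "fst (hh (X ! t)) = V ! (length X - 1 - t)" using left_map[OF t] by simp
  show "ray (hh (X ! t)) (snd p)" if c: "covers (length X - 1 - t, p) x" for x
  proof -
    obtain h l h' where h: "sided_map (length X - 1 - t) (fst x) h l h'" "ray h' (snd p)"
      using covers_ray[of "length X - 1 - t" p "fst x" "snd x"] c unfolding prod.collapse by blast
    have "h' = hh (X ! t)" using outgoing_unique[OF h(1) left_tail_map[OF t]] t by auto
    then show ?thesis using h by simp
  qed
  show "\<exists>x. covers (length X - 1 - t, p) x" if "ray (hh (X ! t)) (snd p)"
    using covers_someI[OF left_tail_map[OF t] that] w by simp
  show "snd p \<noteq> [] \<and> ray (opposite (hh (X ! t))) (snd p)" if c: "covers y (length X - 1 - t, p)" for y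
  proof -
    obtain h l h' where h: "sided_map (fst y) (length X - 1 - t) h l h'" "ray h (snd p)" "snd p \<noteq> []"
      using covers_ray[of "fst y" "snd y" "length X - 1 - t" p] c unfolding prod.collapse by blast
    from h(1) have "h = opposite (hh (X ! t))"
    proof (cases rule: sided_map_cases)
      case (left_tail t')
      then have "t' = Suc t" using t by linarith
      then show ?thesis using left_tail chain_heads_left[of "Suc t"] by (simp add: left_start_def)
    qed (use t k in linarith)+
    then show ?thesis using h by simp
  qed
  show "\<exists>y. covers y (length X - 1 - t, p)" if r: "snd p \<noteq> []" "ray (opposite (hh (X ! t))) (snd p)"
  proof -
    obtain a m where am: "snd p = a # m" using r(1) by (cases "snd p") auto
    then have a: "a \<in> arcs Q" "ht a = opposite (hh (X ! t))" "ray (hh a) m" using r(2) by auto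
    have "Suc t < length X"
    proof (rule ccontr)
      assume "\<not> Suc t < length X"
      then have "t = length X - 1" using t by simp
      then show False using relation_chain_end[OF X a(1)] a(2) t by (auto split: if_splits)
    qed
    note t' = this
    have "ht (X ! Suc t) = ht a" "X ! Suc t \<in> arcs Q" using relation_chain_nth[OF X t'] a by auto
    then have "X ! Suc t = a" using a(1) by (intro ht_inj)
    then have "left_list (Suc t) = [a]" "ray (hh (X ! Suc t)) m" using a by (auto simp: left_list_def)
    moreover have "length X - Suc t = length X - 1 - t" by simp
    ultimately show ?thesis
      using covered_byI[OF left_tail_map[OF t'], of m p] w am by simp
  qed
qed (use w in auto)

lemma right_tail_exact:
  assumes t: "t < length Y" and w: "p \<in> NP" "fst p = V ! (length X + 2 * k - 1 + t)"
  shows "(\<exists>y. covers y (length X + 2 * k - 1 + t, p)) \<longleftrightarrow> \<not> (\<exists>x. covers (length X + 2 * k - 1 + t, p) x)"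
proof (rule tail_exact[where h = "hh (Y ! t)"])
  show "fst (hh (Y ! t)) = V ! (length X + 2 * k - 1 + t)" using right_map[OF t] by simp
  show "ray (hh (Y ! t)) (snd p)" if c: "covers (length X + 2 * k - 1 + t, p) x" for x
  proof -
    obtain h l h' where h: "sided_map (length X + 2 * k - 1 + t) (fst x) h l h'" "ray h' (snd p)"
      using covers_ray[of "length X + 2 * k - 1 + t" p "fst x" "snd x"] c unfolding prod.collapse by blast
    have "\<not> (\<exists>i. i + 1 < k \<and> length X + 2 * k - 1 + t = length X + 2 * i + 1)" by presburger
    then have "h' = hh (Y ! t)" using outgoing_unique[OF h(1) right_tail_map[OF t]] by blast
    then show ?thesis using h by simp
  qed
  show "\<exists>x. covers (length X + 2 * k - 1 + t, p) x" if "ray (hh (Y ! t)) (snd p)"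
    using covers_someI[OF right_tail_map[OF t] that] w by simp
  show "snd p \<noteq> [] \<and> ray (opposite (hh (Y ! t))) (snd p)" if c: "covers y (length X + 2 * k - 1 + t, p)" for y
  proof -
    obtain h l h' where h: "sided_map (fst y) (length X + 2 * k - 1 + t) h l h'" "ray h (snd p)" "snd p \<noteq> []"
      using covers_ray[of "fst y" "snd y" "length X + 2 * k - 1 + t" p] c unfolding prod.collapse by blast
    from h(1) have "h = opposite (hh (Y ! t))"
    proof (cases rule: sided_map_cases)
      case (right_tail t')
      then have "t' = Suc t" using k by linarith
      then show ?thesis using right_tail chain_heads_right[of "Suc t"] by (simp add: right_start_def)
    qed (use k in linarith)+
    then show ?thesis using h by simp
  qed
  show "\<exists>y. covers y (length X + 2 * k - 1 + t, p)" if r: "snd p \<noteq> []" "ray (opposite (hh (Y ! t))) (snd p)"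
  proof -
    obtain a m where am: "snd p = a # m" using r(1) by (cases "snd p") auto
    then have a: "a \<in> arcs Q" "ht a = opposite (hh (Y ! t))" "ray (hh a) m" using r(2) by auto
    have "Suc t < length Y"
    proof (rule ccontr)
      assume "\<not> Suc t < length Y"
      then have "t = length Y - 1" using t by simp
      then show False using relation_chain_end[OF Y a(1)] a(2) t by (auto split: if_splits)
    qed
    note t' = this
    have "ht (Y ! Suc t) = ht a" "Y ! Suc t \<in> arcs Q" using relation_chain_nth[OF Y t'] a by auto
    then have "Y ! Suc t = a" using a(1) by (intro ht_inj)
    then have "right_list (Suc t) = [a]" "ray (hh (Y ! Suc t)) m" using a by (auto simp: right_list_def)
    moreover have s: "length X + 2 * k - 2 + Suc t = length X + 2 * k - 1 + t" using k by simp
    ultimately show ?thesis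
      using covered_byI[OF right_tail_map[OF t', unfolded s], of m p] w am by simp
  qed
qed (use w in auto)

lemma exact_at:
  assumes "s < length V" "0 < deg s" and w: "p \<in> NP" "fst p = V ! s"
  shows "(\<exists>y. covers y (s, p)) \<longleftrightarrow> \<not> (\<exists>x. covers (s, p) x)"
  using assms(1)
proof (cases rule: node_cases)
  case (left t)
  then show ?thesis using left_tail_exact[of t p] w by simp
next
  case (right t)
  then show ?thesis using right_tail_exact[of t p] w by simp
next
  case (peak i)
  then show ?thesis using deg_simps(2)[of i] assms(2) by simp
next
  case (valley i)
  obtain e where e: "ray (V ! s, e) (snd p)"
    using nonzero_path_iff_ray[of "fst p" "snd p"] w by (metis prod.collapse)
  have Vs: "V ! s = \<kappa> (dp (i + 1))" using V_valley valley by simp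
  have "\<exists>x. covers (s, p) x"
  proof (cases "e = d (dp (i + 1))")
    case True
    then show ?thesis using covers_someI[OF valley_maps(2)[OF valley(1)], of p] e Vs w valley(2) by simp
  next
    case False
    then have "e = (\<not> d (dp (i + 1)))" by simp
    then show ?thesis using covers_someI[OF valley_maps(1)[OF valley(1)], of p] e Vs w valley(2) by simp
  qed
  then show ?thesis using valley_not_covered[OF valley(1)] valley(2) by blast
qed

text \<open>Two different basis vectors covered by the same one are the paths from two neighbouring peaks to
  the valley between them.\<close>

lemma covers_two_at_valley:
  assumes c: "covers y x" "covers y x'" "x \<noteq> x'"
  obtains i where "i + 1 < k" "deg (fst x) = 0" "deg (fst x') = 0"
    "x = (length X + 2 * i, string_path (pk i) (dp (i + 1))) \<and>
       x' = (length X + 2 * (i + 1), string_path (pk (i + 1)) (dp (i + 1))) \<or>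
     x' = (length X + 2 * i, string_path (pk i) (dp (i + 1))) \<and>
       x = (length X + 2 * (i + 1), string_path (pk (i + 1)) (dp (i + 1)))"
proof -
  obtain h1 l1 h1' where 1: "sided_map (fst y) (fst x) h1 l1 h1'" "snd x = (fst h1, l1 @ snd (snd y))"
    "ray h1' (snd (snd y))" using c(1) unfolding covers_iff by blast
  obtain h2 l2 h2' where 2: "sided_map (fst y) (fst x') h2 l2 h2'" "snd x' = (fst h2, l2 @ snd (snd y))"
    "ray h2' (snd (snd y))" using c(2) unfolding covers_iff by blast
  have "\<not> (fst x = fst x' \<and> h1 = h2 \<and> l1 = l2 \<and> h1' = h2')" using 1 2 c(3) by (auto simp: prod_eq_iff)
  then obtain i where i: "i + 1 < k" "fst y = length X + 2 * i + 1" "h2' = opposite h1'"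
      "fst x = length X + 2 * i \<and> fst x' = length X + 2 * (i + 1) \<or>
       fst x' = length X + 2 * i \<and> fst x = length X + 2 * (i + 1)"
    using outgoing_unique[OF 1(1) 2(1)] by blast
  have "h2' \<noteq> h1'" unfolding i(3) by (cases h1') (auto simp: opposite_def)
  then have nil: "snd (snd y) = []" using ray_start 1(3) 2(3) by metis
  have p1: "(\<kappa> (pk i), arrows_between (pk i) (dp (i + 1))) = string_path (pk i) (dp (i + 1))"
    using order[of i] i(1) by (simp add: string_path_def)
  have p2: "(\<kappa> (pk (i + 1)), rev (arrows_between (dp (i + 1)) (pk (i + 1)))) = string_path (pk (i + 1)) (dp (i + 1))"
    using strict_left[of "i + 1"] i(1) by (simp add: string_path_def)
  have d: "deg (length X + 2 * i) = 0" "deg (length X + 2 * (i + 1)) = 0"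
    using deg_simps(2)[of i] deg_simps(2)[of "i + 1"] i(1) by simp_all
  note m = valley_maps[OF i(1)]
  have q1: "z = (length X + 2 * i, string_path (pk i) (dp (i + 1)))"
    if "sided_map (fst y) (fst z) h l h'" "snd z = (fst h, l @ snd (snd y))" "fst z = length X + 2 * i" for z h l h'
    using sided_map_ends_unique[OF that(1)[unfolded i(2) that(3)] m(1)] that(2,3) nil p1 by (auto simp: prod_eq_iff)
  have q2: "z = (length X + 2 * (i + 1), string_path (pk (i + 1)) (dp (i + 1)))"
    if "sided_map (fst y) (fst z) h l h'" "snd z = (fst h, l @ snd (snd y))" "fst z = length X + 2 * (i + 1)" for z h l h'
    using sided_map_ends_unique[OF that(1)[unfolded i(2) that(3)] m(2)] that(2,3) nil p2 by (auto simp: prod_eq_iff)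
  from i(4) show thesis
  proof (elim disjE conjE)
    assume *: "fst x = length X + 2 * i" "fst x' = length X + 2 * (i + 1)"
    show thesis using that[of i] i(1) d q1[OF 1(1,2) *(1)] q2[OF 2(1,2) *(2)] by auto
  next
    assume *: "fst x' = length X + 2 * i" "fst x = length X + 2 * (i + 1)"
    show thesis using that[of i] i(1) d q2[OF 1(1,2) *(2)] q1[OF 2(1,2) *(1)] by auto
  qed
qed

lemma valley_covers:
  assumes "i + 1 < k"
  shows "covers (length X + 2 * i + 1, (\<kappa> (dp (i + 1)), [])) (length X + 2 * i, string_path (pk i) (dp (i + 1)))"
    and "covers (length X + 2 * i + 1, (\<kappa> (dp (i + 1)), [])) (length X + 2 * (i + 1), string_path (pk (i + 1)) (dp (i + 1)))"
proof -
  have p1: "(\<kappa> (pk i), arrows_between (pk i) (dp (i + 1))) = string_path (pk i) (dp (i + 1))"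
    using order[of i] assms by (simp add: string_path_def)
  have p2: "(\<kappa> (pk (i + 1)), rev (arrows_between (dp (i + 1)) (pk (i + 1)))) = string_path (pk (i + 1)) (dp (i + 1))"
    using strict_left[of "i + 1"] assms by (simp add: string_path_def)
  show "covers (length X + 2 * i + 1, (\<kappa> (dp (i + 1)), [])) (length X + 2 * i, string_path (pk i) (dp (i + 1)))"
    using coversI[OF valley_maps(1)[OF assms], of "[]"] V_peak[of i] V_valley[OF assms] p1 assms by simp
  show "covers (length X + 2 * i + 1, (\<kappa> (dp (i + 1)), [])) (length X + 2 * (i + 1), string_path (pk (i + 1)) (dp (i + 1)))"
    using coversI[OF valley_maps(2)[OF assms], of "[]"] V_peak[of "i + 1"] V_valley[OF assms] p2 assms by simp
qed

text \<open>The path from a peak to a position of the string other than an inner valley is too short to be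
  covered.\<close>

lemma string_path_not_covered:
  assumes i: "i < k" and j: "dp i \<le> j" "j \<le> dp (i + 1)"
    and inner: "i + 1 < k \<Longrightarrow> j < dp (i + 1)" "0 < i \<Longrightarrow> dp i < j"
  shows "\<not> covers y (length X + 2 * i, string_path (pk i) j)"
proof
  assume "covers y (length X + 2 * i, string_path (pk i) j)"
  then obtain h l h' where h: "sided_map (fst y) (length X + 2 * i) h l h'" "ray h (snd (string_path (pk i) j))"
      "snd (string_path (pk i) j) \<noteq> []" "snd (string_path (pk i) j) = l @ snd (snd y)"
    using covers_ray[of "fst y" "snd y" "length X + 2 * i" "string_path (pk i) j"] unfolding prod.collapse by blast
  have len: "length l \<le> (if pk i \<le> j then j - pk i else pk i - j)"
    using length_string_path[of "pk i" j] h(4) by simp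
  have "pk i \<noteq> j" using h(3) length_string_path[of "pk i" j] by auto
  have R: "h = (\<kappa> (pk i), \<not> d (pk i))" if "pk i < j"
    using string_path_ray(1)[OF i j] that ray_start h(2,3) by auto
  have L: "h = (\<kappa> (pk i), d (pk i))" if "j < pk i"
    using string_path_ray(2)[OF i j] that ray_start h(2,3) by auto
  from h(1) show False
  proof (cases rule: sided_map_cases)
    case (left_tail t)
    then have "t = 0" "i = 0" by linarith+
    then have "\<not> pk i < j" "length l = Suc (pk 0)"
      using R left_tail by (auto simp: left_start_def left_list_def)
    then show False using len \<open>i = 0\<close> by (simp split: if_splits)
  next
    case (right i')
    then have "i' = i" by linarith
    then have "\<not> j < pk i" "length l = dp (i + 1) - pk i" using L right by auto
    then show False using len inner(1) right(1) \<open>i' = i\<close> \<open>pk i \<noteq> j\<close> by (simp split: if_splits)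
  next
    case (left i')
    then have ii: "i = i' + 1" by linarith
    have "\<not> pk i < j" using R left(4) unfolding ii by auto
    moreover have "length l = pk i - dp i" using left(5) unfolding ii by simp
    ultimately show False using len inner(2) ii \<open>pk i \<noteq> j\<close> by (simp split: if_splits)
  next
    case (right_tail t)
    then have "t = 0" "i = k - 1" using i by linarith+
    then have "\<not> j < pk i" "length l = Suc (length w - pk i)"
      using L right_tail by (auto simp: right_start_def right_list_def)
    then show False using len j dp_bound[of "i + 1"] i \<open>pk i \<noteq> j\<close> by (simp split: if_splits)
  qed
qed

text \<open>A path from a peak that leaves the string is covered, from the next valley or from the first node
  of a relation chain.\<close>

lemma uncovered_on_string:
  assumes i: "i < k" and p: "p \<in> NP" "fst p = \<kappa> (pk i)" and u: "\<not> (\<exists>y. covers y (length X + 2 * i, p))"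
  shows "\<exists>j. dp i \<le> j \<and> j \<le> dp (i + 1) \<and> p = string_path (pk i) j"
proof (cases rule: peak_path_cases[OF i p, where ?'k = rat])
  case (1 t)
  then show ?thesis by blast
next
  case (2 m)
  have "\<exists>y. covers y (length X + 2 * i, p)"
  proof (cases "i + 1 < k")
    case True
    then show ?thesis
      using covered_byI[OF valley_maps(1)[OF True] 2(3,2)] V_peak[OF i] p by simp
  next
    case False
    then have ik: "i = k - 1" "i + 1 = k" using i by simp_all
    obtain a m' where m: "m = a # m'" using 2(1) by (cases m) auto
    then have a: "a \<in> arcs Q" "ht a = (\<kappa> (length w), \<not> d (length w))" "ray (hh a) m'" using 2(3) dp_k ik by auto
    then have Y0: "Y \<noteq> []" using relation_chain_end[OF Y a(1)] by auto
    then have "Y ! 0 \<in> arcs Q" "ht (Y ! 0) = ht a" using relation_chain_nth[OF Y, of 0] a by auto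
    then have "Y ! 0 = a" using a(1) by (intro ht_inj)
    then have l: "snd p = right_list 0 @ m'" using 2(2) m ik dp_k by (simp add: right_list_def)
    have s: "length X + 2 * k - 2 + 0 = length X + 2 * i" using ik by simp
    have "ray (hh (Y ! 0)) m'" using a \<open>Y ! 0 = a\<close> by simp
    from covered_byI[OF right_tail_map[of 0] this l] show ?thesis
      using Y0 V_peak[OF i] p unfolding s by simp
  qed
  then show ?thesis using u by blast
next
  case (3 m)
  have "\<exists>y. covers y (length X + 2 * i, p)"
  proof (cases i)
    case (Suc i')
    then have i': "i' + 1 < k" "i = i' + 1" using i by auto
    show ?thesis
      using covered_byI[OF valley_maps(2)[OF i'(1)], of m p] 3(2,3) V_peak[OF i] p unfolding i'(2) by simp
  next
    case 0
    obtain a m' where m: "m = a # m'" using 3(1) by (cases m) auto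
    then have a: "a \<in> arcs Q" "ht a = (\<kappa> 0, d 0)" "ray (hh a) m'" using 3(3) dp_0 0 by auto
    then have X0: "X \<noteq> []" using relation_chain_end[OF X a(1)] by auto
    then have "X ! 0 \<in> arcs Q" "ht (X ! 0) = ht a" using relation_chain_nth[OF X, of 0] a by auto
    then have "X ! 0 = a" using a(1) by (intro ht_inj)
    then have l: "snd p = left_list 0 @ m'" using 3(2) m 0 dp_0 by (simp add: left_list_def)
    have s: "length X - 0 = length X + 2 * i" using 0 by simp
    have "ray (hh (X ! 0)) m'" using a \<open>X ! 0 = a\<close> by simp
    from covered_byI[OF left_tail_map[of 0] this l] show ?thesis
      using X0 V_peak[OF i] p unfolding s by simp
  qed
  then show ?thesis using u by blast
qed

lemma hit_valley:
  assumes "i + 1 < k"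
  shows "hit (length X + 2 * i) (dp (i + 1)) = Some (string_path (pk i) (dp (i + 1)))"
    "hit (length X + 2 * (i + 1)) (dp (i + 1)) = Some (string_path (pk (i + 1)) (dp (i + 1)))"
  using order[of i] order[of "i + 1"] assms hit_peak[of i "dp (i + 1)"] hit_peak[of "i + 1" "dp (i + 1)"] by simp_all

lemma dp_strict:
  assumes "i + 1 < k"
  shows "dp i < dp (i + 1)" "dp (i + 1) < dp (i + 2)"
  using order[of i] strict_right[of i] strict_left[of "i + 1"] order[of "i + 1"] assms by simp_all

lemma position_in_interval: "j \<le> length w \<Longrightarrow> \<exists>i<k. dp i \<le> j \<and> j \<le> dp (i + 1)"
proof -
  assume j: "j \<le> length w"
  define i where "i = (LEAST i. j \<le> dp (i + 1))"
  have "j \<le> dp (k - 1 + 1)" using j dp_k k by simp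
  then have i: "j \<le> dp (i + 1)" "i \<le> k - 1" unfolding i_def by (rule LeastI, rule Least_le)
  have "dp i \<le> j"
  proof (cases i)
    case (Suc i')
    then have "\<not> j \<le> dp (i' + 1)" using not_less_Least[of i' "\<lambda>i. j \<le> dp (i + 1)"] unfolding i_def by simp
    then show ?thesis using Suc by simp
  qed (simp add: dp_0)
  then show ?thesis using i k by (intro exI[of _ i]) simp
qed

text \<open>Each position belongs to one peak only, except for the inner valleys.\<close>

lemma position_fibre:
  assumes "j \<le> length w"
  obtains (single) i where "i < k" "dp i \<le> j" "j \<le> dp (i + 1)" "i + 1 < k \<Longrightarrow> j < dp (i + 1)" "0 < i \<Longrightarrow> dp i < j"
      "\<And>i'. i' < k \<Longrightarrow> i' \<noteq> i \<Longrightarrow> \<not> (dp i' \<le> j \<and> j \<le> dp (i' + 1))"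
  | (double) i where "i + 1 < k" "j = dp (i + 1)"
      "\<And>i'. i' < k \<Longrightarrow> i' \<noteq> i \<Longrightarrow> i' \<noteq> i + 1 \<Longrightarrow> \<not> (dp i' \<le> j \<and> j \<le> dp (i' + 1))"
proof (cases "\<exists>i. i + 1 < k \<and> j = dp (i + 1)")
  case True
  then obtain i where i: "i + 1 < k" "j = dp (i + 1)" by blast
  have "\<not> (dp i' \<le> j \<and> j \<le> dp (i' + 1))" if i': "i' < k" "i' \<noteq> i" "i' \<noteq> i + 1" for i'
  proof (cases "i' < i")
    case True
    then have "dp (i' + 1) \<le> dp i" using dp_le[of "i' + 1" i] i by simp
    then show ?thesis using dp_strict(1)[OF i(1)] i(2) by simp
  next
    case False
    then have "dp (i + 2) \<le> dp i'" using dp_le[of "i + 2" i'] i' by simp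
    then show ?thesis using dp_strict(2)[OF i(1)] i(2) by simp
  qed
  then show thesis using double[of i] i by blast
next
  case False
  obtain i where i: "i < k" "dp i \<le> j" "j \<le> dp (i + 1)" using position_in_interval[OF assms] by blast
  have r: "j < dp (i + 1)" if "i + 1 < k" using False that i(3) by (metis le_neq_implies_less)
  have l: "dp i < j" if "0 < i"
    using False[simplified, rule_format, of "i - 1"] that i by (cases i) (auto simp: le_neq_implies_less)
  have "\<not> (dp i' \<le> j \<and> j \<le> dp (i' + 1))" if i': "i' < k" "i' \<noteq> i" for i'
  proof (cases "i' < i")
    case True
    then have "dp (i' + 1) \<le> dp i" using dp_le[of "i' + 1" i] i by simp
    then show ?thesis using l True by simp
  next
    case False
    then have "dp (i + 1) \<le> dp i'" "i + 1 < k" using dp_le[of "i + 1" i'] i' by simp_all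
    then show ?thesis using r by simp
  qed
  then show thesis using single[of i] i r l by blast
qed

lemma string_module_resolved: "resolved_by (A :: (_, 'k::field) alg) M V L"
proof -
  have peak: "\<exists>i<k. s = length X + 2 * i" if "s < length V" "deg s = 0" for s
    using that deg_0_iff by blast
  have node: "length X + 2 * i < length V" "deg (length X + 2 * i) = 0" if "i < k" for i
    using that deg_0_iff by blast+
  have sign_Suc: "(peak_sign (length X + 2 * (i + 1)) :: 'k) = - peak_sign (length X + 2 * i)" for i
    by (simp add: peak_sign_def)
  interpret resolving_diagram Q R V L deg M "length w" peak_gen "peak_sign :: nat \<Rightarrow> 'k" hit
  proof
    fix s w' assume "s < length V" "0 < deg s" "w' \<in> NP" "fst w' = V ! s"
    then show "(\<exists>y. covers y (s, w')) \<longleftrightarrow> \<not> (\<exists>x. covers (s, w') x)" by (rule exact_at)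
  next
    fix y x x' assume c: "covers y x" "covers y x'" "0 < deg (fst x)"
    show "x = x'"
    proof (rule ccontr)
      assume "x \<noteq> x'"
      then show False using covers_two_at_valley[OF c(1,2)] c(3) by (metis less_irrefl)
    qed
  next
    show "fd_module A M" by (rule string_module_fd)
    show "mcarrier M = {f. \<forall>j>length w. f j = (0 :: 'k)}" by (simp add: string_module_def)
  next
    fix s assume "s < length V" "deg s = 0"
    then obtain i where i: "i < k" "s = length X + 2 * i" using peak by blast
    show "(peak_gen s :: nat \<Rightarrow> 'k) \<in> mcarrier M"
      using peak_bound[OF i(1)] by (auto simp: i string_module_def peak_gen_def fscale_def basis_vec_def)
    fix a j assume "a \<in> mcarrier (indec_projective (A :: (_, 'k) alg) (V ! s))"
    then show "mact M (peak_gen s) a j = peak_sign s * (case hit s j of None \<Rightarrow> 0 | Some p \<Rightarrow> a p)"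
      using peak_gen_act[OF i(1)] V_peak[OF i(1)] i(2) by simp
  next
    show "peak_sign s * peak_sign s = (1 :: 'k)" for s
      by (simp add: peak_sign_def power_mult_distrib[symmetric])
  next
    fix s j p assume *: "s < length V" "deg s = 0" "hit s j = Some p"
    then obtain i where i: "i < k" "s = length X + 2 * i" using peak by blast
    then have p: "dp i \<le> j" "j \<le> dp (i + 1)" "p = string_path (pk i) j" using *(3) by (auto simp: hit_peak split: if_splits)
    then show "j \<le> length w \<and> p \<in> NP \<and> fst p = V ! s"
      using string_path_nonzero[OF i(1) p(1,2)] V_peak[OF i(1)] i dp_bound[of "i + 1"] by simp
    fix j' assume "hit s j' = Some p"
    then have p': "dp i \<le> j'" "j' \<le> dp (i + 1)" "p = string_path (pk i) j'" using i by (auto simp: hit_peak split: if_splits)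
    show "j = j'" using string_path_inj[OF i(1) p(1,2) p'(1,2)] p(3) p'(3) by simp
  next
    fix j assume "j \<le> length w"
    then show "(\<exists>s p. s < length V \<and> deg s = 0 \<and> hit s j = Some p \<and> \<not> (\<exists>y. covers y (s, p)) \<and>
         (\<forall>t<length V. deg t = 0 \<longrightarrow> t \<noteq> s \<longrightarrow> hit t j = None)) \<or>
      (\<exists>s p t q y. s < length V \<and> deg s = 0 \<and> t < length V \<and> deg t = 0 \<and> s \<noteq> t \<and>
         hit s j = Some p \<and> hit t j = Some q \<and> peak_sign t = - (peak_sign s :: 'k) \<and> covers y (s, p) \<and> covers y (t, q) \<and>
         (\<forall>t'<length V. deg t' = 0 \<longrightarrow> t' \<noteq> s \<longrightarrow> t' \<noteq> t \<longrightarrow> hit t' j = None))"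
    proof (cases rule: position_fibre)
      case (single i)
      have "hit t j = None" if t: "t < length V" "deg t = 0" "t \<noteq> length X + 2 * i" for t
      proof -
        obtain i' where "i' < k" "t = length X + 2 * i'" using peak t by blast
        then show ?thesis using single(6)[of i'] t(3) by (auto simp: hit_peak)
      qed
      moreover have "\<not> (\<exists>y. covers y (length X + 2 * i, string_path (pk i) j))"
        using string_path_not_covered[OF single(1-5)] by blast
      ultimately show ?thesis using node[OF single(1)] single(2,3)
        by (intro disjI1 exI[of _ "length X + 2 * i"] exI[of _ "string_path (pk i) j"]) (auto simp: hit_peak)
    next
      case (double i)
      have "hit t j = None" if t: "t < length V" "deg t = 0" "t \<noteq> length X + 2 * i" "t \<noteq> length X + 2 * (i + 1)" for t
      proof -
        obtain i' where "i' < k" "t = length X + 2 * i'" using peak t by blast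
        then show ?thesis using double(3)[of i'] t(3,4) by (auto simp: hit_peak)
      qed
      then have none: "\<forall>t'<length V. deg t' = 0 \<longrightarrow> t' \<noteq> length X + 2 * i \<longrightarrow> t' \<noteq> length X + 2 * (i + 1) \<longrightarrow> hit t' j = None"
        by blast
      have "i < k" using double(1) by simp
      note facts = node[OF \<open>i < k\<close>] node[OF double(1)] hit_valley[OF double(1)] valley_covers[OF double(1)]
        sign_Suc[of i] none[unfolded double(2)]
      have "length X + 2 * i \<noteq> length X + 2 * (i + 1)" by simp
      then show ?thesis unfolding double(2) using facts by blast
    qed
  next
    fix s p assume *: "s < length V" "deg s = 0" "p \<in> NP" "fst p = V ! s" "\<not> (\<exists>y. covers y (s, p))"
    then obtain i where i: "i < k" "s = length X + 2 * i" using peak by blast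
    then show "\<exists>j. hit s j = Some p"
      using uncovered_on_string[OF i(1) *(3)] *(4,5) V_peak[OF i(1)] by (auto simp: hit_peak)
  next
    fix y s p t q assume c: "covers y (s, p)" "covers y (t, q)" "(s, p) \<noteq> (t, q)" "deg s = 0"
    from c(1-3) show "\<exists>j. hit s j = Some p \<and> hit t j = Some q"
    proof (cases rule: covers_two_at_valley)
      case (1 i)
      then show ?thesis using hit_valley[OF 1(1)] by blast
    qed
  qed
  show ?thesis by (rule resolved)
qed

end

section \<open>Strings given by their maximal direct and inverse parts\<close>

context gentle_string begin

text \<open>The string \<open>w\<close> is divided into \<open>2 k\<close> words, alternately inverse and direct; only the first and
  the last one may be empty. The words with even number are the inverse ones. The diagram consists
  of the vertices between consecutive words and of two relation chains, which are joined to it by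
  the links along \<open>u\<close> and \<open>v\<close> prolonged by an arrow.\<close>

definition chain_diagram_nodes :: "'a list \<Rightarrow> 'a letter list list \<Rightarrow> 'a list \<Rightarrow> 'v list" where
  "chain_diagram_nodes X \<tau> Y = map (head Q) (rev X) @
     map (\<lambda>j. \<kappa> (length (concat (take (Suc j) \<tau>)))) [0..<length \<tau> - 1] @ map (head Q) Y"

definition chain_diagram_links ::
    "('v, 'a) qpath \<Rightarrow> 'a list \<Rightarrow> 'a letter list list \<Rightarrow> 'a list \<Rightarrow> ('v, 'a) qpath \<Rightarrow> ('v, 'a) qpath link list" where
  "chain_diagram_links u X \<tau> Y v =
     (if X = [] then []
      else map (\<lambda>a. Rightwards (tail Q a, [a])) (rev (tl X)) @ [Rightwards (fst u, snd u @ [hd X])]) @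
     map (\<lambda>j. word_link Q (\<tau> ! j)) [1..<length \<tau> - 1] @
     (if Y = [] then []
      else Leftwards (fst v, snd v @ [hd Y]) # map (\<lambda>a. Leftwards (tail Q a, [a])) (tl Y))"

text \<open>Here \<open>u\<close> and \<open>v\<close> are the paths along the first and the last word, from the outermost peaks to the ends of
  the string.\<close>

lemma chain_diagram_resolved:
  fixes \<tau> :: "'a letter list list"
  assumes k: "length \<tau> = 2 * k" "1 \<le> k"
    and inv: "\<And>i l. i < k \<Longrightarrow> l \<in> set (\<tau> ! (2 * i)) \<Longrightarrow> \<not> snd l"
    and dir: "\<And>i l. i < k \<Longrightarrow> l \<in> set (\<tau> ! (2 * i + 1)) \<Longrightarrow> snd l"
    and ne: "\<And>j. 0 < j \<Longrightarrow> j < 2 * k - 1 \<Longrightarrow> \<tau> ! j \<noteq> []"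
    and w: "concat \<tau> = w"
    and X: "relation_chain (\<kappa> 0, d 0) X"
    and Y: "relation_chain (\<kappa> (length w), \<not> d (length w)) Y"
    and u: "u = (\<kappa> (length (\<tau> ! 0)), rev (map fst (\<tau> ! 0)))"
    and v: "v = (\<kappa> (length w - length (\<tau> ! (2 * k - 1))), map fst (\<tau> ! (2 * k - 1)))"
  shows "resolved_by (A :: (_, 'k::field) alg) M (chain_diagram_nodes X \<tau> Y) (chain_diagram_links u X \<tau> Y v)"
proof -
  define B where "B j = length (concat (take j \<tau>))" for j
  have B_0: "B 0 = 0" by (simp add: B_def)
  have B_Suc: "B (Suc j) = B j + length (\<tau> ! j)" if "j < 2 * k" for j
    using that k(1) by (simp add: B_def take_Suc_conv_app_nth)
  have B_end: "B (2 * k) = length w" using w k(1) by (simp add: B_def)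
  have letter: "w ! (B j + t) = \<tau> ! j ! t" if "j < 2 * k" "t < length (\<tau> ! j)" for j t
  proof -
    have "w = concat (take j \<tau>) @ \<tau> ! j @ concat (drop (Suc j) \<tau>)"
      using id_take_nth_drop[of j \<tau>] that k(1) w by (metis concat.simps(2) concat_append)
    then show ?thesis using that by (simp add: B_def nth_append)
  qed
  \<comment> \<open>Peaks are where a direct word follows an inverse one.\<close>
  define pk where "pk i = B (2 * i + 1)" for i
  define dp where "dp i = B (2 * i)" for i
  have pk: "pk i = dp i + length (\<tau> ! (2 * i))" if "i < k" for i
    using B_Suc[of "2 * i"] that by (simp add: pk_def dp_def)
  have dp: "dp (i + 1) = pk i + length (\<tau> ! (2 * i + 1))" if "i < k" for i
    using B_Suc[of "2 * i + 1"] that by (simp add: pk_def dp_def)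
  have left_path: "string_path (pk i) (dp i) = (\<kappa> (pk i), rev (map fst (\<tau> ! (2 * i))))" if i: "i < k" for i
  proof -
    have "arrows_between (dp i) (pk i) = map fst (\<tau> ! (2 * i))"
    proof (rule nth_equalityI)
      show "length (arrows_between (dp i) (pk i)) = length (map fst (\<tau> ! (2 * i)))" using pk[OF i] by simp
      fix t assume "t < length (arrows_between (dp i) (pk i))"
      then show "arrows_between (dp i) (pk i) ! t = map fst (\<tau> ! (2 * i)) ! t"
        using letter[of "2 * i" t] i pk[OF i] by (simp add: dp_def)
    qed
    then show ?thesis using pk[OF i] by (auto simp: string_path_def)
  qed
  have right_path: "string_path (pk i) (dp (i + 1)) = (\<kappa> (pk i), map fst (\<tau> ! (2 * i + 1)))" if i: "i < k" for i
  proof -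
    have "arrows_between (pk i) (dp (i + 1)) = map fst (\<tau> ! (2 * i + 1))"
    proof (rule nth_equalityI)
      show "length (arrows_between (pk i) (dp (i + 1))) = length (map fst (\<tau> ! (2 * i + 1)))" using dp[OF i] by simp
      fix t assume "t < length (arrows_between (pk i) (dp (i + 1)))"
      then show "arrows_between (pk i) (dp (i + 1)) ! t = map fst (\<tau> ! (2 * i + 1)) ! t"
        using letter[of "2 * i + 1" t] i dp[OF i] by (simp add: pk_def)
    qed
    then show ?thesis using dp[OF i] by (auto simp: string_path_def)
  qed
  have inv_t: "\<not> snd (w ! t)" if "i < k" "dp i \<le> t" "t < pk i" for i t
  proof -
    have "t - dp i < length (\<tau> ! (2 * i))" using that pk[OF that(1)] by simp
    then show ?thesis using letter[of "2 * i" "t - dp i"] inv[OF that(1)] that by (simp add: dp_def nth_mem)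
  qed
  have dir_t: "snd (w ! t)" if "i < k" "pk i \<le> t" "t < dp (i + 1)" for i t
  proof -
    have "t - pk i < length (\<tau> ! (2 * i + 1))" using that dp[OF that(1)] by simp
    then show ?thesis using letter[of "2 * i + 1" "t - pk i"] dir[OF that(1)] that by (simp add: pk_def nth_mem)
  qed
  have sl: "dp i < pk i" if "0 < i" "i < k" for i
    using ne[of "2 * i"] that pk[of i] by simp
  have sr: "pk i < dp (i + 1)" if "i + 1 < k" for i
    using ne[of "2 * i + 1"] that dp[of i] by simp
  have bound: "dp (i + 1) \<le> length w" if "i < k" for i
  proof -
    have "length (concat (take j \<tau>)) \<le> length (concat \<tau>)" for j
      by (metis append_take_drop_id concat_append le_add1 length_append)
    then show ?thesis using w by (simp add: dp_def B_def)
  qed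
  let ?V = "chain_diagram_nodes X \<tau> Y" and ?L = "chain_diagram_links u X \<tau> Y v"
  \<comment> \<open>The links of the inner words.\<close>
  have link_right: "word_link Q (\<tau> ! (2 * i + 1)) = Leftwards (string_path (pk i) (dp (i + 1)))" if i: "i + 1 < k" for i
  proof -
    have n: "\<tau> ! (2 * i + 1) \<noteq> []" using ne[of "2 * i + 1"] i by simp
    then have "direct_word (\<tau> ! (2 * i + 1))" using dir[of i] i by (auto simp: direct_word_def)
    moreover have "tail Q (fst (hd (\<tau> ! (2 * i + 1)))) = \<kappa> (pk i)"
    proof -
      have h: "hd (\<tau> ! (2 * i + 1)) = w ! pk i"
        using letter[of "2 * i + 1" 0] n i by (simp add: hd_conv_nth pk_def)
      have "pk i < length w" using sr[OF i] bound[of i] i by simp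
      moreover have "snd (w ! pk i)" using dir_t[of i "pk i"] sr[OF i] i by simp
      ultimately show ?thesis unfolding h using letter_cases(1)[of "pk i"] by (simp add: ht_def)
    qed
    ultimately show ?thesis using right_path[of i] i by (simp add: word_link_def word_path_def)
  qed
  have link_left: "word_link Q (\<tau> ! (2 * i + 2)) = Rightwards (string_path (pk (i + 1)) (dp (i + 1)))" if i: "i + 1 < k" for i
  proof -
    have n: "\<tau> ! (2 * i + 2) \<noteq> []" using ne[of "2 * i + 2"] i by simp
    have "\<not> direct_word (\<tau> ! (2 * i + 2))"
      using inv[of "i + 1" "hd (\<tau> ! (2 * i + 2))"] i n by (auto simp: direct_word_def)
    moreover have "tail Q (fst (last (\<tau> ! (2 * i + 2)))) = \<kappa> (pk (i + 1))"
    proof -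
      have p: "pk (i + 1) = dp (i + 1) + length (\<tau> ! (2 * i + 2))" "0 < length (\<tau> ! (2 * i + 2))"
        using pk[of "i + 1"] i n by simp_all
      moreover have "dp (i + 1) = B (2 * i + 2)" by (simp add: dp_def)
      ultimately have e: "B (2 * i + 2) + (length (\<tau> ! (2 * i + 2)) - 1) = pk (i + 1) - 1" by linarith
      have h: "last (\<tau> ! (2 * i + 2)) = w ! (pk (i + 1) - 1)"
        using letter[of "2 * i + 2" "length (\<tau> ! (2 * i + 2)) - 1", unfolded e] n i by (simp add: last_conv_nth)
      have "pk (i + 1) \<le> length w" using bound[of "i + 1"] dp[of "i + 1"] i by simp
      then have l: "pk (i + 1) - 1 < length w" "pk (i + 1) - 1 + 1 = pk (i + 1)" using p by linarith+
      have "\<not> snd (w ! (pk (i + 1) - 1))" using inv_t[of "i + 1" "pk (i + 1) - 1"] sl[of "i + 1"] i by simp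
      then show ?thesis unfolding h using letter_cases(2)[OF l(1)] l(2) by (simp add: ht_def)
    qed
    ultimately show ?thesis using left_path[of "i + 1"] i by (simp add: word_link_def word_path_def)
  qed
  have u': "u = (\<kappa> (pk 0), snd (string_path (pk 0) 0))"
    using left_path[of 0] pk[of 0] k(2) by (simp add: u dp_def B_0)
  have v': "v = (\<kappa> (pk (k - 1)), snd (string_path (pk (k - 1)) (length w)))"
  proof -
    have "k - 1 < k" "2 * (k - 1) + 1 = 2 * k - 1" "k - 1 + 1 = k" using k(2) by simp_all
    moreover have "dp k = length w" by (simp add: dp_def B_end)
    ultimately show ?thesis using right_path[of "k - 1"] dp[of "k - 1"] by (simp add: v)
  qed
  have lenl: "length (if X = [] then []
      else map (\<lambda>a. Rightwards (tail Q a, [a])) (rev (tl X)) @ [Rightwards (fst u, snd u @ [hd X])]) = length X"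
    by simp
  have L_left: "?L ! (length X - 1 - t) = Rightwards
     (if t = 0 then (\<kappa> (pk 0), snd (string_path (pk 0) 0) @ [X ! 0]) else (tail Q (X ! t), [X ! t]))"
    if t: "t < length X" for t
  proof (cases "t = 0")
    case True
    then have "X \<noteq> []" using t by auto
    then show ?thesis using True u' by (simp add: chain_diagram_links_def nth_append hd_conv_nth)
  next
    case False
    then have "X \<noteq> []" "length X - 1 - t < length (tl X)" using t by auto
    moreover have "rev (tl X) ! (length X - 1 - t) = X ! t"
    proof -
      have "length (tl X) - Suc (length X - 1 - t) = t - 1" "t - 1 < length (tl X)" "Suc (t - 1) = t"
        using t False by auto
      then show ?thesis using \<open>length X - 1 - t < length (tl X)\<close> by (simp only: rev_nth nth_tl)
    qed
    ultimately show ?thesis using False by (simp add: chain_diagram_links_def nth_append)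
  qed
  have L_mid: "?L ! (length X + j) = word_link Q (\<tau> ! (j + 1))" if "j < 2 * k - 2" for j
    using that k by (simp add: chain_diagram_links_def nth_append flip: numeral_2_eq_2)
  have L_right: "?L ! (length X + 2 * k - 2 + t) = Leftwards
     (if t = 0 then (\<kappa> (pk (k - 1)), snd (string_path (pk (k - 1)) (length w)) @ [Y ! 0]) else (tail Q (Y ! t), [Y ! t]))"
    if t: "t < length Y" for t
  proof -
    have "Y \<noteq> []" using t by auto
    moreover have "length X + 2 * k - 2 + t - length X - (2 * k - 2) = t" using k(2) by simp
    ultimately show ?thesis using k t v'
      by (cases t) (auto simp: chain_diagram_links_def nth_append hd_conv_nth nth_tl)
  qed
  have lenL: "length ?L = length X + (2 * k - 2) + length Y"
    using k by (simp add: chain_diagram_links_def add.assoc flip: numeral_2_eq_2)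
  have lenV: "length ?V = length X + (2 * k - 1) + length Y"
    using k by (simp add: chain_diagram_nodes_def)
  have V_mid: "?V ! (length X + j) = \<kappa> (B (Suc j))" if "j < 2 * k - 1" for j
    using that k by (simp add: chain_diagram_nodes_def nth_append B_def)
  interpret gentle_string_diagram Q R te he \<kappa> d w k pk dp X Y ?V ?L
  proof
    show "1 \<le> k" "dp 0 = 0" "dp k = length w" using k B_0 B_end by (simp_all add: dp_def)
    show "dp i \<le> pk i \<and> pk i \<le> dp (i + 1)" if "i < k" for i using pk[OF that] dp[OF that] by simp
    show "relation_chain (\<kappa> 0, d 0) X" "relation_chain (\<kappa> (length w), \<not> d (length w)) Y" by fact+
    show "length ?V = length X + (2 * k - 1) + length Y" by (rule lenV)
    show "length ?L + 1 = length ?V" using lenL lenV k(2) by simp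
    show "?V ! (length X - 1 - t) = head Q (X ! t)" if "t < length X" for t
    proof -
      have "length X - 1 - t < length X" "length X - Suc (length X - 1 - t) = t" using that by linarith+
      then show ?thesis by (simp only: chain_diagram_nodes_def nth_append length_map length_rev if_True nth_map rev_nth)
    qed
    show "?V ! (length X + 2 * i) = \<kappa> (pk i)" if "i < k" for i
      using V_mid[of "2 * i"] that by (simp add: pk_def)
    show "?V ! (length X + 2 * i + 1) = \<kappa> (dp (i + 1))" if "i + 1 < k" for i
      using V_mid[of "2 * i + 1"] that by (simp add: dp_def)
    show "?V ! (length X + 2 * k - 1 + t) = head Q (Y ! t)" if "t < length Y" for t
    proof -
      have "length X + 2 * k - 1 + t = length (map (head Q) (rev X) @
          map (\<lambda>j. \<kappa> (length (concat (take (Suc j) \<tau>)))) [0..<length \<tau> - 1]) + t" using k by simp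
      then show ?thesis using that
        unfolding chain_diagram_nodes_def append_assoc[symmetric] by (simp only: nth_append_length_plus nth_map)
    qed
    show "displayed_map ?L s' s p \<longleftrightarrow>
      (\<exists>t<length X. s' = length X - 1 - t \<and> s = length X - t \<and>
         p = (if t = 0 then (\<kappa> (pk 0), snd (string_path (pk 0) 0) @ [X ! 0]) else (tail Q (X ! t), [X ! t]))) \<or>
      (\<exists>i. i + 1 < k \<and> s' = length X + 2 * i + 1 \<and> s = length X + 2 * i \<and>
         p = string_path (pk i) (dp (i + 1))) \<or>
      (\<exists>i. i + 1 < k \<and> s' = length X + 2 * i + 1 \<and> s = length X + 2 * i + 2 \<and>
         p = string_path (pk (i + 1)) (dp (i + 1))) \<or>
      (\<exists>t<length Y. s' = length X + 2 * k - 1 + t \<and> s = length X + 2 * k - 2 + t \<and>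
         p = (if t = 0 then (\<kappa> (pk (k - 1)), snd (string_path (pk (k - 1)) (length w)) @ [Y ! 0])
              else (tail Q (Y ! t), [Y ! t])))" (is "?D \<longleftrightarrow> ?A \<or> ?B \<or> ?C \<or> ?E") for s' s p
    proof
      assume ?D
      then obtain j where j: "j < length ?L" "(s = Suc j \<and> s' = j \<and> ?L ! j = Rightwards p) \<or>
          (s' = Suc j \<and> s = j \<and> ?L ! j = Leftwards p)"
        unfolding displayed_map_def by blast
      consider "j < length X" | "length X \<le> j" "j < length X + (2 * k - 2)" | "length X + (2 * k - 2) \<le> j" by linarith
      then show "?A \<or> ?B \<or> ?C \<or> ?E"
      proof cases
        case 1
        define t where "t = length X - 1 - j"
        have t: "t < length X" "j = length X - 1 - t" "Suc j = length X - t" using 1 by (auto simp: t_def)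
        have ?A using L_left[OF t(1)] j(2) t by (intro exI[of _ t]) auto
        then show ?thesis ..
      next
        case 2
        define m where "m = j - length X"
        have m: "j = length X + m" "m < 2 * k - 2" using 2 by (auto simp: m_def)
        show ?thesis
        proof (cases "even m")
          case True
          then obtain i where i: "m = 2 * i" by blast
          then have "i + 1 < k" using m(2) by simp
          then have ?B using L_mid[OF m(2)] link_right[of i] j(2) m(1) i by (intro exI[of _ i]) auto
          then show ?thesis by blast
        next
          case False
          then obtain i where i: "m = 2 * i + 1" by (rule oddE)
          then have "i + 1 < k" using m(2) by simp
          then have ?C using L_mid[OF m(2)] link_left[of i] j(2) m(1) i by (intro exI[of _ i]) auto
          then show ?thesis by blast
        qed
      next
        case 3
        define t where "t = j - (length X + (2 * k - 2))"
        have t: "t < length Y" "j = length X + 2 * k - 2 + t" "Suc j = length X + 2 * k - 1 + t"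
          using 3 j(1) lenL k(2) by (auto simp: t_def)
        have ?E using L_right[OF t(1)] j(2) t by (intro exI[of _ t]) auto
        then show ?thesis by blast
      qed
    next
      assume "?A \<or> ?B \<or> ?C \<or> ?E"
      then show ?D
      proof (elim disjE)
        assume ?A
        then obtain t where t: "t < length X" "s' = length X - 1 - t" "s = length X - t"
         "p = (if t = 0 then (\<kappa> (pk 0), snd (string_path (pk 0) 0) @ [X ! 0]) else (tail Q (X ! t), [X ! t]))" by blast
        have "s = Suc s'" "s' < length ?L" using t lenL by linarith+
        then show ?D using L_left[OF t(1)] t(2,4) unfolding displayed_map_def by simp
      next
        assume ?B
        then obtain i where i: "i + 1 < k" "s' = length X + 2 * i + 1" "s = length X + 2 * i"
         "p = string_path (pk i) (dp (i + 1))" by blast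
        then show ?D using L_mid[of "2 * i"] link_right[OF i(1)] lenL unfolding displayed_map_def by auto
      next
        assume ?C
        then obtain i where i: "i + 1 < k" "s' = length X + 2 * i + 1" "s = length X + 2 * i + 2"
         "p = string_path (pk (i + 1)) (dp (i + 1))" by blast
        then show ?D using L_mid[of "2 * i + 1"] link_left[OF i(1)] lenL unfolding displayed_map_def by auto
      next
        assume ?E
        then obtain t where t: "t < length Y" "s' = length X + 2 * k - 1 + t" "s = length X + 2 * k - 2 + t"
          "p = (if t = 0 then (\<kappa> (pk (k - 1)), snd (string_path (pk (k - 1)) (length w)) @ [Y ! 0])
              else (tail Q (Y ! t), [Y ! t]))" by blast
        have "s' = Suc s" "s < length ?L" using t k(2) lenL by auto
        then show ?D using L_right[OF t(1)] t(3,4) unfolding displayed_map_def by auto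
      qed
    qed
  qed (use sl sr inv_t dir_t in blast)+
  show ?thesis by (rule string_module_resolved)
qed

text \<open>If the string starts with a direct word then its first vertex is a node of the diagram, and the
  first arrow of \<open>X\<close> alone gives the link to it; otherwise this arrow is preceded by the path of the
  first word, and there is no node at the first vertex. The same holds at the other end, with the
  roles of direct and inverse words exchanged.\<close>

lemma maximal_parts_resolved:
  fixes \<sigma>s :: "'a letter list list"
  assumes dec: "maximal_decomposition w \<sigma>s" and r: "1 \<le> length \<sigma>s"
    and X: "relation_chain (\<kappa> 0, d 0) X"
    and Y: "relation_chain (\<kappa> (length w), \<not> d (length w)) Y"
  shows "resolved_by (A :: (_, 'k::field) alg) M
     (map (head Q) (rev X) @ (if direct_word (\<sigma>s ! 0) then [\<kappa> 0] else []) @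
      map (\<lambda>i. letter_target Q (last (\<sigma>s ! (i - 1)))) [1..<length \<sigma>s] @
      (if inverse_word (\<sigma>s ! (length \<sigma>s - 1)) then [\<kappa> (length w)] else []) @ map (head Q) Y)
     ((if X = [] then [] else map (\<lambda>a. Rightwards (tail Q a, [a])) (rev (tl X)) @
         [Rightwards (if direct_word (\<sigma>s ! 0) then (tail Q (hd X), [hd X])
            else path_append (word_path Q (\<sigma>s ! 0)) (tail Q (hd X), [hd X]))]) @
      map (\<lambda>i. word_link Q (\<sigma>s ! (i - 1)))
        [(if direct_word (\<sigma>s ! 0) then 1 else 2)..<
         (if inverse_word (\<sigma>s ! (length \<sigma>s - 1)) then length \<sigma>s + 1 else length \<sigma>s)] @
      (if Y = [] then [] else
         Leftwards (if inverse_word (\<sigma>s ! (length \<sigma>s - 1)) then (tail Q (hd Y), [hd Y])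
            else path_append (word_path Q (\<sigma>s ! (length \<sigma>s - 1))) (tail Q (hd Y), [hd Y])) #
         map (\<lambda>a. Leftwards (tail Q a, [a])) (tl Y)))"
    (is "resolved_by A M ?V ?L")
proof -
  define n where "n = length \<sigma>s"
  define D where "D \<longleftrightarrow> direct_word (\<sigma>s ! 0)"
  define I where "I \<longleftrightarrow> inverse_word (\<sigma>s ! (n - 1))"
  define s :: nat where "s = (if D then 1 else 0)"
  define p :: nat where "p = (if I then 1 else 0)"
  have n: "1 \<le> n" using r by (simp add: n_def)
  have cat: "concat \<sigma>s = w" and kinds: "\<And>\<sigma>. \<sigma> \<in> set \<sigma>s \<Longrightarrow> direct_word \<sigma> \<or> inverse_word \<sigma>"
    and succ: "successively (\<lambda>\<sigma> \<tau>. direct_word \<sigma> \<longleftrightarrow> inverse_word \<tau>) \<sigma>s"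
    using dec unfolding maximal_decomposition_def by blast+
  have kind: "inverse_word (\<sigma>s ! j) \<longleftrightarrow> \<not> direct_word (\<sigma>s ! j)" and nonempty: "\<sigma>s ! j \<noteq> []" if "j < n" for j
  proof -
    have "direct_word (\<sigma>s ! j) \<or> inverse_word (\<sigma>s ! j)" using kinds that by (simp add: n_def)
    then show "inverse_word (\<sigma>s ! j) \<longleftrightarrow> \<not> direct_word (\<sigma>s ! j)" "\<sigma>s ! j \<noteq> []"
      by (cases "\<sigma>s ! j"; auto simp: direct_word_def inverse_word_def)+
  qed
  have parity: "direct_word (\<sigma>s ! j) \<longleftrightarrow> (D \<longleftrightarrow> even j)" if "j < n" for j
    using that
  proof (induction j)
    case (Suc j)
    have "direct_word (\<sigma>s ! j) \<longleftrightarrow> inverse_word (\<sigma>s ! Suc j)"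
      using succ Suc.prems unfolding successively_conv_nth n_def by blast
    then show ?case using Suc kind[of "Suc j"] by auto
  qed (simp add: D_def)
  have even: "even (n + s + p)"
    using parity[of "n - 1"] kind[of "n - 1"] n by (auto simp: I_def s_def p_def)
  then obtain k where k: "n + s + p = 2 * k" by blast
  have k1: "1 \<le> k" using k n by linarith
  \<comment> \<open>The list of words is padded with empty words so that it starts with an inverse word and ends with
    a direct one, either of them possibly empty.\<close>
  define \<tau> where "\<tau> = (if D then [[]] else []) @ \<sigma>s @ (if I then [[]] else [])"
  have len: "length \<tau> = 2 * k" using k by (auto simp: \<tau>_def s_def p_def n_def)
  have nth: "\<tau> ! (s + j) = \<sigma>s ! j" if "j < n" for j
    using that by (simp add: \<tau>_def s_def nth_append n_def)
  have nth_left: "\<tau> ! j = []" if "j < s" for j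
    using that by (simp add: \<tau>_def s_def split: if_splits)
  have nth_right: "\<tau> ! j = []" if "s + n \<le> j" "j < 2 * k" for j
    using that k by (auto simp: \<tau>_def s_def p_def nth_append n_def split: if_splits)
  have cases: "\<tau> ! j = [] \<and> (j < s \<or> s + n \<le> j) \<or> (\<exists>i<n. j = s + i \<and> \<tau> ! j = \<sigma>s ! i)" if "j < 2 * k" for j
  proof -
    consider "j < s" | "s + n \<le> j" | "s \<le> j" "j < s + n" by linarith
    then show ?thesis
    proof cases
      case 3
      then have "j - s < n" "j = s + (j - s)" by auto
      then show ?thesis using nth[of "j - s"] by (intro disjI2 exI[of _ "j - s"]) auto
    qed (use nth_left nth_right that in auto)
  qed
  have pd: "direct_word (\<tau> ! j) \<longleftrightarrow> odd j" "inverse_word (\<tau> ! j) \<longleftrightarrow> even j" if j: "j < 2 * k" "\<tau> ! j \<noteq> []" for j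
  proof -
    obtain i where i: "i < n" "j = s + i" "\<tau> ! j = \<sigma>s ! i" using cases[OF j(1)] j(2) by blast
    then show "direct_word (\<tau> ! j) \<longleftrightarrow> odd j" "inverse_word (\<tau> ! j) \<longleftrightarrow> even j"
      using parity[OF i(1)] kind[OF i(1)] by (auto simp: s_def)
  qed
  define f where "f j = \<kappa> (length (concat (take j \<sigma>s)))" for j
  have target: "letter_target Q (last (\<sigma>s ! (i - 1))) = f i" if i: "1 \<le> i" "i \<le> n" for i
  proof -
    have split: "take i \<sigma>s = take (i - 1) \<sigma>s @ [\<sigma>s ! (i - 1)]"
      using take_Suc_conv_app_nth[of "i - 1" \<sigma>s] i by (simp add: n_def)
    have ne: "\<sigma>s ! (i - 1) \<noteq> []" using nonempty[of "i - 1"] i by simp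
    have w_eq: "w = concat (take i \<sigma>s) @ concat (drop i \<sigma>s)"
      using cat by (metis append_take_drop_id concat_append)
    have "concat (take i \<sigma>s) \<noteq> []" "last (concat (take i \<sigma>s)) = last (\<sigma>s ! (i - 1))"
      using split ne by simp_all
    then have "last (\<sigma>s ! (i - 1)) = w ! (length (concat (take i \<sigma>s)) - 1)"
      using w_eq by (metis diff_less last_conv_nth length_greater_0_conv nth_append zero_less_one)
    moreover have "length (concat (take i \<sigma>s)) \<le> length w" using w_eq by (metis le_add1 length_append)
    moreover have "length (concat (take i \<sigma>s)) \<noteq> 0" using \<open>concat (take i \<sigma>s) \<noteq> []\<close> by simp
    ultimately show ?thesis using word_vertex[of "length (concat (take i \<sigma>s))"]
      by (simp only: f_def word_vertex_def if_False)
  qed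
  have nodes: "chain_diagram_nodes X \<tau> Y = ?V"
  proof -
    have pad: "concat (take x [[]]) = []" for x by (cases x) simp_all
    have "map (\<lambda>j. \<kappa> (length (concat (take (Suc j) \<tau>)))) [0..<length \<tau> - 1] = map f [1 - s..<n + p]"
    proof (cases D)
      case True
      have "map (\<lambda>j. \<kappa> (length (concat (take (Suc j) \<tau>)))) [0..<length \<tau> - 1] = map f [0..<n + p]"
        using True k by (auto simp: len f_def \<tau>_def s_def p_def n_def pad)
      then show ?thesis using True by (simp add: s_def)
    next
      case False
      have "map (\<lambda>j. \<kappa> (length (concat (take (Suc j) \<tau>)))) [0..<length \<tau> - 1] = map (\<lambda>j. f (Suc j)) [0..<n + p - 1]"
      proof -
        have e: "length \<tau> - 1 = n + p - 1" using False by (simp add: \<tau>_def p_def n_def)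
        show ?thesis unfolding e using False n by (auto simp: f_def \<tau>_def p_def n_def pad)
      qed
      also have "\<dots> = map f (map Suc [0..<n + p - 1])" by simp
      also have "\<dots> = map f [1..<n + p]" using n by (simp only: map_Suc_upt) simp
      finally show ?thesis using False by (simp add: s_def)
    qed
    also have "\<dots> = (if D then [\<kappa> 0] else []) @ map f [1..<n] @ (if I then [\<kappa> (length w)] else [])"
    proof -
      have "[1 - s..<n + p] = (if D then [0] else []) @ [1..<n] @ (if I then [n] else [])"
        using n by (auto simp: s_def p_def upt_conv_Cons)
      moreover have "f 0 = \<kappa> 0" "f n = \<kappa> (length w)" using cat by (simp_all add: f_def n_def)
      ultimately show ?thesis by auto
    qed
    also have "map f [1..<n] = map (\<lambda>i. letter_target Q (last (\<sigma>s ! (i - 1)))) [1..<n]"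
      using target by auto
    finally show ?thesis by (simp add: chain_diagram_nodes_def D_def I_def n_def)
  qed
  have mid: "map (\<lambda>j. word_link Q (\<tau> ! j)) [1..<length \<tau> - 1] =
      map (\<lambda>i. word_link Q (\<sigma>s ! (i - 1))) [(if D then 1 else 2)..<(if I then n + 1 else n)]"
  proof (cases D)
    case True
    have "map (\<lambda>j. word_link Q (\<tau> ! j)) [1..<length \<tau> - 1] = map (\<lambda>i. word_link Q (\<sigma>s ! (i - 1))) [1..<length \<tau> - 1]"
    proof (rule map_cong)
      fix j assume "j \<in> set [1..<length \<tau> - 1]"
      then have "j - 1 < n" "s + (j - 1) = j" using len k True by (auto simp: s_def p_def split: if_splits)
      then show "word_link Q (\<tau> ! j) = word_link Q (\<sigma>s ! (j - 1))" using nth[of "j - 1"] by simp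
    qed simp
    moreover have "length \<tau> - 1 = (if I then n + 1 else n)" using True len k by (auto simp: s_def p_def)
    ultimately show ?thesis using True by simp
  next
    case False
    have "map (\<lambda>j. word_link Q (\<tau> ! j)) [1..<length \<tau> - 1] =
        map (\<lambda>j. word_link Q (\<sigma>s ! (Suc j - 1))) [1..<length \<tau> - 1]"
    proof (rule map_cong)
      fix j assume "j \<in> set [1..<length \<tau> - 1]"
      then have "j < n" using len k False by (auto simp: s_def p_def split: if_splits)
      then show "word_link Q (\<tau> ! j) = word_link Q (\<sigma>s ! (Suc j - 1))" using nth[of j] False by (simp add: s_def)
    qed simp
    also have "\<dots> = map (\<lambda>j. word_link Q (\<sigma>s ! (j - 1))) (map Suc [1..<length \<tau> - 1])" by simp
    also have "map Suc [1..<length \<tau> - 1] = [2..<Suc (length \<tau> - 1)]"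
      by (simp add: map_Suc_upt numeral_2_eq_2)
    also have "Suc (length \<tau> - 1) = (if I then n + 1 else n)" using False len k n by (auto simp: s_def p_def)
    finally show ?thesis using False by simp
  qed
  define u where "u = (\<kappa> (length (\<tau> ! 0)), rev (map fst (\<tau> ! 0)))"
  define v where "v = (\<kappa> (length w - length (\<tau> ! (2 * k - 1))), map fst (\<tau> ! (2 * k - 1)))"
  have u: "u = (if D then (\<kappa> 0, []) else word_path Q (\<sigma>s ! 0))"
  proof (cases D)
    case False
    let ?l = "length (\<sigma>s ! 0)"
    have t: "\<tau> ! 0 = \<sigma>s ! 0" using nth[of 0] False n by (simp add: s_def)
    have ne: "\<sigma>s ! 0 \<noteq> []" using nonempty[of 0] n by simp
    obtain \<sigma>s' where "\<sigma>s = \<sigma>s ! 0 # \<sigma>s'" using r by (cases \<sigma>s) auto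
    then have w_eq: "w = \<sigma>s ! 0 @ concat \<sigma>s'" using cat by (metis concat.simps(2))
    then have last: "last (\<sigma>s ! 0) = w ! (?l - 1)" "?l - 1 < length w"
      using ne by (metis diff_less last_conv_nth length_greater_0_conv nth_append zero_less_one)
        (use ne w_eq in \<open>metis diff_less length_append length_greater_0_conv trans_less_add1 zero_less_one\<close>)
    have "\<not> snd (last (\<sigma>s ! 0))" using kind[of 0] False ne n by (auto simp: D_def inverse_word_def)
    then have "w ! (?l - 1) = (fst (last (\<sigma>s ! 0)), False)" unfolding last(1) by (simp add: prod_eq_iff)
    then have "tail Q (fst (last (\<sigma>s ! 0))) = \<kappa> ?l" using inverse_letter[OF last(2)] ne by simp
    then show ?thesis using False t by (simp add: u_def word_path_def D_def)
  qed (use nth_left[of 0] in \<open>simp add: u_def s_def\<close>)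
  have v: "v = (if I then (\<kappa> (length w), []) else word_path Q (\<sigma>s ! (n - 1)))"
  proof (cases I)
    case True
    have "s + n \<le> 2 * k - 1" "2 * k - 1 < 2 * k" using True k k1 by (auto simp: p_def)
    then show ?thesis using nth_right[of "2 * k - 1"] True by (simp add: v_def)
  next
    case False
    let ?z = "\<sigma>s ! (n - 1)"
    have t: "\<tau> ! (2 * k - 1) = ?z" 
    proof -
      have "s + (n - 1) = 2 * k - 1" using False n k by (simp add: p_def)
      then show ?thesis using nth[of "n - 1"] n by simp
    qed
    have ne: "?z \<noteq> []" using nonempty[of "n - 1"] n by simp
    have "\<sigma>s = butlast \<sigma>s @ [?z]" using r n_def by (metis append_butlast_last_id last_conv_nth list.size(3) not_one_le_zero)
    then have w_eq: "w = concat (butlast \<sigma>s) @ ?z" using cat by (metis append_Nil2 concat.simps concat_append)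
    then have hd: "hd ?z = w ! (length w - length ?z)" "length w - length ?z < length w"
      using ne by (metis add_diff_cancel_right' hd_append2 hd_conv_nth length_append nth_append_length_plus add_0_right length_greater_0_conv)
        (use ne w_eq in simp)
    have dz: "direct_word ?z" using kind[of "n - 1"] False n by (simp add: I_def)
    then have "snd (hd ?z)" using ne by (simp add: direct_word_def)
    then have "w ! (length w - length ?z) = (fst (hd ?z), True)" unfolding hd(1) by (simp add: prod_eq_iff)
    then have "tail Q (fst (hd ?z)) = \<kappa> (length w - length ?z)" using direct_letter[OF hd(2)] by simp
    then show ?thesis using False t dz by (simp add: v_def word_path_def)
  qed
  have X_tail: "tail Q (hd X) = \<kappa> 0" if "X \<noteq> []" using X that by (cases X) (auto simp: ht_def)
  have Y_tail: "tail Q (hd Y) = \<kappa> (length w)" if "Y \<noteq> []" using Y that by (cases Y) (auto simp: ht_def)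
  have links: "chain_diagram_links u X \<tau> Y v = ?L"
    unfolding chain_diagram_links_def mid u v D_def[symmetric] I_def[symmetric] n_def[symmetric]
    using X_tail Y_tail by (simp add: path_append_def I_def[unfolded n_def])
  have "resolved_by A M (chain_diagram_nodes X \<tau> Y) (chain_diagram_links u X \<tau> Y v)"
  proof (rule chain_diagram_resolved[OF len k1 _ _ _ _ X Y u_def v_def])
    show "concat \<tau> = w" using cat by (simp add: \<tau>_def)
    show "\<not> snd l" if "i < k" "l \<in> set (\<tau> ! (2 * i))" for i l
    proof -
      have "\<tau> ! (2 * i) \<noteq> []" using that(2) by auto
      then show ?thesis using pd(2)[of "2 * i"] that by (simp add: inverse_word_def)
    qed
    show "snd l" if "i < k" "l \<in> set (\<tau> ! (2 * i + 1))" for i l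
    proof -
      have "\<tau> ! (2 * i + 1) \<noteq> []" using that(2) by auto
      then show ?thesis using pd(1)[of "2 * i + 1"] that by (simp add: direct_word_def)
    qed
    show "\<tau> ! j \<noteq> []" if "0 < j" "j < 2 * k - 1" for j
    proof -
      have "s \<le> j" "j < s + n" using that k by (auto simp: s_def p_def split: if_splits)
      then have "\<tau> ! j = \<sigma>s ! (j - s)" "j - s < n" using nth[of "j - s"] by auto
      then show ?thesis using nonempty by simp
    qed
  qed
  then show ?thesis unfolding nodes links .
qed

end


section \<open>The string of a zigzag arc\<close>

text \<open>The sides of an arc are its ends: the following say whether an angle has its corner at the end \<open>1\<close>
  of the arc at which it starts, resp. ends.\<close>

definition tail_side :: "'p angle \<Rightarrow> bool" where
  "tail_side = (\<lambda>(P, i). snd (edge P i))"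

definition head_side :: "'p angle \<Rightarrow> bool" where
  "head_side = (\<lambda>(P, i). \<not> snd (edge P (next_edge P i)))"

context simple_coordinate begin

lemma gentle_bound_quiver:
  "gentle_bound_quiver (gentle_quiver \<Delta> \<P>) (gentle_relations \<Delta> \<P>) tail_side head_side"
proof (intro gentle_bound_quiver.intro bound_quiver.intro bound_quiver_axioms.intro
    gentle_bound_quiver_axioms.intro)
  show "wf_digraph (gentle_quiver \<Delta> \<P>)" by (rule quiver_wf)
  show "finite (nonzero_paths (gentle_quiver \<Delta> \<P>) (gentle_relations \<Delta> \<P>))" by (rule finite_nonzero_paths)
next
  fix a b assume ab: "a \<in> arcs (gentle_quiver \<Delta> \<P>)" "b \<in> arcs (gentle_quiver \<Delta> \<P>)"
    "tail (gentle_quiver \<Delta> \<P>) a = tail (gentle_quiver \<Delta> \<P>) b" "tail_side a = tail_side b"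
  obtain P i P' i' where a: "a = (P, i)" and b: "b = (P', i')" by fastforce
  have P: "P \<in> \<P>" "P' \<in> \<P>" "has_next P i" "has_next P' i'"
    using ab(1,2) by (simp_all add: gentle_quiver_def a b)
  have "edge P i = edge P' i'"
    using ab(3,4) by (simp add: gentle_quiver_def a b edge_arc_def tail_side_def prod_eq_iff)
  then show "a = b"
    using edge_unique[OF P(1) has_next_bounds(1,2)[OF P(3)] P(2) has_next_bounds(1,2)[OF P(4)]] by (simp add: a b)
next
  fix a b
  show "(a, b) \<in> gentle_relations \<Delta> \<P> \<longleftrightarrow> a \<in> arcs (gentle_quiver \<Delta> \<P>) \<and> b \<in> arcs (gentle_quiver \<Delta> \<P>) \<and>
      head (gentle_quiver \<Delta> \<P>) a = tail (gentle_quiver \<Delta> \<P>) b \<and> head_side a \<noteq> tail_side b"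
    by (cases a; cases b)
      (auto simp: gentle_relations_def angle_ends head_side_def tail_side_def gentle_quiver_def)
qed

text \<open>In a polygon without puncture the angles following an edge form a maximal sequence of arrows
  in which consecutive arrows form relations: consecutive angles lie at different ends of the edge
  between them, and the last edge has no successor.\<close>

lemma relation_chain_polygon:
  assumes P: "P \<in> \<P>" "\<not> punctured P" and c: "1 \<le> c" "c \<le> num_edges P"
  shows "gentle_bound_quiver.relation_chain (gentle_quiver \<Delta> \<P>) tail_side head_side (edge P c)
    (map (\<lambda>i. (P, i)) [c..<num_edges P])"
proof -
  interpret gentle_bound_quiver "gentle_quiver \<Delta> \<P>" "gentle_relations \<Delta> \<P>" tail_side head_side
    by (rule gentle_bound_quiver)
  have ht: "ht (P', i) = edge P' i" for P' i
    unfolding ht_def by (simp add: gentle_quiver_def tail_side_def edge_arc_def)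
  have hh: "opposite (hh (P', i)) = edge P' (next_edge P' i)" for P' i
    unfolding hh_def opposite_def by (simp add: gentle_quiver_def head_side_def edge_arc_def)
  have arrow: "(P', i) \<in> arcs (gentle_quiver \<Delta> \<P>) \<longleftrightarrow> P' \<in> \<P> \<and> has_next P' i" for P' i
    by (simp add: gentle_quiver_def)
  show ?thesis using c
  proof (induction "num_edges P - c" arbitrary: c)
    case 0
    then have e: "c = num_edges P" by simp
    have "edge P' i \<noteq> edge P c" if "P' \<in> \<P>" "has_next P' i" for P' i
    proof
      assume "edge P' i = edge P c"
      then have "P' = P" "i = c"
        using edge_unique[OF that(1) has_next_bounds(1,2)[OF that(2)] P(1) 0(2,3)] by auto
      then show False using that(2) e P(2) by (simp add: has_next_def)
    qed
    then show ?case using e ht arrow by auto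
  next
    case (Suc k)
    then have "c < num_edges P" "k = num_edges P - Suc c" by simp_all
    moreover from this have "relation_chain (edge P (Suc c)) (map (\<lambda>i. (P, i)) [Suc c..<num_edges P])"
      using Suc.hyps(1)[of "Suc c"] by simp
    ultimately show ?case using P Suc.prems
      by (simp add: upt_conv_Cons ht hh arrow has_next_def next_edge_def)
  qed
qed

text \<open>The polygons at the ends of an arc that ends on the boundary have no punctures, as the closure
  of a punctured polygon meets the boundary only in points of type \<open>\<bullet>\<close>.\<close>

lemma white_unpunctured:
  assumes P: "P \<in> \<P>" and z: "z \<in> cball 0 1" "param P z \<in> white_points S"
  shows "\<not> punctured P"
proof
  assume p: "punctured P"
  have bd: "param P z \<in> boundary_of S" and nb: "param P z \<notin> black_points S"
    using z(2) white_boundary white_black_disjoint by auto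
  have "z \<notin> ball 0 1" using open_polygon_interior(2)[OF P] bd by blast
  then have "norm z = 1" using z(1) by simp
  then obtain i t where it: "z = side P i t" "0 \<le> t" "t < 1" "i \<le> num_edges P" "i = 0 \<Longrightarrow> \<not> punctured P"
    using circle_side[OF polygons[OF P]] by blast
  then have i: "1 \<le> i" using p by (cases i) auto
  define t' where "t' = (if snd (edge P i) then t else 1 - t)"
  have e: "param P z = edge_arc P i t'" "edge_arc P i \<in> \<Delta>"
    using edge_point[OF P i it(4), of t] it(1-3) by (simp_all add: t'_def)
  have "0 \<le> t'" "t' \<le> 1" using it by (auto simp: t'_def)
  then consider "t' = 0" | "t' = 1" | "0 < t'" "t' < 1" by linarith
  then show False
  proof cases
    case 3
    then show False using arc_inner[OF e(2)] inner_not_boundary bd e(1) by simp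
  qed (use nb e arcs[OF e(2)] in \<open>auto simp: black_arc_def\<close>)
qed

text \<open>The curve leaves the polygon \<open>cpoly \<gamma> j\<close> through the \<open>j\<close>-th crossed arc, and the polygon lies to
  the right of this arc iff \<open>snd (edge (cpoly \<gamma> j) (cout \<gamma> j))\<close>. Which end of the arc is at the
  corner cut off by the next segment of the curve depends on this and on the direction of the
  letter.\<close>

lemma gentle_string_zigzag:
  assumes z: "zigzag_arc S \<Delta> \<P> \<alpha> \<gamma>" and w: "associated_string S \<gamma> w"
  shows "gentle_string (gentle_quiver \<Delta> \<P>) (gentle_relations \<Delta> \<P>) tail_side head_side
    (crossed_arc \<gamma>) (\<lambda>j. snd (edge (cpoly \<gamma> j) (cout \<gamma> j))) w"
proof -
  interpret gentle_bound_quiver "gentle_quiver \<Delta> \<P>" "gentle_relations \<Delta> \<P>" tail_side head_side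
    by (rule gentle_bound_quiver)
  interpret crosses_along \<P> \<alpha> \<gamma> using z by (simp add: zigzag_arc_def)
  have len: "length w = clast \<gamma>" using w by (simp add: associated_string_def)
  have letter: "zigzag_letter S \<gamma> (j + 1) (w ! j)" if "j < length w" for j
    using w that unfolding associated_string_def by (metis Suc_eq_plus1 Suc_leI atLeastAtMost_iff diff_add_inverse2 le_add2 len)
  have inn: "edge_arc (cpoly \<gamma> (j + 1)) (cin \<gamma> (j + 1)) = crossed_arc \<gamma> j"
      "snd (edge (cpoly \<gamma> (j + 1)) (cin \<gamma> (j + 1))) = (\<not> snd (edge (cpoly \<gamma> j) (cout \<gamma> j)))"
    if "j < length w" for j
    using opposite_sides[of j] that len by (auto simp: crossed_arc_def)
  have P: "cpoly \<gamma> (j + 1) \<in> \<P>" if "j < length w" for j using polys[of "j + 1"] that len by simp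
  show ?thesis
  proof
    fix j assume "j \<le> length w"
    then show "crossed_arc \<gamma> j \<in> verts (gentle_quiver \<Delta> \<P>)"
      using polygon_edges[of "cpoly \<gamma> j" "cout \<gamma> j"] polys[of j] exit[of j] len
      by (simp add: crossed_arc_def gentle_quiver_def)
  next
    fix j a assume j: "j < length w" "w ! j = (a, True)"
    have "a = (cpoly \<gamma> (j + 1), cin \<gamma> (j + 1))" "to_successor \<gamma> (j + 1)"
      using letter[OF j(1)] j(2) by (auto simp: zigzag_letter_def)
    then show "a \<in> arcs (gentle_quiver \<Delta> \<P>) \<and> tail (gentle_quiver \<Delta> \<P>) a = crossed_arc \<gamma> j \<and>
        tail_side a = (\<not> snd (edge (cpoly \<gamma> j) (cout \<gamma> j))) \<and>
        head (gentle_quiver \<Delta> \<P>) a = crossed_arc \<gamma> (j + 1) \<and>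
        head_side a = (\<not> snd (edge (cpoly \<gamma> (j + 1)) (cout \<gamma> (j + 1))))"
      using inn[OF j(1)] P[OF j(1)]
      by (simp add: gentle_quiver_def to_successor_def cuts_corner_def tail_side_def head_side_def crossed_arc_def)
  next
    fix j a assume j: "j < length w" "w ! j = (a, False)"
    have "a = (cpoly \<gamma> (j + 1), cout \<gamma> (j + 1))" "to_predecessor \<gamma> (j + 1)"
      using letter[OF j(1)] j(2) by (auto simp: zigzag_letter_def)
    then show "a \<in> arcs (gentle_quiver \<Delta> \<P>) \<and> tail (gentle_quiver \<Delta> \<P>) a = crossed_arc \<gamma> (j + 1) \<and>
        tail_side a = snd (edge (cpoly \<gamma> (j + 1)) (cout \<gamma> (j + 1))) \<and>
        head (gentle_quiver \<Delta> \<P>) a = crossed_arc \<gamma> j \<and>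
        head_side a = snd (edge (cpoly \<gamma> j) (cout \<gamma> j))"
      using inn[OF j(1)] P[OF j(1)]
      by (auto simp: gentle_quiver_def to_predecessor_def cuts_corner_def tail_side_def head_side_def crossed_arc_def)
  qed
qed

end

theorem proposition2p23:
  fixes S :: "'p marked_surface" and \<Delta> :: "'p curve set" and \<P> :: "'p polygon set"
    and \<alpha> :: "'p curve" and \<gamma> :: "'p crossings"
    and w :: "'p angle letter list" and \<sigma>s :: "'p angle letter list list"
  defines "Q \<equiv> gentle_quiver \<Delta> \<P>"
    and "A \<equiv> (gentle_algebra \<Delta> \<P> :: (('p curve, 'p angle) qpath, 'k::alg_closed_field) alg)"
    and "M \<equiv> zigzag_module \<Delta> \<P> \<gamma> w"
    and "P \<equiv> cpoly \<gamma> 0" and "P' \<equiv> cpoly \<gamma> (clast \<gamma> + 1)"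
    and "n \<equiv> num_edges (cpoly \<gamma> 0)" and "m \<equiv> num_edges (cpoly \<gamma> (clast \<gamma> + 1))"
    and "\<l> \<equiv> edge_arc (cpoly \<gamma> 0)" and "\<iota> \<equiv> edge_arc (cpoly \<gamma> (clast \<gamma> + 1))"
    and "r \<equiv> length \<sigma>s"
    and "\<sigma> \<equiv> (\<lambda>i. \<sigma>s ! (i - 1))"
    and "\<nu> \<equiv> (\<lambda>i. letter_target (gentle_quiver \<Delta> \<P>) (last (\<sigma>s ! (i - 1))))"
    and "a \<equiv> num_edges (cpoly \<gamma> 0) - start_weight \<gamma>"
    and "b \<equiv> num_edges (cpoly \<gamma> (clast \<gamma> + 1)) - end_weight \<gamma>"
  assumes "simple_coordinate S \<Delta> \<P>"
    and "zigzag_arc S \<Delta> \<P> \<alpha> \<gamma>"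
    and "\<alpha> 0 \<in> white_points S" and "\<alpha> 1 \<in> white_points S"
    and "associated_string S \<gamma> w"
    and "maximal_decomposition w \<sigma>s" and "1 \<le> r"
  shows "(direct_word (\<sigma> 1) \<and> inverse_word (\<sigma> r) \<longrightarrow>
      resolved_by A M
        (map \<l> (rev [a..<n+1]) @ map \<nu> [1..<r] @ map \<iota> [b..<m+1])
        (descending_links P a @ map (\<lambda>i. word_link Q (\<sigma> i)) [1..<r+1] @ ascending_links P' b)) \<and>
    (direct_word (\<sigma> 1) \<and> direct_word (\<sigma> r) \<longrightarrow>
      resolved_by A M
        (map \<l> (rev [a..<n+1]) @ map \<nu> [1..<r] @ map \<iota> [b+1..<m+1])
        (descending_links P a @ map (\<lambda>i. word_link Q (\<sigma> i)) [1..<r] @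
         (if b < m then Leftwards (path_append (word_path Q (\<sigma> r)) (angle_path P' b))
                          # ascending_links P' (b+1) else []))) \<and>
    (inverse_word (\<sigma> 1) \<and> inverse_word (\<sigma> r) \<longrightarrow>
      resolved_by A M
        (map \<l> (rev [a+1..<n+1]) @ map \<nu> [1..<r] @ map \<iota> [b..<m+1])
        ((if a < n then descending_links P (a+1) @
                          [Rightwards (path_append (word_path Q (\<sigma> 1)) (angle_path P a))] else []) @
         map (\<lambda>i. word_link Q (\<sigma> i)) [2..<r+1] @ ascending_links P' b)) \<and>
    (inverse_word (\<sigma> 1) \<and> direct_word (\<sigma> r) \<longrightarrow>
      resolved_by A M
        (map \<l> (rev [a+1..<n+1]) @ map \<nu> [1..<r] @ map \<iota> [b+1..<m+1])
        ((if a < n then descending_links P (a+1) @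
                          [Rightwards (path_append (word_path Q (\<sigma> 1)) (angle_path P a))] else []) @
         map (\<lambda>i. word_link Q (\<sigma> i)) [2..<r] @
         (if b < m then Leftwards (path_append (word_path Q (\<sigma> r)) (angle_path P' b))
                          # ascending_links P' (b+1) else [])))"
proof -
  interpret simple_coordinate S \<Delta> \<P> by fact
  interpret crosses_along \<P> \<alpha> \<gamma> using \<open>zigzag_arc S \<Delta> \<P> \<alpha> \<gamma>\<close> by (simp add: zigzag_arc_def)
  interpret gs: gentle_string Q "gentle_relations \<Delta> \<P>" tail_side head_side "crossed_arc \<gamma>"
      "\<lambda>j. snd (edge (cpoly \<gamma> j) (cout \<gamma> j))" w
    unfolding Q_def by (rule gentle_string_zigzag) fact+
  have len: "length w = clast \<gamma>" using \<open>associated_string S \<gamma> w\<close> by (simp add: associated_string_def)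
  have ex: "1 \<le> cout \<gamma> 0" "cout \<gamma> 0 \<le> n" using exit[of 0] by (simp_all add: n_def)
  have en: "1 \<le> cin \<gamma> (clast \<gamma> + 1)" "cin \<gamma> (clast \<gamma> + 1) \<le> m" using entry[of "clast \<gamma> + 1"] by (simp_all add: m_def)
  have ab: "a = cout \<gamma> 0" "b = cin \<gamma> (clast \<gamma> + 1)"
    using ex en by (simp_all add: a_def b_def start_weight_def end_weight_def n_def m_def)
  have bounds: "1 \<le> a" "a \<le> n" "1 \<le> b" "b \<le> m" using ex en ab by simp_all
  have PP: "P \<in> \<P>" "P' \<in> \<P>" using polys[of 0] polys[of "clast \<gamma> + 1"] by (simp_all add: P_def P'_def)
  have end_segment: "clift \<gamma> i t \<in> cball 0 1 \<and> param (cpoly \<gamma> i) (clift \<gamma> i t) = \<alpha> t"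
    if "i \<le> clast \<gamma> + 1" "t = seg_start \<gamma> i \<or> t = seg_end \<gamma> i" for i t
  proof -
    have "t \<in> {seg_start \<gamma> i..seg_end \<gamma> i}" using times[OF that(1)] that(2) by auto
    moreover from this have "clift \<gamma> i t \<in> segment \<gamma> i" by (simp add: segment_def)
    ultimately show ?thesis using lift_closed[OF that(1)] lift[OF that(1)] by blast
  qed
  have unp: "\<not> punctured P"
  proof -
    have "clift \<gamma> 0 0 \<in> cball 0 1 \<and> param P (clift \<gamma> 0 0) = \<alpha> 0"
      using end_segment[of 0 0] by (simp add: P_def seg_start_def)
    then show ?thesis using white_unpunctured[OF PP(1), of "clift \<gamma> 0 0"] \<open>\<alpha> 0 \<in> white_points S\<close> by simp
  qed
  have unp': "\<not> punctured P'"
  proof -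
    let ?z = "clift \<gamma> (clast \<gamma> + 1) 1"
    have "?z \<in> cball 0 1 \<and> param P' ?z = \<alpha> 1"
      using end_segment[of "clast \<gamma> + 1" 1] by (simp add: P'_def seg_end_def)
    then show ?thesis using white_unpunctured[OF PP(2), of ?z] \<open>\<alpha> 1 \<in> white_points S\<close> by simp
  qed
  define X where "X = map (\<lambda>i. (P, i)) [a..<n]"
  define Y where "Y = map (\<lambda>i. (P', i)) [b..<m]"
  have "edge P a = (crossed_arc \<gamma> 0, snd (edge (cpoly \<gamma> 0) (cout \<gamma> 0)))"
    by (simp add: ab P_def crossed_arc_def edge_arc_def)
  then have X: "gs.relation_chain (crossed_arc \<gamma> 0, snd (edge (cpoly \<gamma> 0) (cout \<gamma> 0))) X"
    using relation_chain_polygon[OF PP(1) unp, of a] bounds by (simp add: X_def Q_def n_def P_def)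
  have last_edge: "edge P' b = (crossed_arc \<gamma> (length w), \<not> snd (edge (cpoly \<gamma> (length w)) (cout \<gamma> (length w))))"
    using opposite_sides[of "clast \<gamma>"]
    by (auto simp: ab P'_def crossed_arc_def edge_arc_def len prod_eq_iff)
  then have Y: "gs.relation_chain (crossed_arc \<gamma> (length w), \<not> snd (edge (cpoly \<gamma> (length w)) (cout \<gamma> (length w)))) Y"
    using relation_chain_polygon[OF PP(2) unp', of b] bounds by (simp add: Y_def Q_def m_def P'_def)
  have head_X: "map (head Q) (rev X) = map \<l> (rev [a + 1..<n + 1])"
  proof -
    have "map (head Q) X = map (\<lambda>i. \<l> (Suc i)) [a..<n]"
      by (simp add: X_def Q_def gentle_quiver_def next_edge_def \<l>_def n_def P_def)
    also have "\<dots> = map \<l> (map Suc [a..<n])" by simp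
    also have "\<dots> = map \<l> [a + 1..<n + 1]" by (simp only: map_Suc_upt Suc_eq_plus1)
    finally show ?thesis by (simp only: rev_map[symmetric])
  qed
  have head_Y: "map (head Q) Y = map \<iota> [b + 1..<m + 1]"
  proof -
    have "map (head Q) Y = map (\<lambda>i. \<iota> (Suc i)) [b..<m]"
      by (simp add: Y_def Q_def gentle_quiver_def next_edge_def \<iota>_def m_def P'_def)
    also have "\<dots> = map \<iota> (map Suc [b..<m])" by simp
    also have "\<dots> = map \<iota> [b + 1..<m + 1]" by (simp only: map_Suc_upt Suc_eq_plus1)
    finally show ?thesis .
  qed
  have nodes_X: "map \<l> (rev [a..<n + 1]) = map \<l> (rev [a + 1..<n + 1]) @ [crossed_arc \<gamma> 0]"
  proof -
    have "[a..<n + 1] = a # [a + 1..<n + 1]"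
      using bounds(2) by (metis Suc_eq_plus1 le_imp_less_Suc upt_conv_Cons)
    moreover have "\<l> a = crossed_arc \<gamma> 0" by (simp add: \<l>_def crossed_arc_def ab)
    ultimately show ?thesis by (simp only: rev.simps map_append list.map)
  qed
  have nodes_Y: "map \<iota> [b..<m + 1] = crossed_arc \<gamma> (length w) # map \<iota> [b + 1..<m + 1]"
  proof -
    have "\<iota> b = crossed_arc \<gamma> (length w)" using last_edge by (simp add: \<iota>_def P'_def edge_arc_def)
    moreover have "[b..<m + 1] = b # [b + 1..<m + 1]"
      using bounds(4) by (metis Suc_eq_plus1 le_imp_less_Suc upt_conv_Cons)
    ultimately show ?thesis by (simp only: list.map)
  qed
  have tail: "(tail Q (R, i), [(R, i)]) = angle_path R i" for R i
    by (simp add: Q_def gentle_quiver_def angle_path_def)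
  have X_Cons: "X = (if a < n then (P, a) # map (\<lambda>i. (P, i)) [a + 1..<n] else [])"
    by (simp add: X_def upt_conv_Cons)
  have Y_Cons: "Y = (if b < m then (P', b) # map (\<lambda>i. (P', i)) [b + 1..<m] else [])"
    by (simp add: Y_def upt_conv_Cons)
  have desc: "descending_links P c = map (\<lambda>a. Rightwards (tail Q a, [a])) (rev (map (\<lambda>i. (P, i)) [c..<n]))" for c
    by (simp add: descending_links_def tail rev_map n_def P_def)
  have asc: "ascending_links P' c = map (\<lambda>a. Leftwards (tail Q a, [a])) (map (\<lambda>i. (P', i)) [c..<m])" for c
    by (simp add: ascending_links_def tail m_def P'_def)
  have desc_a: "descending_links P a = (if a < n then descending_links P (a + 1) @ [Rightwards (angle_path P a)] else [])"
    by (simp add: desc tail upt_conv_Cons[of a])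
  have asc_b: "ascending_links P' b = (if b < m then Leftwards (angle_path P' b) # ascending_links P' (b + 1) else [])"
    by (simp add: asc tail upt_conv_Cons[of b])
  have links_X: "(if X = [] then [] else map (\<lambda>a. Rightwards (tail Q a, [a])) (rev (tl X)) @
       [Rightwards (if D then (tail Q (hd X), [hd X]) else path_append p (tail Q (hd X), [hd X]))]) =
     (if a < n then descending_links P (a + 1) @
       [Rightwards (if D then angle_path P a else path_append p (angle_path P a))] else [])" for D p
    by (simp add: X_Cons desc tail)
  have links_Y: "(if Y = [] then [] else
       Leftwards (if D then (tail Q (hd Y), [hd Y]) else path_append p (tail Q (hd Y), [hd Y])) #
       map (\<lambda>a. Leftwards (tail Q a, [a])) (tl Y)) =
     (if b < m then Leftwards (if D then angle_path P' b else path_append p (angle_path P' b)) #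
       ascending_links P' (b + 1) else [])" for D p
    by (simp add: Y_Cons asc tail)
  have kind: "inverse_word (\<sigma> r) \<longleftrightarrow> \<not> direct_word (\<sigma> r)" "inverse_word (\<sigma> 1) \<longleftrightarrow> \<not> direct_word (\<sigma> 1)"
  proof -
    have "r - 1 < length \<sigma>s" "1 - 1 < length \<sigma>s" using \<open>1 \<le> r\<close> unfolding r_def by linarith+
    then have "\<sigma> r \<in> set \<sigma>s" "\<sigma> 1 \<in> set \<sigma>s" unfolding \<sigma>_def by (blast intro: nth_mem)+
    then have "direct_word (\<sigma> r) \<or> inverse_word (\<sigma> r)" "direct_word (\<sigma> 1) \<or> inverse_word (\<sigma> 1)"
      using \<open>maximal_decomposition w \<sigma>s\<close> unfolding maximal_decomposition_def by blast+
    moreover have "\<not> (direct_word l \<and> inverse_word l)" for l :: "'p angle letter list"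
      by (cases l) (auto simp: direct_word_def inverse_word_def)
    ultimately show "inverse_word (\<sigma> r) \<longleftrightarrow> \<not> direct_word (\<sigma> r)" "inverse_word (\<sigma> 1) \<longleftrightarrow> \<not> direct_word (\<sigma> 1)"
      by blast+
  qed
  have A: "A = bound_quiver_algebra Q (gentle_relations \<Delta> \<P>)" by (simp add: A_def gentle_algebra_def Q_def)
  have M: "M = string_module Q (crossed_arc \<gamma> 0) w" by (simp add: M_def zigzag_module_def Q_def)
  have \<nu>': "\<nu> = (\<lambda>i. letter_target Q (last (\<sigma>s ! (i - 1))))" by (simp add: \<nu>_def Q_def)
  note parts = gs.maximal_parts_resolved[where ?'k = 'k, OF \<open>maximal_decomposition w \<sigma>s\<close> \<open>1 \<le> r\<close>[unfolded r_def] X Y,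
      unfolded links_X links_Y head_X head_Y]
  have res: "resolved_by A M
     (map \<l> (rev [a + 1..<n + 1]) @ (if direct_word (\<sigma> 1) then [crossed_arc \<gamma> 0] else []) @
      map \<nu> [1..<r] @ (if inverse_word (\<sigma> r) then [crossed_arc \<gamma> (length w)] else []) @ map \<iota> [b + 1..<m + 1])
     ((if a < n then descending_links P (a + 1) @
        [Rightwards (if direct_word (\<sigma> 1) then angle_path P a
          else path_append (word_path Q (\<sigma> 1)) (angle_path P a))] else []) @
      map (\<lambda>i. word_link Q (\<sigma> i)) [(if direct_word (\<sigma> 1) then 1 else 2)..<(if inverse_word (\<sigma> r) then r + 1 else r)] @
      (if b < m then Leftwards (if inverse_word (\<sigma> r) then angle_path P' b
          else path_append (word_path Q (\<sigma> r)) (angle_path P' b)) # ascending_links P' (b + 1) else []))"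
    using parts unfolding A M \<nu>' r_def \<sigma>_def diff_self_eq_0 .
  show ?thesis
    unfolding nodes_X nodes_Y desc_a asc_b using res kind by auto
qed

end
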